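(* Consider the MIMO multiway relay channel $(M,N,K)$ with pairwise data exchange described in the context, with $K=3$ users. For all positive integers $M,N$, the per-user DoF capacity equals $$d_{\mathrm{user}}=\begin{cases} M, & \frac{M}{N}<\frac{2}{3},\\[2pt] \frac{2N}{3}, & \frac{M}{N}\ge \frac{2}{3},\end{cases}$$ and this value is achievable.
   Context: MIMO multiway relay channel (mRC) $(M,N,K)$ with pairwise data exchange: $K$ users, each with $M$ antennas, communicate via a single relay with $N$ antennas ($M,N$ positive integers); there are no direct user-to-user links. Communication uses two phases of $T$ channel uses each. Uplink: the relay receives $\mathbf{Y}_R=\sum_{k=1}^K\mathbf{H}_k\mathbf{X}_k+\mathbf{Z}_R$, where $\mathbf{H}_k\in\mathbb{C}^{N\times M}$, $\mathbf{X}_k\in\mathbb{C}^{M\times T}$ is user $k$'s transmit signal with $\frac1T\mathrm{tr}(\mathbf{X}_k\mathbf{X}_k^H)\le P$, and $\mathbf{Z}_R$ has i.i.d. $\mathcal{CN}(0,\sigma^2)$ entries. Downlink: the relay transmits $\mathbf{X}_R\in\mathbb{C}^{N\times T}$, a function of $\mathbf{Y}_R$, with $\frac1T\mathrm{tr}(\mathbf{X}_R\mathbf{X}_R^H)\le P$; user $k$ receives $\mathbf{Y}_k=\mathbf{G}_k\mathbf{X}_R+\mathbf{Z}_k$ with $\mathbf{G}_k\in\mathbb{C}^{M\times N}$ and $\mathbf{Z}_k$ having i.i.d. $\mathcal{CN}(0,\sigma^2)$ entries. The entries of all channel matrices $\mathbf{H}_k,\mathbf{G}_k$ are drawn from a continuous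 distribution and are perfectly known at all nodes. Pairwise data exchange: for every ordered pair $k\neq k'$, user $k$ has an independent message $W^{(k,k')}$ of rate $R^{(k,k')}$ intended for user $k'$, who decodes it from $\mathbf{Y}_{k'}$ and its own messages; rates are achievable if all decoding error probabilities tend to $0$ as $T\to\infty$. Let $\mathrm{SNR}=P/\sigma^2$ and $C_k(\mathrm{SNR})=\sum_{k'\neq k}R^{(k,k')}$. The total DoF of a family of achievable rates is $d_{\mathrm{sum}}=\lim_{\mathrm{SNR}\to\infty}\frac{\sum_{k=1}^K C_k(\mathrm{SNR})}{\log \mathrm{SNR}}$ and the per-user DoF is $d_{\mathrm{user}}=d_{\mathrm{sum}}/K$. A DoF value is achievable if it is attained by some transmission scheme (possibly using symbol extensions over several channel uses) for almost all channel realizations; the per-user DoF capacity is the supremum of achievable per-user DoF values. *)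

theory Defs
  imports "HOL-Probability.Probability"
begin

text \<open>MIMO multiway relay channel (M,N,K) with pairwise data exchange.
Users are indexed 0..K-1.  Matrices are functions nat => nat => complex,
only the entries inside the stated dimensions are meaningful.
All logarithms (rates, DoF denominator) are to base 2.\<close>

type_synonym cmat = "nat \<Rightarrow> nat \<Rightarrow> complex"
type_synonym msgs = "nat \<times> nat \<Rightarrow> nat"

text \<open>A block code of length T: message-set sizes, user encoders (applied to the
user's own messages), relay map, and user decoders (applied to the received block
and the user's own messages, returning an estimate of the message from each source k).\<close>
record mrc_code =
  code_sz    :: "nat \<times> nat \<Rightarrow> nat"
  code_enc   :: "nat \<Rightarrow> msgs \<Rightarrow> cmat"
  code_relay :: "cmat \<Rightarrow> cmat"
  code_dec   :: "nat \<Rightarrow> cmat \<Rightarrow> msgs \<Rightarrow> nat \<Rightarrow> nat"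

definition pairs :: "nat \<Rightarrow> (nat \<times> nat) set" where
  "pairs K = {(k, k'). k < K \<and> k' < K \<and> k \<noteq> k'}"

definition msg_set :: "nat \<Rightarrow> (nat \<times> nat \<Rightarrow> nat) \<Rightarrow> msgs set" where
  "msg_set K sz = {w. (\<forall>p\<in>pairs K. w p < sz p) \<and> (\<forall>p. p \<notin> pairs K \<longrightarrow> w p = 0)}"

definition own :: "nat \<Rightarrow> msgs \<Rightarrow> msgs" where
  "own k w = (\<lambda>p. if fst p = k then w p else 0)"

definition mmul :: "nat \<Rightarrow> cmat \<Rightarrow> cmat \<Rightarrow> cmat" where
  "mmul n A B = (\<lambda>i t. \<Sum>j<n. A i j * B j t)"

definition trunc :: "nat \<Rightarrow> nat \<Rightarrow> cmat \<Rightarrow> cmat" where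
  "trunc r T A = (\<lambda>i t. if i < r \<and> t < T then A i t else 0)"

definition frob :: "nat \<Rightarrow> nat \<Rightarrow> cmat \<Rightarrow> real" where
  "frob r T A = (\<Sum>i<r. \<Sum>t<T. (cmod (A i t))\<^sup>2)"

text \<open>Noise entries: (0,i,t) relay noise, (Suc k,i,t) noise at user k.\<close>
definition noise_idx :: "nat \<Rightarrow> nat \<Rightarrow> nat \<Rightarrow> nat \<Rightarrow> (nat \<times> nat \<times> nat) set" where
  "noise_idx K M N T =
     {(0, i, t) | i t. i < N \<and> t < T} \<union> {(Suc k, i, t) | k i t. k < K \<and> i < M \<and> t < T}"

definition cgauss :: "real \<Rightarrow> complex measure" where
  "cgauss s2 = distr
     (density lborel (normal_density 0 (sqrt (s2 / 2))) \<Otimes>\<^sub>M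
      density lborel (normal_density 0 (sqrt (s2 / 2))))
     borel (\<lambda>(a, b). Complex a b)"

definition noise_meas :: "nat \<Rightarrow> nat \<Rightarrow> nat \<Rightarrow> nat \<Rightarrow> real \<Rightarrow> (nat \<times> nat \<times> nat \<Rightarrow> complex) measure" where
  "noise_meas K M N T s2 = PiM (noise_idx K M N T) (\<lambda>_. cgauss s2)"

definition relay_rx ::
  "nat \<Rightarrow> nat \<Rightarrow> nat \<Rightarrow> nat \<Rightarrow> (nat \<Rightarrow> cmat) \<Rightarrow> mrc_code \<Rightarrow> msgs \<Rightarrow> (nat \<times> nat \<times> nat \<Rightarrow> complex) \<Rightarrow> cmat" where
  "relay_rx K M N T H c w z =
     trunc N T (\<lambda>i t. (\<Sum>k<K. mmul M (H k) (code_enc c k (own k w)) i t) + z (0, i, t))"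

definition user_rx ::
  "nat \<Rightarrow> nat \<Rightarrow> nat \<Rightarrow> nat \<Rightarrow> (nat \<Rightarrow> cmat) \<Rightarrow> (nat \<Rightarrow> cmat) \<Rightarrow> mrc_code \<Rightarrow> msgs
     \<Rightarrow> (nat \<times> nat \<times> nat \<Rightarrow> complex) \<Rightarrow> nat \<Rightarrow> cmat" where
  "user_rx K M N T H G c w z k' =
     trunc M T (\<lambda>i t. mmul N (G k') (code_relay c (relay_rx K M N T H c w z)) i t + z (Suc k', i, t))"

definition err_event ::
  "nat \<Rightarrow> nat \<Rightarrow> nat \<Rightarrow> nat \<Rightarrow> real \<Rightarrow> (nat \<Rightarrow> cmat) \<Rightarrow> (nat \<Rightarrow> cmat) \<Rightarrow> mrc_code \<Rightarrow> msgs
     \<Rightarrow> nat \<times> nat \<Rightarrow> (nat \<times> nat \<times> nat \<Rightarrow> complex) set" where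
  "err_event K M N T s2 H G c w p =
     {z \<in> space (noise_meas K M N T s2).
        code_dec c (snd p) (user_rx K M N T H G c w z (snd p)) (own (snd p) w) (fst p) \<noteq> w p}"

definition err_prob ::
  "nat \<Rightarrow> nat \<Rightarrow> nat \<Rightarrow> nat \<Rightarrow> real \<Rightarrow> (nat \<Rightarrow> cmat) \<Rightarrow> (nat \<Rightarrow> cmat) \<Rightarrow> mrc_code \<Rightarrow> nat \<times> nat \<Rightarrow> real" where
  "err_prob K M N T s2 H G c p =
     (\<Sum>w\<in>msg_set K (code_sz c). measure (noise_meas K M N T s2) (err_event K M N T s2 H G c w p))
       / real (card (msg_set K (code_sz c)))"

definition valid_code ::
  "nat \<Rightarrow> nat \<Rightarrow> nat \<Rightarrow> nat \<Rightarrow> real \<Rightarrow> real \<Rightarrow> (nat \<Rightarrow> cmat) \<Rightarrow> (nat \<Rightarrow> cmat) \<Rightarrow> mrc_code \<Rightarrow> bool" where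
  "valid_code K M N T P s2 H G c \<longleftrightarrow>
     (\<forall>w\<in>msg_set K (code_sz c). \<forall>k<K. frob M T (code_enc c k (own k w)) \<le> real T * P) \<and>
     (\<forall>Y. frob N T (code_relay c Y) \<le> real T * P) \<and>
     (\<forall>w\<in>msg_set K (code_sz c). \<forall>p\<in>pairs K.
        err_event K M N T s2 H G c w p \<in> sets (noise_meas K M N T s2))"

definition achievable_rates ::
  "nat \<Rightarrow> nat \<Rightarrow> nat \<Rightarrow> real \<Rightarrow> real \<Rightarrow> (nat \<Rightarrow> cmat) \<Rightarrow> (nat \<Rightarrow> cmat) \<Rightarrow> (nat \<times> nat \<Rightarrow> real) \<Rightarrow> bool" where
  "achievable_rates K M N P s2 H G R \<longleftrightarrow>
     (\<forall>p\<in>pairs K. 0 \<le> R p) \<and>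
     (\<exists>c :: nat \<Rightarrow> mrc_code.
        (\<forall>T. valid_code K M N T P s2 H G (c T)) \<and>
        (\<forall>T. \<forall>p\<in>pairs K. 2 powr (real T * R p) \<le> real (code_sz (c T) p)) \<and>
        (\<forall>p\<in>pairs K. (\<lambda>T. err_prob K M N T s2 H G (c T) p) \<longlonglongrightarrow> 0))"

definition dof_achievable_at ::
  "nat \<Rightarrow> nat \<Rightarrow> nat \<Rightarrow> real \<Rightarrow> (nat \<Rightarrow> cmat) \<Rightarrow> (nat \<Rightarrow> cmat) \<Rightarrow> real \<Rightarrow> bool" where
  "dof_achievable_at K M N s2 H G d \<longleftrightarrow>
     (\<exists>R :: real \<Rightarrow> nat \<times> nat \<Rightarrow> real.
        (\<forall>snr>0. achievable_rates K M N (snr * s2) s2 H G (R snr)) \<and>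
        ((\<lambda>snr. (\<Sum>p\<in>pairs K. R snr p) / log 2 snr) \<longlongrightarrow> real K * d) at_top)"

text \<open>Channel realizations are parametrised by 4KMN real numbers (real and imaginary
parts of all entries of H_k (N x M) and G_k (M x N)).\<close>
definition chan_dim :: "nat \<Rightarrow> nat \<Rightarrow> nat \<Rightarrow> nat" where
  "chan_dim K M N = 4 * K * M * N"

definition chan_H :: "nat \<Rightarrow> nat \<Rightarrow> nat \<Rightarrow> (nat \<Rightarrow> real) \<Rightarrow> nat \<Rightarrow> cmat" where
  "chan_H K M N v k i j =
     (if k < K \<and> i < N \<and> j < M
      then Complex (v (2 * ((k * N + i) * M + j))) (v (2 * ((k * N + i) * M + j) + 1)) else 0)"

definition chan_G :: "nat \<Rightarrow> nat \<Rightarrow> nat \<Rightarrow> (nat \<Rightarrow> real) \<Rightarrow> nat \<Rightarrow> cmat" where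
  "chan_G K M N v k i j =
     (if k < K \<and> i < M \<and> j < N
      then Complex (v (2 * K * N * M + 2 * ((k * M + i) * N + j)))
                   (v (2 * K * N * M + 2 * ((k * M + i) * N + j) + 1)) else 0)"

definition dof_achievable :: "nat \<Rightarrow> nat \<Rightarrow> nat \<Rightarrow> real \<Rightarrow> real \<Rightarrow> bool" where
  "dof_achievable K M N s2 d \<longleftrightarrow>
     (AE v in PiM {..<chan_dim K M N} (\<lambda>_. lborel).
        dof_achievable_at K M N s2 (chan_H K M N v) (chan_G K M N v) d)"

definition per_user_dof_capacity :: "nat \<Rightarrow> nat \<Rightarrow> nat \<Rightarrow> real \<Rightarrow> real" where
  "per_user_dof_capacity K M N s2 = Sup {d. dof_achievable K M N s2 d}"

end

theory Submission
  imports Defs "HOL-Real_Asymp.Real_Asymp" "Jordan_Normal_Form.Determinant"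
begin

text \<open>Converse: a Gaussian centred at a point of bounded energy is dominated, up to a factor of order
  \<open>(1 + SNR)\<close> per complex dimension, by one centred Gaussian of variance \<open>(1 + SNR) s2\<close>. Disjoint decoding
  regions therefore number at most \<open>(1 + SNR)\<close> to the number of dimensions. Applied to the \<open>N\<close> relay antennas
  with a genie this bounds two complementary triples of rates by \<open>N\<close> degrees of freedom each; applied to the
  \<open>M\<close> antennas of each user it bounds the incoming rates.

  Achievability: the two symbols exchanged by a pair of users are aligned in the signal space of the relay,
  which receives their sum, forwards it linearly, and keeps it invisible to the third user. For
  \<open>2 N \<le> 3 M\<close> the intersections of the column spaces of the users leave room for \<open>N\<close> such sums per channel use;
  for \<open>3 M \<le> 2 N\<close> the relay compresses two channel uses to \<open>3 M\<close> dimensions, which gives \<open>3 M\<close> sums.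
  The required nonsingularity is a determinant condition, hence holds almost everywhere once it holds for a
  single channel. Each resulting scalar channel carries a Gilbert-Varshamov code on the integer grid;
  this loses only a bounded rate, and the only random event to control is that the noise energy is
  atypically large.\<close>

section \<open>Gaussian noise\<close>

text \<open>Relay map and decoders are arbitrary functions and only error events are known to be
  measurable, so the blocks received by the users need not be random variables and have no entropy
  to estimate. Counting disjoint regions under one dominating measure uses nothing but those events.
  The variance is widened by the same SNR that scales the permitted power, so the exponential factor
  is \<open>exp (h * T)\<close> with \<open>h\<close> free of SNR and vanishes in the limit.

  For \<open>3 M < 2 N\<close> two channel uses give column spaces of dimension \<open>2 M\<close>
  in dimension \<open>2 N\<close>, whose generic pairwise intersections have dimension
  \<open>max 0 (4 M - 2 N) < M\<close>. Projection to \<open>3 M\<close> dimensions enlarges each of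
  them to \<open>M\<close> while the triple intersection stays trivial. Two uses are taken because
  \<open>3 M / 2\<close> need not be an integer.

  Grid spacing and relay gain are fixed relative to the noise; SNR enters the code only through the
  side \<open>q\<close> of the grid. A squared distance linear in the block length, with a slope
  free of SNR, then beats all typical noise. One exceptional event serves every message, so no union
  bound over codewords arises.\<close>

lemma sets_cgauss [simp, measurable_cong]: "sets (cgauss s) = sets borel"
  by (simp add: cgauss_def)

lemma space_cgauss [simp]: "space (cgauss s) = UNIV"
  by (simp add: cgauss_def)

lemma measurable_case_Complex [measurable]: "case_prod Complex \<in> borel_measurable (borel \<Otimes>\<^sub>M borel)"
proof -
  have "case_prod Complex = (\<lambda>p. complex_of_real (fst p) + \<i> * complex_of_real (snd p))"
    by (auto simp: fun_eq_iff complex_eq_iff)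
  then show ?thesis by simp
qed

lemma prob_space_cgauss:
  assumes "0 < s" shows "prob_space (cgauss s)"
proof -
  let ?N = "density lborel (normal_density 0 (sqrt (s / 2)))"
  interpret N: prob_space ?N by (rule prob_space_normal_density) (use assms in simp)
  interpret NN: pair_prob_space ?N ?N ..
  show ?thesis unfolding cgauss_def
  proof (rule NN.prob_space_distr)
    have "sets (?N \<Otimes>\<^sub>M ?N) = sets (borel \<Otimes>\<^sub>M borel)" by (rule sets_pair_measure_cong) auto
    then show "case_prod Complex \<in> ?N \<Otimes>\<^sub>M ?N \<rightarrow>\<^sub>M borel"
      using measurable_case_Complex measurable_cong_sets by blast
  qed
qed

lemma nn_integral_cgauss:
  assumes "0 < s" and [measurable]: "f \<in> borel_measurable borel"
  shows "(\<integral>\<^sup>+ z. f z \<partial>cgauss s) =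
    (\<integral>\<^sup>+ a. \<integral>\<^sup>+ b. ennreal (normal_density 0 (sqrt (s/2)) a) * (ennreal (normal_density 0 (sqrt (s/2)) b) * f (Complex a b)) \<partial>lborel \<partial>lborel)"
proof -
  let ?N = "density lborel (normal_density 0 (sqrt (s / 2)))"
  interpret N: prob_space ?N by (rule prob_space_normal_density) (use assms in simp)
  interpret NN: pair_prob_space ?N ?N ..
  have fC: "(\<lambda>p. f (case_prod Complex p)) \<in> borel_measurable (borel \<Otimes>\<^sub>M borel)" by measurable
  have NN_sets: "sets (?N \<Otimes>\<^sub>M ?N) = sets (borel \<Otimes>\<^sub>M borel)" by (rule sets_pair_measure_cong) auto
  have fC': "(\<lambda>p. f (case_prod Complex p)) \<in> borel_measurable (?N \<Otimes>\<^sub>M ?N)"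
    using fC measurable_cong_sets[OF NN_sets refl] by blast
  have Cm: "case_prod Complex \<in> ?N \<Otimes>\<^sub>M ?N \<rightarrow>\<^sub>M borel"
    using measurable_case_Complex measurable_cong_sets[OF NN_sets refl] by blast
  have Ca[measurable]: "(\<lambda>b. f (Complex a b)) \<in> borel_measurable borel" for a
    using measurable_compose[OF _ fC, of "\<lambda>b. (a, b)" borel] by simp
  have "(\<integral>\<^sup>+ z. f z \<partial>cgauss s) = (\<integral>\<^sup>+ p. f (case_prod Complex p) \<partial>(?N \<Otimes>\<^sub>M ?N))"
    unfolding cgauss_def by (rule nn_integral_distr[OF Cm]) simp
  also have "\<dots> = (\<integral>\<^sup>+ a. \<integral>\<^sup>+ b. f (Complex a b) \<partial>?N \<partial>?N)"
    using N.nn_integral_fst[OF fC', symmetric] by simp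
  also have "\<dots> = (\<integral>\<^sup>+ a. \<integral>\<^sup>+ b. ennreal (normal_density 0 (sqrt (s/2)) b) * f (Complex a b) \<partial>lborel \<partial>?N)"
    by (intro nn_integral_cong nn_integral_density) auto
  also have "\<dots> = (\<integral>\<^sup>+ a. ennreal (normal_density 0 (sqrt (s/2)) a) * (\<integral>\<^sup>+ b. ennreal (normal_density 0 (sqrt (s/2)) b) * f (Complex a b) \<partial>lborel) \<partial>lborel)"
  proof (rule nn_integral_density)
    have "(\<lambda>p. ennreal (normal_density 0 (sqrt (s/2)) (snd p)) * f (case_prod Complex p)) \<in> borel_measurable (borel \<Otimes>\<^sub>M borel)"
      by (intro borel_measurable_times_ennreal fC) measurable
    also have "(\<lambda>p. ennreal (normal_density 0 (sqrt (s/2)) (snd p)) * f (case_prod Complex p))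
        = (\<lambda>(a, b). ennreal (normal_density 0 (sqrt (s/2)) b) * f (Complex a b))"
      by (simp add: fun_eq_iff split: prod.split)
    finally have "(\<lambda>(a, b). ennreal (normal_density 0 (sqrt (s/2)) b) * f (Complex a b)) \<in> borel_measurable (lborel \<Otimes>\<^sub>M lborel)"
      using measurable_cong_sets[OF sets_pair_measure_cong[OF sets_lborel sets_lborel] refl] by blast
    then show "(\<lambda>a. \<integral>\<^sup>+ b. ennreal (normal_density 0 (sqrt (s/2)) b) * f (Complex a b) \<partial>lborel) \<in> borel_measurable lborel"
      by (intro lborel.borel_measurable_nn_integral) 
  qed auto
  also have "\<dots> = (\<integral>\<^sup>+ a. \<integral>\<^sup>+ b. ennreal (normal_density 0 (sqrt (s/2)) a) * (ennreal (normal_density 0 (sqrt (s/2)) b) * f (Complex a b)) \<partial>lborel \<partial>lborel)"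
    by (intro nn_integral_cong nn_integral_cmult[symmetric]) auto
  finally show ?thesis .
qed

section \<open>Likelihood ratios of shifted Gaussians against wider centred ones\<close>

definition shift_ratio :: "real \<Rightarrow> real \<Rightarrow> real \<Rightarrow> real \<Rightarrow> real" where
  "shift_ratio s s' x y = normal_density x (sqrt (s/2)) y / normal_density 0 (sqrt (s'/2)) y"

lemma shift_ratio_nonneg: "0 \<le> shift_ratio s s' x y"
  by (simp add: shift_ratio_def)

lemma shift_ratio_measurable [measurable]: "shift_ratio s s' x \<in> borel_measurable borel"
  unfolding shift_ratio_def[abs_def] by measurable

text \<open>Completing the square: the exponents differ by
  \<open>(a * y - (1 + a) * x)\<^sup>2 / (a * (1 + a))\<close> over \<open>s\<close>, which is
  nonnegative for every \<open>y\<close>. At equal variances the ratio would be unbounded in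
  \<open>y\<close>. The wider reference costs \<open>sqrt (1 + a)\<close> per real dimension, and
  with \<open>a\<close> equal to the SNR the remaining exponent is signal energy over permitted
  power.\<close>

lemma shift_ratio_le:
  assumes s: "0 < s" and a: "0 < a"
  shows "shift_ratio s ((1 + a) * s) x y \<le> sqrt (1 + a) * exp (x\<^sup>2 / (a * s))"
proof -
  have sq: "0 \<le> (a * y - (1 + a) * x)\<^sup>2 / (a * (1 + a))" using a by simp
  have "y\<^sup>2 / (1 + a) + (a * y - (1 + a) * x)\<^sup>2 / (a * (1 + a)) = (y - x)\<^sup>2 + x\<^sup>2 / a"
    using a by (simp add: divide_simps) (simp add: power2_eq_square algebra_simps)
  with sq have "y\<^sup>2 / (1 + a) \<le> (y - x)\<^sup>2 + x\<^sup>2 / a" by linarith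
  then have "y\<^sup>2 / (1 + a) / s \<le> ((y - x)\<^sup>2 + x\<^sup>2 / a) / s" using s by (intro divide_right_mono) auto
  then have le: "- (y - x)\<^sup>2 / s + y\<^sup>2 / ((1 + a) * s) \<le> x\<^sup>2 / (a * s)"
    by (simp add: add_divide_distrib)
  have "shift_ratio s ((1 + a) * s) x y
      = (sqrt (pi * ((1 + a) * s)) / sqrt (pi * s)) * (exp (- (y - x)\<^sup>2 / s) / exp (- y\<^sup>2 / ((1 + a) * s)))"
    using s a by (simp add: shift_ratio_def normal_density_def)
  also have "sqrt (pi * ((1 + a) * s)) / sqrt (pi * s) = sqrt (1 + a)"
    using s a by (simp add: real_sqrt_mult)
  also have "exp (- (y - x)\<^sup>2 / s) / exp (- y\<^sup>2 / ((1 + a) * s)) = exp (- (y - x)\<^sup>2 / s + y\<^sup>2 / ((1 + a) * s))"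
    by (simp add: exp_diff[symmetric])
  finally show ?thesis using le a by simp
qed

lemma shift_ratio_refl: "0 < s \<Longrightarrow> shift_ratio s s 0 y = 1"
  by (simp add: shift_ratio_def) (metis less_irrefl normal_density_pos half_gt_zero real_sqrt_gt_zero)

lemma nn_integral_shift_normal:
  assumes "0 < s'" and [measurable]: "f \<in> borel_measurable borel"
  shows "(\<integral>\<^sup>+ a. ennreal (normal_density 0 (sqrt (s/2)) a) * f (a + x) \<partial>lborel)
       = (\<integral>\<^sup>+ a. ennreal (normal_density 0 (sqrt (s'/2)) a) * (ennreal (shift_ratio s s' x a) * f a) \<partial>lborel)"
proof -
  have "(\<integral>\<^sup>+ a. ennreal (normal_density 0 (sqrt (s/2)) (a - x)) * f a \<partial>lborel)
      = ennreal \<bar>1\<bar> * (\<integral>\<^sup>+ a. ennreal (normal_density 0 (sqrt (s/2)) (x + 1 * a - x)) * f (x + 1 * a) \<partial>lborel)"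
    by (rule nn_integral_real_affine) auto
  then have "(\<integral>\<^sup>+ a. ennreal (normal_density 0 (sqrt (s/2)) a) * f (a + x) \<partial>lborel)
    = (\<integral>\<^sup>+ a. ennreal (normal_density 0 (sqrt (s/2)) (a - x)) * f a \<partial>lborel)"
    by (simp add: add.commute)
  also have "\<dots> = (\<integral>\<^sup>+ a. ennreal (normal_density 0 (sqrt (s'/2)) a) * (ennreal (shift_ratio s s' x a) * f a) \<partial>lborel)"
  proof (intro nn_integral_cong)
    fix a :: real
    have "normal_density 0 (sqrt (s'/2)) a \<noteq> 0"
      using normal_density_pos[of "sqrt (s'/2)" 0 a] assms(1) by simp
    then have "normal_density 0 (sqrt (s/2)) (a - x) = normal_density 0 (sqrt (s'/2)) a * shift_ratio s s' x a"
      by (simp add: shift_ratio_def normal_density_def)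
    then show "ennreal (normal_density 0 (sqrt (s/2)) (a - x)) * f a
        = ennreal (normal_density 0 (sqrt (s'/2)) a) * (ennreal (shift_ratio s s' x a) * f a)"
      by (simp add: ennreal_mult shift_ratio_nonneg mult.assoc)
  qed
  finally show ?thesis .
qed

definition cshift_ratio :: "real \<Rightarrow> real \<Rightarrow> complex \<Rightarrow> complex \<Rightarrow> real" where
  "cshift_ratio s s' x z = shift_ratio s s' (Re x) (Re z) * shift_ratio s s' (Im x) (Im z)"

lemma cshift_ratio_nonneg: "0 \<le> cshift_ratio s s' x z"
  by (simp add: cshift_ratio_def shift_ratio_nonneg)

lemma cshift_ratio_measurable [measurable]: "cshift_ratio s s' x \<in> borel_measurable borel"
  unfolding cshift_ratio_def[abs_def] by measurable

lemma cshift_ratio_le: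
  assumes "0 < s" "0 < a"
  shows "cshift_ratio s ((1 + a) * s) x z \<le> (1 + a) * exp ((cmod x)\<^sup>2 / (a * s))"
proof -
  have "cshift_ratio s ((1 + a) * s) x z \<le>
    (sqrt (1 + a) * exp ((Re x)\<^sup>2 / (a * s))) * (sqrt (1 + a) * exp ((Im x)\<^sup>2 / (a * s)))"
    unfolding cshift_ratio_def using assms
    by (intro mult_mono shift_ratio_le) (auto simp: shift_ratio_nonneg)
  also have "\<dots> = (sqrt (1 + a) * sqrt (1 + a)) * exp ((Re x)\<^sup>2 / (a * s) + (Im x)\<^sup>2 / (a * s))"
    by (simp only: exp_add mult_ac)
  also have "\<dots> = (1 + a) * exp ((Re x)\<^sup>2 / (a * s) + (Im x)\<^sup>2 / (a * s))"
    using assms by simp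
  also have "\<dots> = (1 + a) * exp ((cmod x)\<^sup>2 / (a * s))"
    by (simp add: cmod_power2 add_divide_distrib)
  finally show ?thesis .
qed

lemma nn_integral_shift_cgauss:
  assumes s: "0 < s" and s': "0 < s'" and f[measurable]: "f \<in> borel_measurable borel"
  shows "(\<integral>\<^sup>+ z. f (z + x) \<partial>cgauss s) = (\<integral>\<^sup>+ z. ennreal (cshift_ratio s s' x z) * f z \<partial>cgauss s')"
proof -
  let ?n = "\<lambda>s a. ennreal (normal_density 0 (sqrt (s/2)) a)"
  let ?r = "\<lambda>x a. ennreal (shift_ratio s s' x a)"
  have Cm[measurable]: "(\<lambda>b. Complex a b) \<in> borel_measurable borel" for a
    using measurable_compose[OF _ measurable_case_Complex, of "\<lambda>b. (a, b)" borel] by simp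
  have fC: "(\<lambda>p. f (case_prod Complex p)) \<in> borel_measurable (borel \<Otimes>\<^sub>M borel)" by measurable
  have "(\<integral>\<^sup>+ z. f (z + x) \<partial>cgauss s)
      = (\<integral>\<^sup>+ a. \<integral>\<^sup>+ b. ?n s a * (?n s b * f (Complex (a + Re x) (b + Im x))) \<partial>lborel \<partial>lborel)"
  proof -
    have "Complex a b + x = Complex (a + Re x) (b + Im x)" for a b by (simp add: complex_eq_iff)
    then show ?thesis by (subst nn_integral_cgauss[OF s]) auto
  qed
  also have "\<dots> = (\<integral>\<^sup>+ a. ?n s a * (\<integral>\<^sup>+ b. ?n s b * f (Complex (a + Re x) (b + Im x)) \<partial>lborel) \<partial>lborel)"
    by (intro nn_integral_cong nn_integral_cmult) measurable
  also have "\<dots> = (\<integral>\<^sup>+ a. ?n s a * (\<integral>\<^sup>+ b. ?n s' b * (?r (Im x) b * f (Complex (a + Re x) b)) \<partial>lborel) \<partial>lborel)"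
    by (intro nn_integral_cong arg_cong2[of _ _ _ _ "(*)"] refl nn_integral_shift_normal s') measurable
  also have "\<dots> = (\<integral>\<^sup>+ a. ?n s' a * (?r (Re x) a * (\<integral>\<^sup>+ b. ?n s' b * (?r (Im x) b * f (Complex a b)) \<partial>lborel)) \<partial>lborel)"
  proof (rule nn_integral_shift_normal[OF s'])
    have "(\<lambda>p. ?n s' (snd p) * (?r (Im x) (snd p) * f (case_prod Complex p))) \<in> borel_measurable (borel \<Otimes>\<^sub>M borel)"
      by (intro borel_measurable_times_ennreal fC) measurable
    also have "(\<lambda>p. ?n s' (snd p) * (?r (Im x) (snd p) * f (case_prod Complex p)))
        = (\<lambda>(a, b). ?n s' b * (?r (Im x) b * f (Complex a b)))"
      by (simp add: fun_eq_iff split: prod.split)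
    finally have "(\<lambda>(a, b). ?n s' b * (?r (Im x) b * f (Complex a b))) \<in> borel_measurable (borel \<Otimes>\<^sub>M lborel)"
      using measurable_cong_sets[OF sets_pair_measure_cong[OF refl sets_lborel] refl] by blast
    then show "(\<lambda>a. \<integral>\<^sup>+ b. ?n s' b * (?r (Im x) b * f (Complex a b)) \<partial>lborel) \<in> borel_measurable borel"
      by (intro lborel.borel_measurable_nn_integral) 
  qed
  also have "\<dots> = (\<integral>\<^sup>+ a. \<integral>\<^sup>+ b. ?n s' a * (?n s' b * (ennreal (cshift_ratio s s' x (Complex a b)) * f (Complex a b))) \<partial>lborel \<partial>lborel)"
  proof (intro nn_integral_cong)
    fix a :: real
    have "?n s' a * (?r (Re x) a * (\<integral>\<^sup>+ b. ?n s' b * (?r (Im x) b * f (Complex a b)) \<partial>lborel))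
        = (?n s' a * ?r (Re x) a) * (\<integral>\<^sup>+ b. ?n s' b * (?r (Im x) b * f (Complex a b)) \<partial>lborel)"
      by (simp add: mult.assoc)
    also have "\<dots> = (\<integral>\<^sup>+ b. (?n s' a * ?r (Re x) a) * (?n s' b * (?r (Im x) b * f (Complex a b))) \<partial>lborel)"
      by (rule nn_integral_cmult[symmetric]) measurable
    also have "\<dots> = (\<integral>\<^sup>+ b. ?n s' a * (?n s' b * (ennreal (cshift_ratio s s' x (Complex a b)) * f (Complex a b))) \<partial>lborel)"
      by (intro nn_integral_cong) (simp add: cshift_ratio_def ennreal_mult shift_ratio_nonneg mult_ac)
    finally show "?n s' a * (?r (Re x) a * (\<integral>\<^sup>+ b. ?n s' b * (?r (Im x) b * f (Complex a b)) \<partial>lborel)) = \<dots>" .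
  qed
  also have "\<dots> = (\<integral>\<^sup>+ z. ennreal (cshift_ratio s s' x z) * f z \<partial>cgauss s')"
    by (subst nn_integral_cgauss[OF s']) auto
  finally show ?thesis .
qed

text \<open>\<open>(cmod z)\<^sup>2 / s\<close> is a standard exponential variable, whose moment
  generating function at \<open>1/2\<close> equals \<open>2\<close>. On densities, the tilt doubles
  the variance of each real component and leaves a factor \<open>sqrt 2\<close>.\<close>

lemma nn_integral_exp_cgauss:
  assumes s: "0 < s"
  shows "(\<integral>\<^sup>+ z. ennreal (exp ((cmod z)\<^sup>2 / (2 * s))) \<partial>cgauss s) = 2"
proof -
  let ?n = "\<lambda>a. ennreal (normal_density 0 (sqrt (s/2)) a)"
  let ?m = "\<lambda>a. ennreal (normal_density 0 (sqrt s) a)"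
  have e: "ennreal (exp (a\<^sup>2 / (2 * s))) * ?n a = ennreal (sqrt 2) * ?m a" for a
  proof -
    have "exp (a\<^sup>2 / (2 * s)) * normal_density 0 (sqrt (s/2)) a = sqrt 2 * normal_density 0 (sqrt s) a"
    proof -
      have "sqrt (2 * pi * s) = sqrt 2 * sqrt (pi * s)" by (simp add: real_sqrt_mult)
      moreover have "exp (a\<^sup>2 / (2 * s)) * exp (- a\<^sup>2 / s) = exp (- a\<^sup>2 / (2 * s))"
        using s by (simp add: exp_add[symmetric] divide_simps)
      ultimately show ?thesis using s by (simp add: normal_density_def)
    qed
    then show ?thesis by (simp add: ennreal_mult[symmetric])
  qed
  have one: "(\<integral>\<^sup>+ a. ?m a \<partial>lborel) = 1"
  proof -
    interpret prob_space "density lborel (normal_density 0 (sqrt s))"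
      by (rule prob_space_normal_density) (use s in simp)
    show ?thesis using emeasure_space_1 by (simp add: emeasure_density)
  qed
  have "(\<integral>\<^sup>+ z. ennreal (exp ((cmod z)\<^sup>2 / (2 * s))) \<partial>cgauss s)
     = (\<integral>\<^sup>+ a. \<integral>\<^sup>+ b. (ennreal (exp (a\<^sup>2 / (2 * s))) * ?n a) * (ennreal (exp (b\<^sup>2 / (2 * s))) * ?n b) \<partial>lborel \<partial>lborel)"
    by (subst nn_integral_cgauss[OF s])
       (auto simp: cmod_power2 add_divide_distrib exp_add ennreal_mult mult_ac intro!: nn_integral_cong)
  also have "\<dots> = (\<integral>\<^sup>+ a. \<integral>\<^sup>+ b. (ennreal (sqrt 2) * ?m a) * (ennreal (sqrt 2) * ?m b) \<partial>lborel \<partial>lborel)"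
    unfolding e ..
  also have "\<dots> = (\<integral>\<^sup>+ a. (ennreal (sqrt 2) * ?m a) * (ennreal (sqrt 2) * 1) \<partial>lborel)"
    by (simp add: nn_integral_cmult one)
  also have "\<dots> = (ennreal (sqrt 2) * 1) * (ennreal (sqrt 2) * 1)"
    by (simp add: nn_integral_cmult nn_integral_multc one)
  also have "\<dots> = 2" by (simp add: ennreal_mult[symmetric] del: ennreal_numeral) simp
  finally show ?thesis .
qed

lemma product_sigma_finite_cgauss:
  assumes "\<And>i. 0 < s i" shows "product_sigma_finite (\<lambda>i. cgauss (s i))"
  unfolding product_sigma_finite_def
  using prob_space_cgauss[OF assms] prob_space_imp_sigma_finite by blast

lemma sets_PiM_cgauss: "sets (PiM I (\<lambda>i. cgauss (s i))) = sets (PiM I (\<lambda>_. borel))"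
  by (rule sets_PiM_cong) auto

text \<open>This domination replaces the entropy estimates of the usual converse.\<close>
lemma emeasure_shift_cgauss_le:
  fixes x :: "'i \<Rightarrow> complex"
  assumes I: "finite I" and W: "W \<subseteq> I" and s: "0 < s" and a: "0 < a"
    and A: "A \<in> sets (PiM I (\<lambda>_. cgauss s))" and x: "\<And>i. i \<in> I - W \<Longrightarrow> x i = 0"
  shows "emeasure (PiM I (\<lambda>_. cgauss s)) {z \<in> space (PiM I (\<lambda>_. cgauss s)). (\<lambda>i\<in>I. z i + x i) \<in> A}
     \<le> ennreal ((1 + a) ^ card W * exp ((\<Sum>i\<in>W. (cmod (x i))\<^sup>2) / (a * s)))
        * emeasure (PiM I (\<lambda>i. cgauss (if i \<in> W then (1 + a) * s else s))) A"
proof -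
  define s' where "s' i = (if i \<in> W then (1 + a) * s else s)" for i
  have s'pos: "0 < s' i" for i using s a by (simp add: s'_def)
  let ?P = "PiM I (\<lambda>_. cgauss s)" and ?Q = "PiM I (\<lambda>i. cgauss (s' i))"
  define g where "g i = cshift_ratio s (s' i) (x i)" for i
  have g[measurable]: "g i \<in> borel_measurable borel" for i by (simp add: g_def)
  interpret P: product_sigma_finite "\<lambda>i::'i. cgauss s" by (rule product_sigma_finite_cgauss) (rule s)
  interpret Q: product_sigma_finite "\<lambda>i. cgauss (s' i)" by (rule product_sigma_finite_cgauss) (rule s'pos)
  let ?D = "\<lambda>i. distr (cgauss s) borel (\<lambda>z. z + x i)"
  have Dprob: "prob_space (?D i)" for i
    by (rule prob_space.prob_space_distr[OF prob_space_cgauss[OF s]]) simp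
  interpret D: product_sigma_finite ?D
    unfolding product_sigma_finite_def using Dprob prob_space_imp_sigma_finite by blast
  let ?sh = "\<lambda>z. \<lambda>i\<in>I. z i + x i"
  have setsP: "sets ?P = sets (PiM I (\<lambda>_. borel))" and setsQ: "sets ?Q = sets (PiM I (\<lambda>_. borel))"
    by (rule sets_PiM_cgauss)+
  have setsD: "sets (PiM I ?D) = sets (PiM I (\<lambda>_. borel))" by (rule sets_PiM_cong) auto
  have sh: "?sh \<in> ?P \<rightarrow>\<^sub>M PiM I (\<lambda>_. borel)" by measurable
  have eD: "emeasure (?D i) B = (\<integral>\<^sup>+ z. ennreal (g i z) * indicator B z \<partial>cgauss (s' i))" if "B \<in> sets borel" for i B
  proof -
    have "emeasure (?D i) B = (\<integral>\<^sup>+ z. indicator B z \<partial>?D i)" using that by (simp)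
    also have "\<dots> = (\<integral>\<^sup>+ z. indicator B (z + x i) \<partial>cgauss s)"
      by (rule nn_integral_distr) (use that in auto)
    also have "\<dots> = (\<integral>\<^sup>+ z. ennreal (g i z) * indicator B z \<partial>cgauss (s' i))"
      unfolding g_def by (rule nn_integral_shift_cgauss[OF s s'pos]) (use that in auto)
    finally show ?thesis .
  qed
  \<comment> \<open>The law of the shifted noise and, in \<open>2\<close>, the reweighted wide
    Gaussian are both identified with the product of the shifted marginals by their values on boxes;
    hence they coincide.\<close>
  have 1: "distr ?P (PiM I (\<lambda>_. borel)) ?sh = PiM I ?D"
  proof (rule D.PiM_eqI[OF I])
    show "sets (distr ?P (PiM I (\<lambda>_. borel)) ?sh) = sets (PiM I ?D)" by (simp add: setsD)
    fix B assume B: "\<And>i. i \<in> I \<Longrightarrow> B i \<in> sets (?D i)"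
    then have B': "\<And>i. i \<in> I \<Longrightarrow> B i \<in> sets borel" by simp
    then have Bm: "Pi\<^sub>E I B \<in> sets (PiM I (\<lambda>_. borel))" using I by (intro sets_PiM_I_finite) auto
    have "emeasure (distr ?P (PiM I (\<lambda>_. borel)) ?sh) (Pi\<^sub>E I B) = emeasure ?P (?sh -` Pi\<^sub>E I B \<inter> space ?P)"
      by (rule emeasure_distr[OF sh Bm])
    also have "?sh -` Pi\<^sub>E I B \<inter> space ?P = Pi\<^sub>E I (\<lambda>i. (\<lambda>z. z + x i) -` B i)"
      by (auto simp: space_PiM PiE_iff)
    also have "emeasure ?P \<dots> = (\<Prod>i\<in>I. emeasure (cgauss s) ((\<lambda>z. z + x i) -` B i))"
    proof (rule P.emeasure_PiM[OF I])
      fix i assume "i \<in> I"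
      have "(\<lambda>z. z + x i) -` B i \<inter> space (borel::complex measure) \<in> sets borel"
        by (rule measurable_sets[of _ borel borel]) (use B'[OF \<open>i \<in> I\<close>] in auto)
      then show "(\<lambda>z. z + x i) -` B i \<in> sets (cgauss s)" by simp
    qed
    also have "\<dots> = (\<Prod>i\<in>I. emeasure (?D i) (B i))"
      by (intro prod.cong refl, subst emeasure_distr) (use B' in auto)
    finally show "emeasure (distr ?P (PiM I (\<lambda>_. borel)) ?sh) (Pi\<^sub>E I B) = (\<Prod>i\<in>I. emeasure (?D i) (B i))" .
  qed
  let ?G = "\<lambda>z. \<Prod>i\<in>I. ennreal (g i (z i))"
  have Gm[measurable]: "?G \<in> borel_measurable ?Q" by measurable
  have 2: "density ?Q ?G = PiM I ?D"
  proof (rule D.PiM_eqI[OF I])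
    show "sets (density ?Q ?G) = sets (PiM I ?D)" by (simp add: setsD setsQ)
    fix B assume B: "\<And>i. i \<in> I \<Longrightarrow> B i \<in> sets (?D i)"
    then have B': "\<And>i. i \<in> I \<Longrightarrow> B i \<in> sets borel" by simp
    then have Bm: "Pi\<^sub>E I B \<in> sets ?Q" using I by (intro sets_PiM_I_finite) auto
    have "emeasure (density ?Q ?G) (Pi\<^sub>E I B) = (\<integral>\<^sup>+ z. ?G z * indicator (Pi\<^sub>E I B) z \<partial>?Q)"
      by (rule emeasure_density[OF Gm Bm])
    also have "\<dots> = (\<integral>\<^sup>+ z. (\<Prod>i\<in>I. ennreal (g i (z i)) * indicator (B i) (z i)) \<partial>?Q)"
    proof (rule nn_integral_cong)
      fix z assume "z \<in> space ?Q"
      then have "(indicator (Pi\<^sub>E I B) z :: ennreal) = (\<Prod>i\<in>I. indicator (B i) (z i))"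
        using I by (auto simp: space_PiM PiE_iff indicator_def split: if_splits)
      then show "?G z * indicator (Pi\<^sub>E I B) z = (\<Prod>i\<in>I. ennreal (g i (z i)) * indicator (B i) (z i))"
        by (simp add: prod.distrib)
    qed
    also have "\<dots> = (\<Prod>i\<in>I. \<integral>\<^sup>+ z. ennreal (g i z) * indicator (B i) z \<partial>cgauss (s' i))"
      by (rule Q.product_nn_integral_prod[OF I]) (use B' in auto)
    also have "\<dots> = (\<Prod>i\<in>I. emeasure (?D i) (B i))"
      using eD B' by (intro prod.cong) auto
    finally show "emeasure (density ?Q ?G) (Pi\<^sub>E I B) = (\<Prod>i\<in>I. emeasure (?D i) (B i))" .
  qed
  \<comment> \<open>Coordinates outside \<open>W\<close> keep mean and variance, so their factor is
    exactly \<open>1\<close> and only \<open>card W\<close> coordinates pay for the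
    domination.\<close>
  have gle: "g i z \<le> (if i \<in> W then (1 + a) * exp ((cmod (x i))\<^sup>2 / (a * s)) else 1)" if "i \<in> I" for i z
  proof (cases "i \<in> W")
    case True
    then show ?thesis using cshift_ratio_le[OF s a, of "x i" z] by (simp add: g_def s'_def)
  next
    case False
    then show ?thesis using x[of i] that s by (simp add: g_def s'_def cshift_ratio_def shift_ratio_refl)
  qed
  have Gle: "?G z \<le> ennreal ((1 + a) ^ card W * exp ((\<Sum>i\<in>W. (cmod (x i))\<^sup>2) / (a * s)))" for z
  proof -
    have fW: "finite W" using I W finite_subset by blast
    have "?G z = ennreal (\<Prod>i\<in>I. g i (z i))"
      by (rule prod_ennreal) (simp add: g_def cshift_ratio_nonneg)
    also have "\<dots> \<le> ennreal (\<Prod>i\<in>I. if i \<in> W then (1 + a) * exp ((cmod (x i))\<^sup>2 / (a * s)) else 1)"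
      by (intro ennreal_leI prod_mono) (use gle in \<open>auto simp: g_def cshift_ratio_nonneg\<close>)
    also have "(\<Prod>i\<in>I. if i \<in> W then (1 + a) * exp ((cmod (x i))\<^sup>2 / (a * s)) else 1)
       = (\<Prod>i\<in>W. (1 + a) * exp ((cmod (x i))\<^sup>2 / (a * s)))"
      using I W by (simp add: prod.If_cases Int_absorb1)
    also have "\<dots> = (1 + a) ^ card W * exp ((\<Sum>i\<in>W. (cmod (x i))\<^sup>2) / (a * s))"
      using fW by (simp add: prod.distrib exp_sum sum_divide_distrib)
    finally show ?thesis .
  qed
  have A': "A \<in> sets (PiM I (\<lambda>_. borel))" using A setsP by simp
  have "emeasure ?P {z \<in> space ?P. ?sh z \<in> A} = emeasure (distr ?P (PiM I (\<lambda>_. borel)) ?sh) A"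
    by (subst emeasure_distr[OF sh A']) (auto intro!: arg_cong[of _ _ "emeasure ?P"])
  also have "\<dots> = emeasure (density ?Q ?G) A" unfolding 1 2 ..
  also have "\<dots> = (\<integral>\<^sup>+ z. ?G z * indicator A z \<partial>?Q)"
    by (rule emeasure_density[OF Gm]) (use A' setsQ in simp)
  also have "\<dots> \<le> (\<integral>\<^sup>+ z. ennreal ((1 + a) ^ card W * exp ((\<Sum>i\<in>W. (cmod (x i))\<^sup>2) / (a * s))) * indicator A z \<partial>?Q)"
    by (intro nn_integral_mono mult_right_mono Gle) auto
  also have "\<dots> = ennreal ((1 + a) ^ card W * exp ((\<Sum>i\<in>W. (cmod (x i))\<^sup>2) / (a * s))) * emeasure ?Q A"
    by (rule nn_integral_cmult_indicator) (use A' setsQ in simp)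
  finally show ?thesis unfolding s'_def .
qed

text \<open>Chernoff bound: each coordinate contributes a factor \<open>2\<close> to the exponential
  moment and a factor \<open>exp 1\<close> to the threshold, which lies at twice the mean energy. As
  \<open>2 < exp 1\<close>, the tail decays geometrically.\<close>

lemma cgauss_energy_tail:
  assumes I: "finite I" and s: "0 < s"
  shows "measure (PiM I (\<lambda>_. cgauss s)) {z \<in> space (PiM I (\<lambda>_. cgauss s)). 2 * s * card I < (\<Sum>i\<in>I. (cmod (z i))\<^sup>2)}
     \<le> (2 / exp 1) ^ card I"
proof -
  let ?P = "PiM I (\<lambda>_. cgauss s)"
  interpret P: product_sigma_finite "\<lambda>i::'a. cgauss s" by (rule product_sigma_finite_cgauss) (rule s)
  interpret PP: prob_space ?P by (rule prob_space_PiM) (rule prob_space_cgauss[OF s])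
  let ?u = "\<lambda>z. \<Prod>i\<in>I. ennreal (exp ((cmod (z i))\<^sup>2 / (2 * s)))"
  let ?S = "{z \<in> space ?P. 2 * s * card I < (\<Sum>i\<in>I. (cmod (z i))\<^sup>2)}"
  have S: "?S \<in> sets ?P" by measurable
  have u: "?u \<in> borel_measurable ?P" by measurable
  have int: "(\<integral>\<^sup>+ z. ?u z \<partial>?P) = 2 ^ card I"
    by (subst P.product_nn_integral_prod[OF I]) (auto simp: nn_integral_exp_cgauss[OF s])
  have key: "ennreal (exp (card I)) * indicator ?S z \<le> ?u z" for z
  proof (cases "z \<in> ?S")
    case True
    have "real (card I) \<le> (\<Sum>i\<in>I. (cmod (z i))\<^sup>2) / (2 * s)"
      using True s by (simp add: field_simps)
    then have "exp (card I) \<le> exp ((\<Sum>i\<in>I. (cmod (z i))\<^sup>2) / (2 * s))" by simp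
    also have "\<dots> = (\<Prod>i\<in>I. exp ((cmod (z i))\<^sup>2 / (2 * s)))" using I by (simp add: exp_sum sum_divide_distrib)
    finally show ?thesis using True by (simp add: prod_ennreal ennreal_leI)
  qed simp
  have "ennreal (exp (card I)) * emeasure ?P ?S = (\<integral>\<^sup>+ z. ennreal (exp (card I)) * indicator ?S z \<partial>?P)"
    using S by (simp add: nn_integral_cmult_indicator)
  also have "\<dots> \<le> 2 ^ card I" unfolding int[symmetric] by (intro nn_integral_mono key)
  finally have "ennreal (exp (card I) * measure ?P ?S) \<le> ennreal (2 ^ card I)"
    by (simp add: PP.emeasure_eq_measure ennreal_mult ennreal_power[symmetric])
  then have "exp (card I) * measure ?P ?S \<le> 2 ^ card I" by (simp add: ennreal_le_iff)
  then have "measure ?P ?S \<le> 2 ^ card I / exp (card I)" by (simp add: field_simps)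
  also have "\<dots> = (2 / exp 1) ^ card I" by (simp add: power_divide exp_of_nat_mult[symmetric])
  finally show ?thesis .
qed

section \<open>The converse\<close>

text \<open>Submultiplicativity of the Frobenius norm, by Cauchy-Schwarz on each entry. It converts
  power constraints at a transmitter into energy bounds at a receiver, and later controls every
  linear map of the coding scheme.\<close>

lemma energy_product:
  fixes A :: "'i \<Rightarrow> 'q \<Rightarrow> complex"
  shows "(\<Sum>i\<in>I. \<Sum>t\<in>T. (cmod (\<Sum>q\<in>Q. A i q * B q t))\<^sup>2)
    \<le> (\<Sum>i\<in>I. \<Sum>q\<in>Q. (cmod (A i q))\<^sup>2) * (\<Sum>q\<in>Q. \<Sum>t\<in>T. (cmod (B q t))\<^sup>2)"
proof -
  have cs: "(cmod (\<Sum>q\<in>Q. A i q * B q t))\<^sup>2 \<le> (\<Sum>q\<in>Q. (cmod (A i q))\<^sup>2) * (\<Sum>q\<in>Q. (cmod (B q t))\<^sup>2)" for i t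
  proof -
    have "cmod (\<Sum>q\<in>Q. A i q * B q t) \<le> (\<Sum>q\<in>Q. cmod (A i q) * cmod (B q t))"
      by (rule order.trans[OF norm_sum]) (simp add: norm_mult)
    then have "(cmod (\<Sum>q\<in>Q. A i q * B q t))\<^sup>2 \<le> (\<Sum>q\<in>Q. cmod (A i q) * cmod (B q t))\<^sup>2"
      by (intro power_mono) auto
    also have "\<dots> \<le> (\<Sum>q\<in>Q. (cmod (A i q))\<^sup>2) * (\<Sum>q\<in>Q. (cmod (B q t))\<^sup>2)"
      by (rule Cauchy_Schwarz_ineq_sum)
    finally show ?thesis .
  qed
  have "(\<Sum>i\<in>I. \<Sum>t\<in>T. (cmod (\<Sum>q\<in>Q. A i q * B q t))\<^sup>2)
     \<le> (\<Sum>i\<in>I. \<Sum>t\<in>T. (\<Sum>q\<in>Q. (cmod (A i q))\<^sup>2) * (\<Sum>q\<in>Q. (cmod (B q t))\<^sup>2))"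
    by (intro sum_mono cs)
  also have "\<dots> = (\<Sum>i\<in>I. \<Sum>q\<in>Q. (cmod (A i q))\<^sup>2) * (\<Sum>t\<in>T. \<Sum>q\<in>Q. (cmod (B q t))\<^sup>2)"
    by (rule sum_product[symmetric])
  also have "(\<Sum>t\<in>T. \<Sum>q\<in>Q. (cmod (B q t))\<^sup>2) = (\<Sum>q\<in>Q. \<Sum>t\<in>T. (cmod (B q t))\<^sup>2)"
    by (rule sum.swap)
  finally show ?thesis .
qed

section \<open>Message sets, genie fibres and the number of decodable messages\<close>

lemma trunc_cong: "(\<And>i t. i < r \<Longrightarrow> t < T \<Longrightarrow> f i t = g i t) \<Longrightarrow> trunc r T f = trunc r T g"
  by (simp add: trunc_def fun_eq_iff)

lemma finite_noise_idx: "finite (noise_idx K M N T)"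
proof -
  have "noise_idx K M N T \<subseteq> {..K} \<times> {..<max M N} \<times> {..<T}"
    by (auto simp: noise_idx_def)
  then show ?thesis by (rule finite_subset) auto
qed

lemma finite_pairs: "finite (pairs K)"
  by (rule finite_subset[of _ "{..<K} \<times> {..<K}"]) (auto simp: pairs_def)

lemma card_msg_fibre:
  assumes Q: "Q \<subseteq> pairs K" and w: "w \<in> msg_set K sz"
  shows "card {g \<in> msg_set K sz. \<forall>p. p \<notin> Q \<longrightarrow> w p = g p} = (\<Prod>p\<in>Q. sz p)"
proof -
  have finQ: "finite Q" using Q finite_pairs finite_subset by blast
  have "bij_betw (\<lambda>g. restrict g Q) {g \<in> msg_set K sz. \<forall>p. p \<notin> Q \<longrightarrow> w p = g p} (Pi\<^sub>E Q (\<lambda>p. {..<sz p}))"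
  proof (rule bij_betw_byWitness[where f' = "\<lambda>h p. if p \<in> Q then h p else w p"])
    show "\<forall>g\<in>{g \<in> msg_set K sz. \<forall>p. p \<notin> Q \<longrightarrow> w p = g p}. (\<lambda>p. if p \<in> Q then restrict g Q p else w p) = g"
      by (auto simp: fun_eq_iff)
    show "\<forall>h\<in>Pi\<^sub>E Q (\<lambda>p. {..<sz p}). restrict (\<lambda>p. if p \<in> Q then h p else w p) Q = h"
      by (auto simp: fun_eq_iff PiE_def extensional_def)
    show "(\<lambda>g. restrict g Q) ` {g \<in> msg_set K sz. \<forall>p. p \<notin> Q \<longrightarrow> w p = g p} \<subseteq> Pi\<^sub>E Q (\<lambda>p. {..<sz p})"
      using Q by (auto simp: msg_set_def)
    show "(\<lambda>h p. if p \<in> Q then h p else w p) ` Pi\<^sub>E Q (\<lambda>p. {..<sz p}) \<subseteq> {g \<in> msg_set K sz. \<forall>p. p \<notin> Q \<longrightarrow> w p = g p}"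
      using Q w by (auto simp: msg_set_def PiE_def Pi_def)
  qed
  then have "card {g \<in> msg_set K sz. \<forall>p. p \<notin> Q \<longrightarrow> w p = g p} = card (Pi\<^sub>E Q (\<lambda>p. {..<sz p}))"
    by (rule bij_betw_same_card)
  also have "\<dots> = (\<Prod>p\<in>Q. sz p)" using finQ by (simp add: card_PiE)
  finally show ?thesis .
qed

lemma finite_msg_set: "finite (msg_set K sz)"
proof -
  have "msg_set K sz \<subseteq> (\<lambda>h p. if p \<in> pairs K then h p else 0) ` (PiE (pairs K) (\<lambda>p. {..<sz p}))"
  proof
    fix w assume w: "w \<in> msg_set K sz"
    have "w = (\<lambda>p. if p \<in> pairs K then restrict w (pairs K) p else 0)"
      using w by (auto simp: msg_set_def fun_eq_iff)
    moreover have "restrict w (pairs K) \<in> PiE (pairs K) (\<lambda>p. {..<sz p})"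
      using w by (auto simp: msg_set_def)
    ultimately show "w \<in> (\<lambda>h p. if p \<in> pairs K then h p else 0) ` (PiE (pairs K) (\<lambda>p. {..<sz p}))"
      by (rule image_eqI)
  qed
  then show ?thesis by (rule finite_subset) (intro finite_imageI finite_PiE finite_pairs, auto)
qed

lemma zero_in_msg_set:
  assumes "\<And>p. p \<in> pairs K \<Longrightarrow> 0 < sz p" shows "(\<lambda>_. 0) \<in> msg_set K sz"
  using assms by (simp add: msg_set_def)

text \<open>Conditioning on the messages outside \<open>Q\<close> plays the role of the genie.\<close>
lemma sum_msg_set_le_of_fibres:
  fixes f :: "msgs \<Rightarrow> real"
  assumes Q: "Q \<subseteq> pairs K"
    and le: "\<And>g. g \<in> msg_set K sz \<Longrightarrow> (\<Sum>w | w \<in> msg_set K sz \<and> (\<forall>p. p \<notin> Q \<longrightarrow> w p = g p). f w) \<le> C"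
  shows "(\<Prod>p\<in>Q. real (sz p)) * (\<Sum>w\<in>msg_set K sz. f w) \<le> C * card (msg_set K sz)"
proof -
  let ?W = "msg_set K sz"
  have "(\<Prod>p\<in>Q. real (sz p)) * (\<Sum>w\<in>?W. f w) = (\<Sum>w\<in>?W. \<Sum>g | g \<in> ?W \<and> (\<forall>p. p \<notin> Q \<longrightarrow> w p = g p). f w)"
    using card_msg_fibre[OF Q] by (simp add: sum_distrib_left flip: of_nat_prod)
  also have "\<dots> = (\<Sum>w\<in>?W. \<Sum>g\<in>?W. if \<forall>p. p \<notin> Q \<longrightarrow> w p = g p then f w else 0)"
    by (rule sum.cong[OF refl], rule sum.inter_filter[OF finite_msg_set])
  also have "\<dots> = (\<Sum>g\<in>?W. \<Sum>w\<in>?W. if \<forall>p. p \<notin> Q \<longrightarrow> w p = g p then f w else 0)"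
    by (rule sum.swap)
  also have "\<dots> = (\<Sum>g\<in>?W. \<Sum>w | w \<in> ?W \<and> (\<forall>p. p \<notin> Q \<longrightarrow> w p = g p). f w)"
    by (rule sum.cong[OF refl], rule sum.inter_filter[OF finite_msg_set, symmetric])
  also have "\<dots> \<le> (\<Sum>g\<in>?W. C)" by (intro sum_mono le)
  finally show ?thesis by (simp add: mult.commute)
qed

lemma prob_space_noise_meas: "0 < s2 \<Longrightarrow> prob_space (noise_meas K M N T s2)"
  unfolding noise_meas_def by (intro prob_space_PiM prob_space_cgauss)

definition correct_event ::
  "nat \<Rightarrow> nat \<Rightarrow> nat \<Rightarrow> nat \<Rightarrow> real \<Rightarrow> (nat \<Rightarrow> cmat) \<Rightarrow> (nat \<Rightarrow> cmat) \<Rightarrow> mrc_code \<Rightarrow> (nat \<times> nat) set \<Rightarrow> msgs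
     \<Rightarrow> (nat \<times> nat \<times> nat \<Rightarrow> complex) set" where
  "correct_event K M N T s2 H G c D w =
     {z \<in> space (noise_meas K M N T s2). \<forall>p\<in>D.
        code_dec c (snd p) (user_rx K M N T H G c w z (snd p)) (own (snd p) w) (fst p) = w p}"

lemma correct_event_eq:
  "correct_event K M N T s2 H G c D w = space (noise_meas K M N T s2) - (\<Union>p\<in>D. err_event K M N T s2 H G c w p)"
  by (auto simp: correct_event_def err_event_def)

lemma correct_event_sets:
  assumes "valid_code K M N T P s2 H G c" "D \<subseteq> pairs K" "w \<in> msg_set K (code_sz c)"
  shows "correct_event K M N T s2 H G c D w \<in> sets (noise_meas K M N T s2)"
proof -
  have "finite D" using assms(2) finite_pairs finite_subset by blast
  then show ?thesis unfolding correct_event_eq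
    using assms by (intro sets.Diff sets.finite_UN sets.top) (auto simp: valid_code_def)
qed

text \<open>A counting substitute for Fano's inequality. In each fibre the success probabilities sum
  to at most \<open>C\<close>, so averaging over all messages leaves room for about \<open>C\<close>
  decodable choices in \<open>Q\<close>. The union bound over \<open>Q\<close> passes from separate
  error probabilities to joint success.\<close>

lemma decoding_count:
  assumes v: "valid_code K M N T P s2 H G c" and s2: "0 < s2"
    and sz: "\<And>p. p \<in> pairs K \<Longrightarrow> 0 < code_sz c p"
    and Q: "Q \<subseteq> pairs K"
    and le: "\<And>g. g \<in> msg_set K (code_sz c) \<Longrightarrow>
      (\<Sum>w | w \<in> msg_set K (code_sz c) \<and> (\<forall>p. p \<notin> Q \<longrightarrow> w p = g p).
        measure (noise_meas K M N T s2) (correct_event K M N T s2 H G c Q w)) \<le> C"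
  shows "(\<Prod>p\<in>Q. real (code_sz c p)) * (1 - (\<Sum>p\<in>Q. err_prob K M N T s2 H G c p)) \<le> C"
proof -
  let ?W = "msg_set K (code_sz c)" and ?M = "noise_meas K M N T s2"
  let ?E = "err_event K M N T s2 H G c" and ?C = "correct_event K M N T s2 H G c Q"
  interpret prob_space ?M by (rule prob_space_noise_meas[OF s2])
  have finQ: "finite Q" using Q finite_pairs finite_subset by blast
  have "?W \<noteq> {}" using zero_in_msg_set[of K "code_sz c"] sz by blast
  then have cW: "0 < real (card ?W)" using finite_msg_set by (simp add: card_gt_0_iff)
  have pc: "1 - (\<Sum>p\<in>Q. prob (?E w p)) \<le> prob (?C w)" if w: "w \<in> ?W" for w
  proof -
    have ev: "?E w p \<in> events" if "p \<in> Q" for p using v w Q that by (auto simp: valid_code_def)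
    have "prob (\<Union>p\<in>Q. ?E w p) \<le> (\<Sum>p\<in>Q. prob (?E w p))"
      by (rule finite_measure_subadditive_finite) (use finQ ev in auto)
    moreover have "prob (?C w) = 1 - prob (\<Union>p\<in>Q. ?E w p)"
      unfolding correct_event_eq by (rule prob_compl) (use finQ ev in auto)
    ultimately show ?thesis by simp
  qed
  have "real (card ?W) * (1 - (\<Sum>p\<in>Q. err_prob K M N T s2 H G c p))
      = (\<Sum>w\<in>?W. 1 - (\<Sum>p\<in>Q. prob (?E w p)))"
  proof -
    have "real (card ?W) * (\<Sum>p\<in>Q. err_prob K M N T s2 H G c p) = (\<Sum>p\<in>Q. \<Sum>w\<in>?W. prob (?E w p))"
    proof -
      have "real (card ?W) * err_prob K M N T s2 H G c p = (\<Sum>w\<in>?W. prob (?E w p))" for p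
        using cW by (simp add: err_prob_def)
      then show ?thesis by (simp add: sum_distrib_left)
    qed
    also have "\<dots> = (\<Sum>w\<in>?W. \<Sum>p\<in>Q. prob (?E w p))" by (rule sum.swap)
    finally show ?thesis by (simp add: right_diff_distrib sum_subtractf)
  qed
  also have "\<dots> \<le> (\<Sum>w\<in>?W. prob (?C w))" by (intro sum_mono pc)
  finally have "(\<Prod>p\<in>Q. real (code_sz c p)) * (real (card ?W) * (1 - (\<Sum>p\<in>Q. err_prob K M N T s2 H G c p)))
     \<le> (\<Prod>p\<in>Q. real (code_sz c p)) * (\<Sum>w\<in>?W. prob (?C w))"
    by (intro mult_left_mono prod_nonneg) auto
  also have "\<dots> \<le> C * real (card ?W)" by (rule sum_msg_set_le_of_fibres[OF Q le])
  finally have "real (card ?W) * ((\<Prod>p\<in>Q. real (code_sz c p)) * (1 - (\<Sum>p\<in>Q. err_prob K M N T s2 H G c p))) \<le> real (card ?W) * C"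
    by (simp add: mult_ac)
  then show ?thesis using cW by simp
qed

text \<open>All messages are compared with one reference law \<open>\<nu>\<close>, under which
  disjoint regions have total mass at most one.\<close>

lemma sum_measure_le_of_domination:
  assumes P: "prob_space P" and \<nu>: "prob_space \<nu>" and W: "finite W"
    and B: "\<And>w. w \<in> W \<Longrightarrow> B w \<in> sets \<nu>" and disj: "disjoint_family_on B W"
    and dom: "\<And>w. w \<in> W \<Longrightarrow> emeasure P (C w) \<le> ennreal \<kappa> * emeasure \<nu> (B w)" and \<kappa>: "0 \<le> \<kappa>"
  shows "(\<Sum>w\<in>W. measure P (C w)) \<le> \<kappa>"
proof -
  interpret P: prob_space P by fact
  interpret \<nu>: prob_space \<nu> by fact
  have "measure P (C w) \<le> \<kappa> * measure \<nu> (B w)" if "w \<in> W" for w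
    using dom[OF that] \<kappa>
    by (simp add: P.emeasure_eq_measure \<nu>.emeasure_eq_measure ennreal_mult[symmetric])
  then have "(\<Sum>w\<in>W. measure P (C w)) \<le> (\<Sum>w\<in>W. \<kappa> * measure \<nu> (B w))" by (rule sum_mono)
  also have "\<dots> = \<kappa> * measure \<nu> (\<Union>w\<in>W. B w)"
    using \<nu>.finite_measure_finite_Union[OF W _ disj] B by (simp add: sum_distrib_left image_subset_iff)
  also have "\<dots> \<le> \<kappa> * 1" by (intro mult_left_mono \<kappa> \<nu>.prob_le_1)
  finally show ?thesis by simp
qed

text \<open>Validity of a code yields measurable events in the space of the noise, whereas
  domination needs measurable regions in the space of received values. Translation has a measurable
  inverse, which carries the one to the other.\<close>

lemma shifted_event_sets:
  fixes x :: "'i \<Rightarrow> complex"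
  assumes C: "{z \<in> space (PiM I (\<lambda>_. cgauss s)). (\<lambda>i\<in>I. z i + x i) \<in> B} \<in> sets (PiM I (\<lambda>_. cgauss s))"
    and B: "B \<subseteq> space (PiM I (\<lambda>_. cgauss s))"
  shows "B \<in> sets (PiM I (\<lambda>_. cgauss s))"
proof -
  let ?P = "PiM I (\<lambda>_. cgauss s)" and ?C = "{z \<in> space (PiM I (\<lambda>_. cgauss s)). (\<lambda>i\<in>I. z i + x i) \<in> B}"
  have m: "(\<lambda>u. \<lambda>i\<in>I. u i - x i) \<in> ?P \<rightarrow>\<^sub>M ?P" by measurable
  have "B = (\<lambda>u. \<lambda>i\<in>I. u i - x i) -` ?C \<inter> space ?P"
  proof (intro Set.set_eqI iffI)
    fix u assume u: "u \<in> B"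
    then have us: "u \<in> space ?P" using B by auto
    then have "(\<lambda>i\<in>I. (\<lambda>i\<in>I. u i - x i) i + x i) = u"
      by (auto simp: space_PiM PiE_def extensional_def fun_eq_iff)
    then show "u \<in> (\<lambda>u. \<lambda>i\<in>I. u i - x i) -` ?C \<inter> space ?P"
      using u us measurable_space[OF m us] by auto
  next
    fix u assume u: "u \<in> (\<lambda>u. \<lambda>i\<in>I. u i - x i) -` ?C \<inter> space ?P"
    then have "(\<lambda>i\<in>I. (\<lambda>i\<in>I. u i - x i) i + x i) = u"
      by (auto simp: space_PiM PiE_def extensional_def fun_eq_iff)
    then show "u \<in> B" using u by auto
  qed
  then show ?thesis using measurable_sets[OF m C] by simp
qed

text \<open>Uplink cut with genie: user \<open>a\<close> decodes the messages sent to it, then holds everything user \<open>b\<close>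
  knows except for the given message from \<open>b\<close> to \<open>c\<close>, and so can also decode the message from \<open>c\<close> to \<open>b\<close>.\<close>
lemma uplink_fibre_bound:
  fixes H G :: "nat \<Rightarrow> cmat"
  assumes v: "valid_code 3 M N T (snr * s2) s2 H G c" and s2: "0 < s2" and snr: "0 < snr"
    and abc: "a < 3" "b < 3" "c' < 3" "a \<noteq> b" "a \<noteq> c'" "b \<noteq> c'"
    and Q: "Q = {(b, a), (c', a), (c', b)}" and g: "g \<in> msg_set 3 (code_sz c)"
  shows "(\<Sum>w | w \<in> msg_set 3 (code_sz c) \<and> (\<forall>p. p \<notin> Q \<longrightarrow> w p = g p).
        measure (noise_meas 3 M N T s2) (correct_event 3 M N T s2 H G c Q w))
     \<le> (1 + snr) ^ (N * T) * exp (3 * (\<Sum>i<N. \<Sum>q\<in>{..<3} \<times> {..<M}. (cmod (H (fst q) i (snd q)))\<^sup>2) * real T)"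
    (is "(\<Sum>w\<in>?W. _) \<le> ?\<kappa>")
proof -
  let ?I = "noise_idx 3 M N T"
  let ?P = "PiM ?I (\<lambda>_. cgauss s2)"
  let ?hs = "\<Sum>i<N. \<Sum>q\<in>{..<3} \<times> {..<M}. (cmod (H (fst q) i (snd q)))\<^sup>2"
  define U where "U = {(0::nat, i, t) | i t. i < N \<and> t < T}"
  have UI: "U \<subseteq> ?I" by (auto simp: U_def noise_idx_def)
  have Ueq: "U = (\<lambda>(i, t). (0, i, t)) ` ({..<N} \<times> {..<T})" by (auto simp: U_def)
  have injU: "inj_on (\<lambda>(i, t). (0::nat, i, t)) ({..<N} \<times> {..<T})" by (auto simp: inj_on_def)
  have cardU: "card U = N * T" unfolding Ueq by (subst card_image[OF injU]) (simp add: card_cartesian_product)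
  \<comment> \<open>In \<open>u\<close> the coordinates with first component \<open>0\<close> carry
    the whole noisy block at the relay and the others the noise of the users. In this form reception
    does not involve the messages.\<close>
  define rx where "rx u k' = trunc M T (\<lambda>i t. mmul N (G k') (code_relay c (trunc N T (\<lambda>i t. u (0::nat, i, t)))) i t + u (Suc k', i, t))"
    for u :: "nat \<times> nat \<times> nat \<Rightarrow> complex" and k'
  define x where "x w = (\<lambda>(e::nat, i, t). if e = 0 then (\<Sum>k<3. mmul M (H k) (code_enc c k (own k w)) i t) else 0)" for w
  define B where "B w = {u \<in> space ?P. \<forall>p\<in>Q. code_dec c (snd p) (rx u (snd p)) (own (snd p) w) (fst p) = w p}" for w
  define \<nu> where "\<nu> = PiM ?I (\<lambda>i. cgauss (if i \<in> U then (1 + snr) * s2 else s2))"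
  have sets\<nu>: "sets \<nu> = sets ?P" unfolding \<nu>_def by (rule sets_PiM_cong) auto
  have Qp: "Q \<subseteq> pairs 3" using abc Q by (auto simp: pairs_def)
  have snd3: "snd p < 3" if "p \<in> Q" for p using that Qp by (auto simp: pairs_def)
  have rx_shift: "user_rx 3 M N T H G c w z k' = rx (\<lambda>i\<in>?I. z i + x w i) k'" if "k' < 3" for w z k'
  proof -
    have "relay_rx 3 M N T H c w z = trunc N T (\<lambda>i t. (\<lambda>i\<in>?I. z i + x w i) (0, i, t))"
      unfolding relay_rx_def by (rule trunc_cong) (simp add: noise_idx_def x_def)
    then show ?thesis unfolding user_rx_def rx_def using that
      by (intro trunc_cong) (simp add: noise_idx_def x_def)
  qed
  have Ceq: "correct_event 3 M N T s2 H G c Q w = {z \<in> space ?P. (\<lambda>i\<in>?I. z i + x w i) \<in> B w}" for w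
    unfolding correct_event_def B_def noise_meas_def using rx_shift snd3 by (auto simp: space_PiM)
  have Bsets: "B w \<in> sets ?P" if w: "w \<in> ?W" for w
  proof (rule shifted_event_sets)
    show "{z \<in> space ?P. (\<lambda>i\<in>?I. z i + x w i) \<in> B w} \<in> sets ?P"
      using correct_event_sets[OF v Qp, of w] w unfolding Ceq noise_meas_def by auto
  qed (auto simp: B_def)
  \<comment> \<open>Division by \<open>snr * s2\<close> cancels the power constraint exactly, so the
    bound is linear in \<open>T\<close> and free of SNR. The factor \<open>3\<close> counts the
    users.\<close>
  have energy: "(\<Sum>i\<in>U. (cmod (x w i))\<^sup>2) / (snr * s2) \<le> 3 * ?hs * real T" if w: "w \<in> ?W" for w
  proof -
    let ?X = "\<lambda>(k, j) t. code_enc c k (own k w) j t"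
    have "(\<Sum>i\<in>U. (cmod (x w i))\<^sup>2) = (\<Sum>i<N. \<Sum>t<T. (cmod (\<Sum>k<3. mmul M (H k) (code_enc c k (own k w)) i t))\<^sup>2)"
      unfolding Ueq by (subst sum.reindex[OF injU]) (simp add: sum.cartesian_product case_prod_beta x_def)
    also have "\<dots> = (\<Sum>i<N. \<Sum>t<T. (cmod (\<Sum>q\<in>{..<3} \<times> {..<M}. H (fst q) i (snd q) * ?X q t))\<^sup>2)"
      by (simp add: mmul_def sum.cartesian_product case_prod_beta)
    also have "\<dots> \<le> ?hs * (\<Sum>q\<in>{..<3} \<times> {..<M}. \<Sum>t<T. (cmod (?X q t))\<^sup>2)"
      by (rule energy_product)
    also have "(\<Sum>q\<in>{..<3} \<times> {..<M}. \<Sum>t<T. (cmod (?X q t))\<^sup>2) = (\<Sum>k<3. frob M T (code_enc c k (own k w)))"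
    proof -
      have "(\<Sum>q\<in>{..<3} \<times> {..<M}. f q) = (\<Sum>k<3. \<Sum>j<M. f (k, j))" for f :: "nat \<times> nat \<Rightarrow> real"
        by (simp add: sum.cartesian_product)
      then show ?thesis by (simp add: frob_def)
    qed
    also have "?hs * \<dots> \<le> ?hs * (\<Sum>k<3::nat. real T * (snr * s2))"
      using v w by (intro mult_left_mono sum_mono sum_nonneg) (auto simp: valid_code_def)
    finally have "(\<Sum>i\<in>U. (cmod (x w i))\<^sup>2) \<le> (3 * ?hs * real T) * (snr * s2)" by (simp add: mult_ac)
    then show ?thesis using s2 snr by (simp add: divide_le_eq)
  qed
  have disj: "disjoint_family_on B ?W"
    unfolding disjoint_family_on_def
  proof (intro ballI impI)
    fix w w' assume w: "w \<in> ?W" and w': "w' \<in> ?W" and ne: "w \<noteq> w'"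
    show "B w \<inter> B w' = {}"
    proof (rule ccontr)
      assume "B w \<inter> B w' \<noteq> {}"
      then obtain u where u: "u \<in> B w" "u \<in> B w'" by auto
      have off: "w p = w' p" if "p \<notin> Q" for p using w w' that by (simp del: split_paired_All)
      \<comment> \<open>No pair in \<open>Q\<close> has source \<open>a\<close>, so the fibre fixes
        all messages of user \<open>a\<close>.\<close>
      have "own a w = own a w'"
        unfolding own_def using off abc by (auto simp: fun_eq_iff Q)
      then have 1: "w (b, a) = w' (b, a)" "w (c', a) = w' (c', a)"
        using u by (auto simp: B_def Q)
      have "w (b, l) = w' (b, l)" for l
        using 1 off[of "(b, l)"] abc by (cases "l = a") (auto simp: Q)
      then have "own b w = own b w'" by (auto simp: own_def fun_eq_iff)
      then have 2: "w (c', b) = w' (c', b)" using u by (auto simp: B_def Q)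
      have "w p = w' p" for p using off[of p] 1 2 by (cases "p \<in> Q") (auto simp: Q)
      then show False using ne by auto
    qed
  qed
  have "(\<Sum>w\<in>?W. measure ?P (correct_event 3 M N T s2 H G c Q w)) \<le> ?\<kappa>"
  proof (rule sum_measure_le_of_domination[where \<nu> = \<nu> and B = B])
    show "prob_space ?P" by (intro prob_space_PiM prob_space_cgauss s2)
    show "prob_space \<nu>" unfolding \<nu>_def by (intro prob_space_PiM prob_space_cgauss) (use s2 snr in auto)
    show "finite ?W" using finite_msg_set by auto
    show "disjoint_family_on B ?W" by (rule disj)
    show "0 \<le> ?\<kappa>" using snr by simp
    fix w assume w: "w \<in> ?W"
    show "B w \<in> sets \<nu>" using Bsets[OF w] sets\<nu> by simp
    have "emeasure ?P (correct_event 3 M N T s2 H G c Q w)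
      \<le> ennreal ((1 + snr) ^ card U * exp ((\<Sum>i\<in>U. (cmod (x w i))\<^sup>2) / (snr * s2))) * emeasure \<nu> (B w)"
      unfolding Ceq \<nu>_def
      by (rule emeasure_shift_cgauss_le[OF finite_noise_idx UI s2 snr Bsets[OF w]])
         (auto simp: noise_idx_def U_def x_def)
    also have "\<dots> \<le> ennreal ?\<kappa> * emeasure \<nu> (B w)"
      unfolding cardU using energy[OF w] snr by (intro mult_right_mono ennreal_leI mult_left_mono) auto
    finally show "emeasure ?P (correct_event 3 M N T s2 H G c Q w) \<le> ennreal ?\<kappa> * emeasure \<nu> (B w)" .
  qed
  then show ?thesis by (simp add: noise_meas_def)
qed

text \<open>The relay map and the decoders need not be measurable, only the error events are. So the noise
  of user \<open>a\<close> is integrated last: for fixed remaining noise the relay output is a constant shift, and the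
  decoding regions are measurable as shifted sections of the error events.\<close>
lemma downlink_fibre_bound:
  fixes H G :: "nat \<Rightarrow> cmat"
  assumes v: "valid_code K M N T (snr * s2) s2 H G c" and s2: "0 < s2" and snr: "0 < snr"
    and a: "a < K" and Q: "Q = {p \<in> pairs K. snd p = a}" and g: "g \<in> msg_set K (code_sz c)"
  shows "(\<Sum>w | w \<in> msg_set K (code_sz c) \<and> (\<forall>p. p \<notin> Q \<longrightarrow> w p = g p).
        measure (noise_meas K M N T s2) (correct_event K M N T s2 H G c Q w))
     \<le> (1 + snr) ^ (M * T) * exp ((\<Sum>i<M. \<Sum>j<N. (cmod (G a i j))\<^sup>2) * real T)"
    (is "(\<Sum>w\<in>?W. _) \<le> ?\<kappa>")
proof -
  let ?I = "noise_idx K M N T"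
  let ?gs = "\<Sum>i<M. \<Sum>j<N. (cmod (G a i j))\<^sup>2"
  define U where "U = {(Suc a, i, t) | i t. i < M \<and> t < T}"
  define V where "V = ?I - U"
  have UI: "U \<subseteq> ?I" using a by (auto simp: U_def noise_idx_def)
  have I: "?I = V \<union> U" "V \<inter> U = {}" using UI by (auto simp: V_def)
  have finUV: "finite U" "finite V" using finite_noise_idx UI by (auto simp: V_def intro: finite_subset)
  have Ueq: "U = (\<lambda>(i, t). (Suc a, i, t)) ` ({..<M} \<times> {..<T})" by (auto simp: U_def)
  have injU: "inj_on (\<lambda>(i, t). (Suc a, i, t)) ({..<M} \<times> {..<T})" by (auto simp: inj_on_def)
  have cardU: "card U = M * T" unfolding Ueq by (subst card_image[OF injU]) (simp add: card_cartesian_product)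
  let ?PI = "PiM ?I (\<lambda>_. cgauss s2)" and ?PU = "PiM U (\<lambda>_. cgauss s2)" and ?PV = "PiM V (\<lambda>_. cgauss s2)"
  interpret PV: prob_space ?PV by (intro prob_space_PiM prob_space_cgauss s2)
  interpret prod: product_sigma_finite "\<lambda>_. cgauss s2" by (rule product_sigma_finite_cgauss) (rule s2)
  define B where "B w = {u \<in> space ?PU. \<forall>p\<in>Q. code_dec c a (trunc M T (\<lambda>i t. u (Suc a, i, t))) (own a w) (fst p) = w p}" for w
  define \<xi> where "\<xi> w y = (\<lambda>(e::nat, i, t). mmul N (G a) (code_relay c (relay_rx K M N T H c w y)) i t)" for w y
  define \<nu> where "\<nu> = PiM U (\<lambda>i. cgauss (if i \<in> U then (1 + snr) * s2 else s2))"
  have sets\<nu>: "sets \<nu> = sets ?PU" unfolding \<nu>_def by (rule sets_PiM_cong) auto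
  have Qp: "Q \<subseteq> pairs K" using Q by auto
  let ?C = "correct_event K M N T s2 H G c Q"
  have sect: "merge V U (y, z) \<in> ?C w \<longleftrightarrow> (\<lambda>i\<in>U. z i + \<xi> w y i) \<in> B w" if yz: "y \<in> space ?PV" "z \<in> space ?PU" for w y z
  proof -
    have rr: "relay_rx K M N T H c w (merge V U (y, z)) = relay_rx K M N T H c w y"
      unfolding relay_rx_def by (rule trunc_cong) (simp add: merge_def V_def U_def noise_idx_def)
    have "user_rx K M N T H G c w (merge V U (y, z)) a = trunc M T (\<lambda>i t. (\<lambda>i\<in>U. z i + \<xi> w y i) (Suc a, i, t))"
      unfolding user_rx_def rr by (rule trunc_cong) (auto simp: merge_def \<xi>_def U_def V_def)
    moreover have "merge V U (y, z) \<in> space ?PI"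
      using yz unfolding I(1) by (auto simp: space_PiM intro!: PiE_cong split: prod.split)
    moreover have "(\<lambda>i\<in>U. z i + \<xi> w y i) \<in> space ?PU" by (auto simp: space_PiM)
    ultimately show ?thesis unfolding correct_event_def B_def noise_meas_def using Q by auto
  qed
  have Csets: "?C w \<in> sets ?PI" if "w \<in> ?W" for w
    using correct_event_sets[OF v Qp, of w] that unfolding noise_meas_def by auto
  have sect_sets: "{z \<in> space ?PU. (\<lambda>i\<in>U. z i + \<xi> w y i) \<in> B w} \<in> sets ?PU" if w: "w \<in> ?W" and y: "y \<in> space ?PV" for w y
  proof -
    have "(\<lambda>z. (y, z)) \<in> ?PU \<rightarrow>\<^sub>M ?PV \<Otimes>\<^sub>M ?PU" using y by simp
    then have m: "(\<lambda>z. merge V U (y, z)) \<in> ?PU \<rightarrow>\<^sub>M ?PI"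
      unfolding I(1) using measurable_merge by (rule measurable_compose)
    have "{z \<in> space ?PU. (\<lambda>i\<in>U. z i + \<xi> w y i) \<in> B w} = (\<lambda>z. merge V U (y, z)) -` ?C w \<inter> space ?PU"
      using sect[OF y] by auto
    then show ?thesis using measurable_sets[OF m Csets[OF w]] by simp
  qed
  have Bsets: "B w \<in> sets ?PU" if w: "w \<in> ?W" for w
  proof -
    obtain y where y: "y \<in> space ?PV" using PV.not_empty by blast
    show ?thesis by (rule shifted_event_sets[OF sect_sets[OF w y]]) (auto simp: B_def)
  qed
  have energy: "(\<Sum>i\<in>U. (cmod (\<xi> w y i))\<^sup>2) / (snr * s2) \<le> ?gs * real T" for w y
  proof -
    let ?X = "code_relay c (relay_rx K M N T H c w y)"
    have "(\<Sum>i\<in>U. (cmod (\<xi> w y i))\<^sup>2) = (\<Sum>i<M. \<Sum>t<T. (cmod (\<Sum>j<N. G a i j * ?X j t))\<^sup>2)"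
      unfolding Ueq by (subst sum.reindex[OF injU]) (simp add: sum.cartesian_product case_prod_beta \<xi>_def mmul_def)
    also have "\<dots> \<le> ?gs * (\<Sum>j<N. \<Sum>t<T. (cmod (?X j t))\<^sup>2)" by (rule energy_product)
    also have "\<dots> \<le> ?gs * (real T * (snr * s2))"
      using v by (intro mult_left_mono sum_nonneg) (auto simp: valid_code_def frob_def)
    finally show ?thesis using s2 snr by (simp add: divide_le_eq mult_ac)
  qed
  have disj: "disjoint_family_on B ?W"
    unfolding disjoint_family_on_def
  proof (intro ballI impI)
    fix w w' assume w: "w \<in> ?W" and w': "w' \<in> ?W" and ne: "w \<noteq> w'"
    show "B w \<inter> B w' = {}"
    proof (rule ccontr)
      assume "B w \<inter> B w' \<noteq> {}"
      then obtain u where u: "u \<in> B w" "u \<in> B w'" by auto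
      have off: "w p = w' p" if "p \<notin> Q" for p using w w' that by (simp del: split_paired_All)
      have "own a w = own a w'"
        unfolding own_def using off by (auto simp: fun_eq_iff Q pairs_def)
      then have "w p = w' p" if "p \<in> Q" for p using u that by (auto simp: B_def)
      then have "w p = w' p" for p using off[of p] by blast
      then show False using ne by auto
    qed
  qed
  have "(\<Sum>w\<in>?W. measure ?PI (?C w)) \<le> ?\<kappa>"
  proof (rule sum_measure_le_of_domination[where \<nu> = \<nu> and B = B])
    show "prob_space ?PI" by (intro prob_space_PiM prob_space_cgauss s2)
    show "prob_space \<nu>" unfolding \<nu>_def by (intro prob_space_PiM prob_space_cgauss) (use s2 snr in auto)
    show "finite ?W" using finite_msg_set by auto
    show "disjoint_family_on B ?W" by (rule disj)
    show "0 \<le> ?\<kappa>" using snr by simp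
    fix w assume w: "w \<in> ?W"
    show "B w \<in> sets \<nu>" using Bsets[OF w] sets\<nu> by simp
    have "emeasure ?PI (?C w) = (\<integral>\<^sup>+ z. indicator (?C w) z \<partial>?PI)" using Csets[OF w] by simp
    also have "\<dots> = (\<integral>\<^sup>+ y. (\<integral>\<^sup>+ z. indicator (?C w) (merge V U (y, z)) \<partial>?PU) \<partial>?PV)"
      unfolding I(1) by (rule prod.product_nn_integral_fold[OF I(2) finUV(2,1)]) (use Csets[OF w] I(1) in simp)
    also have "\<dots> \<le> (\<integral>\<^sup>+ y. ennreal ?\<kappa> * emeasure \<nu> (B w) \<partial>?PV)"
    proof (rule nn_integral_mono)
      fix y assume y: "y \<in> space ?PV"
      have "(\<integral>\<^sup>+ z. indicator (?C w) (merge V U (y, z)) \<partial>?PU)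
         = (\<integral>\<^sup>+ z. indicator {z \<in> space ?PU. (\<lambda>i\<in>U. z i + \<xi> w y i) \<in> B w} z \<partial>?PU)"
        using sect[OF y] by (intro nn_integral_cong) (auto simp: indicator_def)
      also have "\<dots> = emeasure ?PU {z \<in> space ?PU. (\<lambda>i\<in>U. z i + \<xi> w y i) \<in> B w}"
        using sect_sets[OF w y] by simp
      also have "\<dots> \<le> ennreal ((1 + snr) ^ card U * exp ((\<Sum>i\<in>U. (cmod (\<xi> w y i))\<^sup>2) / (snr * s2))) * emeasure \<nu> (B w)"
        unfolding \<nu>_def by (rule emeasure_shift_cgauss_le[OF finUV(1) order_refl s2 snr Bsets[OF w]]) auto
      also have "\<dots> \<le> ennreal ?\<kappa> * emeasure \<nu> (B w)"
        unfolding cardU using energy snr by (intro mult_right_mono ennreal_leI mult_left_mono) auto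
      finally show "(\<integral>\<^sup>+ z. indicator (?C w) (merge V U (y, z)) \<partial>?PU) \<le> ennreal ?\<kappa> * emeasure \<nu> (B w)" .
    qed
    also have "\<dots> = ennreal ?\<kappa> * emeasure \<nu> (B w)" by (simp add: PV.emeasure_space_1)
    finally show "emeasure ?PI (?C w) \<le> ennreal ?\<kappa> * emeasure \<nu> (B w)" .
  qed
  then show ?thesis by (simp add: noise_meas_def)
qed

section \<open>From counting bounds to bounds on the degrees of freedom\<close>

text \<open>A single block length \<open>T \<ge> 1\<close> with total error below \<open>1/2\<close>
  is enough. The resulting factor \<open>2\<close> costs at most one bit per channel use, which is
  the additive \<open>1\<close>.\<close>

lemma rate_bound_of_counting:
  fixes R :: "'p \<Rightarrow> real" and sz :: "nat \<Rightarrow> 'p \<Rightarrow> nat" and err :: "nat \<Rightarrow> 'p \<Rightarrow> real"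
  assumes Q: "finite Q" and snr: "0 < snr"
    and sz: "\<And>T p. p \<in> Q \<Longrightarrow> 2 powr (real T * R p) \<le> real (sz T p)"
    and err: "\<And>p. p \<in> Q \<Longrightarrow> (\<lambda>T. err T p) \<longlonglongrightarrow> 0"
    and count: "\<And>T. (\<Prod>p\<in>Q. real (sz T p)) * (1 - (\<Sum>p\<in>Q. err T p)) \<le> (1 + snr) ^ (n * T) * exp (h * real T)"
  shows "(\<Sum>p\<in>Q. R p) \<le> real n * log 2 (1 + snr) + h / ln 2 + 1"
proof -
  have "(\<lambda>T. \<Sum>p\<in>Q. err T p) \<longlonglongrightarrow> (\<Sum>p\<in>Q. 0)" by (intro tendsto_sum err)
  then have "eventually (\<lambda>T. (\<Sum>p\<in>Q. err T p) < 1 / 2) sequentially"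
    by (intro order_tendstoD(2)) auto
  moreover have "eventually (\<lambda>T::nat. 1 \<le> T) sequentially" by (rule eventually_ge_at_top)
  ultimately have "eventually (\<lambda>T::nat. (\<Sum>p\<in>Q. err T p) < 1 / 2 \<and> 1 \<le> T) sequentially" by (rule eventually_conj)
  then obtain T where T: "(\<Sum>p\<in>Q. err T p) < 1 / 2" "1 \<le> T"
    by (metis (mono_tags, lifting) eventually_sequentially order_refl)
  have "2 powr (real T * (\<Sum>p\<in>Q. R p)) = (\<Prod>p\<in>Q. 2 powr (real T * R p))"
    using Q by (simp add: powr_sum sum_distrib_left)
  also have "\<dots> \<le> (\<Prod>p\<in>Q. real (sz T p))" by (intro prod_mono) (use sz in auto)
  finally have "2 powr (real T * (\<Sum>p\<in>Q. R p)) * (1 / 2) \<le> (\<Prod>p\<in>Q. real (sz T p)) * (1 - (\<Sum>p\<in>Q. err T p))"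
    using T by (intro mult_mono prod_nonneg) auto
  also have "\<dots> \<le> (1 + snr) ^ (n * T) * exp (h * real T)" by (rule count)
  also have "\<dots> = exp (real T * (real n * ln (1 + snr) + h))"
  proof -
    have "(1 + snr) ^ (n * T) = exp (real (n * T) * ln (1 + snr))"
      using snr by (subst exp_of_nat_mult) simp
    then show ?thesis by (simp add: exp_add[symmetric] algebra_simps)
  qed
  finally have "2 powr (real T * (\<Sum>p\<in>Q. R p)) \<le> 2 * exp (real T * (real n * ln (1 + snr) + h))" by simp
  also have "\<dots> = exp (ln 2 + real T * (real n * ln (1 + snr) + h))" by (simp add: exp_add)
  finally have "real T * (\<Sum>p\<in>Q. R p) * ln 2 \<le> ln 2 + real T * (real n * ln (1 + snr) + h)"
    by (simp add: powr_def)
  also have "\<dots> \<le> real T * (real n * ln (1 + snr) + h + ln 2)"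
    using T(2) by (simp add: algebra_simps)
  finally have "real T * ((\<Sum>p\<in>Q. R p) * ln 2) \<le> real T * (real n * ln (1 + snr) + h + ln 2)" by (simp add: mult.assoc)
  then have "(\<Sum>p\<in>Q. R p) * ln 2 \<le> real n * ln (1 + snr) + h + ln 2" using T(2) by simp
  then have "(\<Sum>p\<in>Q. R p) \<le> (real n * ln (1 + snr) + h + ln 2) / ln 2" by (simp add: le_divide_eq)
  also have "\<dots> = real n * log 2 (1 + snr) + h / ln 2 + 1" by (simp add: log_def add_divide_distrib)
  finally show ?thesis .
qed

lemma achievable_rates_bound:
  assumes ach: "achievable_rates K M N (snr * s2) s2 H G R" and s2: "0 < s2" and snr: "0 < snr"
    and Q: "Q \<subseteq> pairs K"
    and fibre: "\<And>T c g. valid_code K M N T (snr * s2) s2 H G c \<Longrightarrow> g \<in> msg_set K (code_sz c) \<Longrightarrow>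
      (\<Sum>w | w \<in> msg_set K (code_sz c) \<and> (\<forall>p. p \<notin> Q \<longrightarrow> w p = g p).
        measure (noise_meas K M N T s2) (correct_event K M N T s2 H G c Q w)) \<le> (1 + snr) ^ (n * T) * exp (h * real T)"
  shows "(\<Sum>p\<in>Q. R p) \<le> real n * log 2 (1 + snr) + h / ln 2 + 1"
proof -
  obtain c :: "nat \<Rightarrow> mrc_code" where v: "\<And>T. valid_code K M N T (snr * s2) s2 H G (c T)"
    and sz: "\<And>T p. p \<in> pairs K \<Longrightarrow> 2 powr (real T * R p) \<le> real (code_sz (c T) p)"
    and err: "\<And>p. p \<in> pairs K \<Longrightarrow> (\<lambda>T. err_prob K M N T s2 H G (c T) p) \<longlonglongrightarrow> 0"
    using ach unfolding achievable_rates_def by blast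
  have pos: "0 < code_sz (c T) p" if "p \<in> pairs K" for T p
  proof -
    have "0 < 2 powr (real T * R p)" by simp
    then have "0 < real (code_sz (c T) p)" using sz[OF that, of T] by linarith
    then show ?thesis by simp
  qed
  show ?thesis
  proof (rule rate_bound_of_counting[OF _ snr, where sz = "\<lambda>T. code_sz (c T)" and err = "\<lambda>T. err_prob K M N T s2 H G (c T)"])
    show "finite Q" using Q finite_pairs finite_subset by blast
    show "(\<Prod>p\<in>Q. real (code_sz (c T) p)) * (1 - (\<Sum>p\<in>Q. err_prob K M N T s2 H G (c T) p))
        \<le> (1 + snr) ^ (n * T) * exp (h * real T)" for T
      by (rule decoding_count[OF v s2 pos Q fibre[OF v]])
  qed (use sz err Q in auto)
qed

lemma pairs_3: "pairs 3 = {(0, 1), (0, 2), (1, 0), (1, 2), (2, 0), (2, 1)}"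
  by (auto simp: pairs_def numeral_3_eq_3 numeral_2_eq_2 less_Suc_eq)

lemma sum_rate_bound:
  assumes s2: "0 < s2"
  obtains C where "\<And>snr R. 0 < snr \<Longrightarrow> achievable_rates 3 M N (snr * s2) s2 H G R \<Longrightarrow>
    (\<Sum>p\<in>pairs 3. R p) \<le> real (2 * N) * log 2 (1 + snr) + C \<and>
    (\<Sum>p\<in>pairs 3. R p) \<le> real (3 * M) * log 2 (1 + snr) + C"
proof -
  define hs where "hs = 3 * (\<Sum>i<N. \<Sum>q\<in>{..<3} \<times> {..<M}. (cmod (H (fst q) i (snd q)))\<^sup>2)"
  define gs where "gs a = (\<Sum>i<M. \<Sum>j<N. (cmod (G a i j))\<^sup>2)" for a
  define C1 where "C1 = 2 * (hs / ln 2 + 1)"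
  define C2 where "C2 = gs 0 / ln 2 + gs 1 / ln 2 + gs 2 / ln 2 + 3"
  have "(\<Sum>p\<in>pairs 3. R p) \<le> real (2 * N) * log 2 (1 + snr) + C1 \<and>
    (\<Sum>p\<in>pairs 3. R p) \<le> real (3 * M) * log 2 (1 + snr) + C2"
    if snr: "0 < snr" and ach: "achievable_rates 3 M N (snr * s2) s2 H G R" for snr R
  proof -
    have up: "(\<Sum>p\<in>Q. R p) \<le> real N * log 2 (1 + snr) + hs / ln 2 + 1"
      if "a < 3" "b < 3" "c' < 3" "a \<noteq> b" "a \<noteq> c'" "b \<noteq> c'" "Q = {(b, a), (c', a), (c', b)}" for Q a b c'
    proof (rule achievable_rates_bound[OF ach s2 snr])
      show "Q \<subseteq> pairs 3" using that by (auto simp: pairs_def)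
    qed (unfold hs_def, rule uplink_fibre_bound[OF _ s2 snr that])
    \<comment> \<open>The decoding orders \<open>0, 1, 2\<close> and \<open>2, 1, 0\<close> produce
      triples that are reversals of each other, so together they cover each of the six ordered pairs
      once.\<close>
    have 1: "(\<Sum>p\<in>{(1, 0), (2, 0), (2, 1)}. R p) \<le> real N * log 2 (1 + snr) + hs / ln 2 + 1"
      by (rule up[of 0 1 2]) auto
    have 2: "(\<Sum>p\<in>{(1, 2), (0, 2), (0, 1)}. R p) \<le> real N * log 2 (1 + snr) + hs / ln 2 + 1"
      by (rule up[of 2 1 0]) auto
    have down: "(\<Sum>p\<in>{p \<in> pairs 3. snd p = a}. R p) \<le> real M * log 2 (1 + snr) + gs a / ln 2 + 1" if "a < 3" for a
      unfolding gs_def by (rule achievable_rates_bound[OF ach s2 snr])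
        (auto simp only: Collect_subset intro!: downlink_fibre_bound[OF _ s2 snr that refl])
    have Qa: "{p \<in> pairs 3. snd p = 0} = {(1, 0), (2, 0)}" "{p \<in> pairs 3. snd p = 1} = {(0, 1), (2, 1)}" "{p \<in> pairs 3. snd p = 2} = {(0, 2), (1, 2)}"
      by (auto simp: pairs_3)
    have "(\<Sum>p\<in>pairs 3. R p) \<le> real (2 * N) * log 2 (1 + snr) + C1"
      using 1 2 by (simp add: pairs_3 C1_def)
    moreover have "(\<Sum>p\<in>pairs 3. R p) \<le> real (3 * M) * log 2 (1 + snr) + C2"
      using down[of 0] down[of 1] down[of 2] unfolding Qa by (simp add: pairs_3 C2_def)
    ultimately show ?thesis ..
  qed
  then have "(\<Sum>p\<in>pairs 3. R p) \<le> real (2 * N) * log 2 (1 + snr) + max C1 C2 \<and>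
    (\<Sum>p\<in>pairs 3. R p) \<le> real (3 * M) * log 2 (1 + snr) + max C1 C2"
    if "0 < snr" "achievable_rates 3 M N (snr * s2) s2 H G R" for snr R
    using that by fastforce
  then show thesis by (rule that)
qed

lemma dof_limit_le:
  fixes f :: "real \<Rightarrow> real"
  assumes lim: "((\<lambda>snr. f snr / log 2 snr) \<longlongrightarrow> L) at_top"
    and le: "\<And>snr. 0 < snr \<Longrightarrow> f snr \<le> c * log 2 (1 + snr) + C"
  shows "L \<le> c"
proof (rule tendsto_le[OF _ _ lim])
  show "((\<lambda>snr. (c * log 2 (1 + snr) + C) / log 2 snr) \<longlongrightarrow> c) at_top"
    unfolding log_def by real_asymp
  have "eventually (\<lambda>snr::real. 1 < snr) at_top" by (rule eventually_gt_at_top)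
  then show "eventually (\<lambda>snr. f snr / log 2 snr \<le> (c * log 2 (1 + snr) + C) / log 2 snr) at_top"
    by eventually_elim (intro divide_right_mono le, auto)
qed simp

lemma dof_achievable_at_le:
  assumes s2: "0 < s2" and "dof_achievable_at 3 M N s2 H G d"
  shows "d \<le> real M" "d \<le> 2 * real N / 3"
proof -
  obtain R where R: "\<And>snr. 0 < snr \<Longrightarrow> achievable_rates 3 M N (snr * s2) s2 H G (R snr)"
    and lim: "((\<lambda>snr. (\<Sum>p\<in>pairs 3. R snr p) / log 2 snr) \<longlongrightarrow> real 3 * d) at_top"
    using assms(2) unfolding dof_achievable_at_def by blast
  obtain C where C: "\<And>snr R. 0 < snr \<Longrightarrow> achievable_rates 3 M N (snr * s2) s2 H G R \<Longrightarrow>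
    (\<Sum>p\<in>pairs 3. R p) \<le> real (2 * N) * log 2 (1 + snr) + C \<and>
    (\<Sum>p\<in>pairs 3. R p) \<le> real (3 * M) * log 2 (1 + snr) + C" using sum_rate_bound[OF s2] by blast
  have "real 3 * d \<le> real (2 * N)" "real 3 * d \<le> real (3 * M)"
    by (rule dof_limit_le[OF lim], use C R in blast)+
  then show "d \<le> real M" "d \<le> 2 * real N / 3" by auto
qed

lemma dof_achievable_le:
  assumes s2: "0 < s2" and d: "dof_achievable 3 M N s2 d"
  shows "d \<le> real M" "d \<le> 2 * real N / 3"
proof -
  let ?P = "PiM {..<chan_dim 3 M N} (\<lambda>_. lborel :: real measure)"
  interpret product_sigma_finite "\<lambda>_::nat. lborel :: real measure" by unfold_locales
  \<comment> \<open>The bound holds for every channel, so one realization suffices. It exists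
    because the product of Lebesgue measures is not the zero measure.\<close>
  have "emeasure ?P (space ?P) = (\<Prod>i\<in>{..<chan_dim 3 M N}. emeasure lborel (UNIV :: real set))"
    unfolding space_PiM by (subst emeasure_PiM) auto
  also have "\<dots> \<noteq> 0" by simp
  finally have "\<not> (AE v in ?P. False)" by (auto simp: AE_iff_null)
  then obtain v where "dof_achievable_at 3 M N s2 (chan_H 3 M N v) (chan_G 3 M N v) d"
    using d unfolding dof_achievable_def by (metis (no_types, lifting) eventually_mono)
  then show "d \<le> real M" "d \<le> 2 * real N / 3" using dof_achievable_at_le[OF s2] by blast+
qed

section \<open>Generic signal alignment\<close>

text \<open>Rows and columns keep their natural names, such as streams or pairs of slot and antenna.
  Enumerations enter only through \<open>reindexed_det\<close>, where determinants are
  required.\<close>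

definition nonsing :: "'i set \<Rightarrow> 'j set \<Rightarrow> ('i \<Rightarrow> 'j \<Rightarrow> complex) \<Rightarrow> bool" where
  "nonsing I J f \<longleftrightarrow> finite I \<and> finite J \<and> card I = card J \<and>
     (\<forall>x. (\<forall>i\<in>I. (\<Sum>j\<in>J. f i j * x j) = 0) \<longrightarrow> (\<forall>j\<in>J. x j = 0))"

definition reindexed_det :: "nat \<Rightarrow> (nat \<Rightarrow> 'i) \<Rightarrow> (nat \<Rightarrow> 'j) \<Rightarrow> ('i \<Rightarrow> 'j \<Rightarrow> complex) \<Rightarrow> complex" where
  "reindexed_det n g h f = det (mat n n (\<lambda>(a, b). f (g a) (h b)))"

lemma nonsing_iff_det:
  assumes g: "bij_betw g {..<n} I" and h: "bij_betw h {..<n} J"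
  shows "nonsing I J f \<longleftrightarrow> reindexed_det n g h f \<noteq> 0"
proof -
  let ?A = "mat n n (\<lambda>(a, b). f (g a) (h b))"
  have fin: "finite I" "finite J" "card I = card J"
    using g h bij_betw_finite bij_betw_same_card by (blast, blast, metis)
  have A: "?A \<in> carrier_mat n n" by simp
  have mv: "(?A *\<^sub>v v) $ a = (\<Sum>b<n. f (g a) (h b) * v $ b)" if "v \<in> carrier_vec n" "a < n" for v a
    using that by (auto simp: scalar_prod_def atLeast0LessThan intro!: sum.cong)
  have re: "(\<Sum>j\<in>J. f i j * x j) = (\<Sum>b<n. f i (h b) * x (h b))" for i x
    using sum.reindex_bij_betw[OF h, of "\<lambda>j. f i j * x j"] by simp
  have gI: "g a \<in> I" if "a < n" for a using g that by (auto simp: bij_betw_def)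
  have hJ: "h a \<in> J" if "a < n" for a using h that by (auto simp: bij_betw_def)
  have gI': "\<exists>a<n. i = g a" if "i \<in> I" for i using g that by (auto simp: bij_betw_def)
  have hJ': "\<exists>a<n. i = h a" if "i \<in> J" for i using h that by (auto simp: bij_betw_def)
  show ?thesis
  proof
    assume ns: "nonsing I J f"
    show "reindexed_det n g h f \<noteq> 0"
    proof
      assume "reindexed_det n g h f = 0"
      then obtain v where v: "v \<in> carrier_vec n" "v \<noteq> 0\<^sub>v n" "?A *\<^sub>v v = 0\<^sub>v n"
        unfolding reindexed_det_def using det_0_iff_vec_prod_zero[OF A] by auto
      define x where "x j = v $ (inv_into {..<n} h j)" for j
      have xh: "x (h b) = v $ b" if "b < n" for b
        using h that by (simp add: x_def bij_betw_def inv_into_f_f)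
      have "(\<Sum>j\<in>J. f i j * x j) = 0" if i: "i \<in> I" for i
      proof -
        from gI'[OF i] obtain a where a: "a < n" "i = g a" by auto
        have "(\<Sum>j\<in>J. f i j * x j) = (\<Sum>b<n. f (g a) (h b) * v $ b)"
          unfolding re using xh a by (intro sum.cong) auto
        also have "\<dots> = (?A *\<^sub>v v) $ a" using mv[OF v(1) a(1)] by simp
        finally show ?thesis using v(3) a by simp
      qed
      with ns have "\<forall>j\<in>J. x j = 0" unfolding nonsing_def by blast
      then have "v $ b = 0" if "b < n" for b using xh hJ that by metis
      then have "v = 0\<^sub>v n" using v(1) by (intro eq_vecI) auto
      with v(2) show False by simp
    qed
  next
    assume d: "reindexed_det n g h f \<noteq> 0"
    show "nonsing I J f" unfolding nonsing_def
    proof (intro conjI fin allI impI ballI)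
      fix x j assume x: "\<forall>i\<in>I. (\<Sum>j\<in>J. f i j * x j) = 0" and j: "j \<in> J"
      define v where "v = vec n (\<lambda>b. x (h b))"
      have v: "v \<in> carrier_vec n" by (simp add: v_def)
      have "?A *\<^sub>v v = 0\<^sub>v n"
      proof (rule eq_vecI)
        fix a assume "a < dim_vec (0\<^sub>v n)"
        then have a: "a < n" by simp
        have "(?A *\<^sub>v v) $ a = (\<Sum>b<n. f (g a) (h b) * v $ b)" using mv[OF v a] .
        also have "\<dots> = (\<Sum>b<n. f (g a) (h b) * x (h b))" by (simp add: v_def)
        also have "\<dots> = 0" using x gI[OF a] unfolding re by simp
        finally show "(?A *\<^sub>v v) $ a = 0\<^sub>v n $ a" using a by simp
      qed (simp)
      with d v have "v = 0\<^sub>v n" unfolding reindexed_det_def using det_0_iff_vec_prod_zero[OF A] by auto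
      moreover obtain b where "b < n" "j = h b" using hJ'[OF j] by auto
      ultimately show "x j = 0" by (metis v_def index_vec index_zero_vec(1))
    qed
  qed
qed

lemma bij_betw_enum: "finite I \<Longrightarrow> \<exists>g. bij_betw g {..<card I} I"
  using ex_bij_betw_nat_finite[of I] by (simp add: atLeast0LessThan)

lemma nonsing_transpose:
  assumes "nonsing I J f" shows "nonsing J I (\<lambda>j i. f i j)"
proof -
  let ?n = "card I"
  from assms have fin: "finite I" "finite J" "card J = ?n" by (auto simp: nonsing_def)
  obtain g h where g: "bij_betw g {..<?n} I" and h: "bij_betw h {..<?n} J"
    using bij_betw_enum[OF fin(1)] bij_betw_enum[OF fin(2)] fin(3) by metis
  have "mat ?n ?n (\<lambda>(a, b). f (g b) (h a)) = transpose_mat (mat ?n ?n (\<lambda>(a, b). f (g a) (h b)))"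
    by (rule eq_matI) auto
  then have "reindexed_det ?n h g (\<lambda>j i. f i j) = reindexed_det ?n g h f"
    unfolding reindexed_det_def by (simp add: det_transpose[where n = ?n])
  then show ?thesis using assms nonsing_iff_det[OF g h] nonsing_iff_det[OF h g, of "\<lambda>j i. f i j"] by simp
qed

lemma nonsing_solve:
  assumes "nonsing I J f" shows "\<exists>x. \<forall>i\<in>I. (\<Sum>j\<in>J. f i j * x j) = b i"
proof -
  let ?n = "card I"
  from assms have fin: "finite I" "finite J" "card J = ?n" by (auto simp: nonsing_def)
  obtain g h where g: "bij_betw g {..<?n} I" and h: "bij_betw h {..<?n} J"
    using bij_betw_enum[OF fin(1)] bij_betw_enum[OF fin(2)] fin(3) by metis
  let ?A = "mat ?n ?n (\<lambda>(a, b). f (g a) (h b))"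
  have A: "?A \<in> carrier_mat ?n ?n" by simp
  have "det ?A \<noteq> 0" using assms nonsing_iff_det[OF g h] by (simp add: reindexed_det_def)
  from det_non_zero_imp_unit[OF A this]
  obtain B where B: "B \<in> carrier_mat ?n ?n" "?A * B = 1\<^sub>m ?n"
    unfolding Units_def by (auto simp: ring_mat_def)
  define c where "c = vec ?n (\<lambda>a. b (g a))"
  define v where "v = B *\<^sub>v c"
  have c: "c \<in> carrier_vec ?n" and v: "v \<in> carrier_vec ?n" using B by (auto simp: c_def v_def)
  have Av: "?A *\<^sub>v v = c" unfolding v_def
    using assoc_mult_mat_vec[OF A B(1) c] B(2) c by simp
  define x where "x j = v $ (inv_into {..<?n} h j)" for j
  have xh: "x (h b) = v $ b" if "b < ?n" for b
    using h that by (simp add: x_def bij_betw_def inv_into_f_f)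
  have "(\<Sum>j\<in>J. f i j * x j) = b i" if i: "i \<in> I" for i
  proof -
    from g i obtain a where a: "a < ?n" "i = g a" by (auto simp: bij_betw_def)
    have "(\<Sum>j\<in>J. f i j * x j) = (\<Sum>b<?n. f i (h b) * x (h b))"
      using sum.reindex_bij_betw[OF h, of "\<lambda>j. f i j * x j"] by simp
    also have "\<dots> = (\<Sum>b<?n. f (g a) (h b) * v $ b)" using xh a by (intro sum.cong) auto
    also have "\<dots> = (?A *\<^sub>v v) $ a" using a v
      by (auto simp: scalar_prod_def atLeast0LessThan intro!: sum.cong)
    also have "\<dots> = b i" unfolding Av using a by (simp add: c_def)
    finally show ?thesis .
  qed
  then show ?thesis by blast
qed

section \<open>Matrices with affine entries are nonsingular almost everywhere\<close>

text \<open>Affine entries replace multivariate polynomials: along a single coordinate a determinant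
  of affine entries is a univariate polynomial, and only this is used.\<close>

definition affine_in :: "nat \<Rightarrow> ((nat \<Rightarrow> real) \<Rightarrow> complex) \<Rightarrow> bool" where
  "affine_in D f \<longleftrightarrow> (\<exists>a b. \<forall>v. f v = a + (\<Sum>l<D. b l * of_real (v l)))"

lemma affine_in_const: "affine_in D (\<lambda>v. c)"
  unfolding affine_in_def by (rule exI[of _ c], rule exI[of _ "\<lambda>_. 0"]) simp

lemma affine_in_add:
  assumes "affine_in D f" "affine_in D g" shows "affine_in D (\<lambda>v. f v + g v)"
proof -
  obtain a b where 1: "\<And>v. f v = a + (\<Sum>l<D. b l * of_real (v l))" using assms(1) unfolding affine_in_def by blast
  obtain a' b' where 2: "\<And>v. g v = a' + (\<Sum>l<D. b' l * of_real (v l))" using assms(2) unfolding affine_in_def by blast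
  show ?thesis unfolding affine_in_def
    by (rule exI[of _ "a + a'"], rule exI[of _ "\<lambda>l. b l + b' l"]) (simp add: 1 2 distrib_right sum.distrib)
qed

lemma affine_in_cmult:
  assumes "affine_in D f" shows "affine_in D (\<lambda>v. c * f v)"
proof -
  obtain a b where 1: "\<And>v. f v = a + (\<Sum>l<D. b l * of_real (v l))" using assms(1) unfolding affine_in_def by blast
  show ?thesis unfolding affine_in_def
    by (rule exI[of _ "c * a"], rule exI[of _ "\<lambda>l. c * b l"]) (simp add: 1 distrib_left sum_distrib_left mult.assoc)
qed

lemma affine_in_sum: "(\<And>i. i \<in> I \<Longrightarrow> affine_in D (f i)) \<Longrightarrow> affine_in D (\<lambda>v. \<Sum>i\<in>I. f i v)"
  by (induction I rule: infinite_finite_induct) (auto intro: affine_in_const affine_in_add)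

lemma affine_in_Complex:
  assumes "a < D" "b < D" shows "affine_in D (\<lambda>v. Complex (v a) (v b))"
proof -
  have "affine_in D (\<lambda>v. of_real (v l))" if "l < D" for l
    unfolding affine_in_def
  proof (rule exI[of _ 0], rule exI[of _ "\<lambda>l'. if l' = l then 1 else 0"], rule allI)
    fix v
    have "(\<Sum>m<D. (if m = l then 1 else 0) * complex_of_real (v m)) = (\<Sum>m<D. if m = l then complex_of_real (v m) else 0)"
      by (intro sum.cong) auto
    then show "complex_of_real (v l) = 0 + (\<Sum>m<D. (if m = l then 1 else 0) * complex_of_real (v m))"
      using that by simp
  qed
  then have "affine_in D (\<lambda>v. of_real (v a) + \<i> * of_real (v b))"
    using assms by (intro affine_in_add affine_in_cmult)
  then show ?thesis by (simp add: Complex_eq)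
qed

text \<open>Along each coordinate the function is a polynomial, so by Fubini its zero set can be
  swept out one coordinate at a time, starting from a point where it does not vanish.\<close>
lemma AE_nonzero_of_coordinatewise_poly:
  fixes F :: "(nat \<Rightarrow> real) \<Rightarrow> complex"
  assumes poly: "\<And>v l. \<exists>p. \<forall>t. F (v(l := t)) = poly p (of_real t)"
    and meas: "\<And>n. (\<lambda>v. F (\<lambda>i. if i < n then v i else v0 i)) \<in> borel_measurable (PiM {..<n} (\<lambda>_. lborel))"
    and v0: "F v0 \<noteq> 0"
  shows "AE v in PiM {..<n} (\<lambda>_. lborel). F (\<lambda>i. if i < n then v i else v0 i) \<noteq> 0"
proof (induction n)
  case 0
  then show ?case using v0 by simp
next
  case (Suc n)
  interpret product_sigma_finite "\<lambda>_::nat. lborel :: real measure"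
    by (unfold_locales)
  let ?G = "\<lambda>n v. F (\<lambda>i. if i < n then v i else v0 i)"
  let ?P = "PiM {..<n} (\<lambda>_. lborel :: real measure)"
  interpret P: sigma_finite_measure ?P by (rule sigma_finite) simp
  have ins: "{..<Suc n} = insert n {..<n}" by auto
  have S: "{v \<in> space (PiM (insert n {..<n}) (\<lambda>_. lborel)). ?G (Suc n) v = 0} \<in> sets (PiM (insert n {..<n}) (\<lambda>_. lborel))"
    using meas[of "Suc n"] unfolding ins by measurable
  have eq: "?G (Suc n) (x(n := y)) = F ((\<lambda>i. if i < n then x i else v0 i)(n := y))" for x y
    by (rule arg_cong[of _ _ F]) (auto simp: fun_eq_iff)
  have AE1: "AE x in ?P. (\<integral>\<^sup>+ y. indicator {v. ?G (Suc n) v = 0} (x(n := y)) \<partial>lborel) = 0"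
    using Suc
  proof eventually_elim
    fix x assume x: "?G n x \<noteq> 0"
    obtain p where p: "\<forall>t. F ((\<lambda>i. if i < n then x i else v0 i)(n := t)) = poly p (of_real t)"
      using poly by blast
    \<comment> \<open>At the value \<open>v0 n\<close> of the new coordinate the function returns to
      \<open>?G n x\<close>, which is nonzero by induction. So the polynomial is not zero and has
      finitely many roots.\<close>
    have "(\<lambda>i. if i < n then x i else v0 i)(n := v0 n) = (\<lambda>i. if i < n then x i else v0 i)" by auto
    then have "poly p (of_real (v0 n)) \<noteq> 0" using x p by metis
    then have "finite {z. poly p z = 0}" by (intro poly_roots_finite) auto
    then have "finite (of_real -` {z::complex. poly p z = 0} :: real set)"
      by (intro finite_vimageI) (auto simp: inj_on_def)
    then have cnt: "countable (of_real -` {z::complex. poly p z = 0} :: real set)" by (rule countable_finite)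
    have "AE y in lborel. y \<notin> (of_real -` {z::complex. poly p z = 0} :: real set)"
      using countable_imp_null_set_lborel[OF cnt] by (rule AE_not_in)
    then have "AE y in lborel. (indicator {v. ?G (Suc n) v = 0} (x(n := y)) :: ennreal) = 0"
      by eventually_elim (use p eq in auto)
    then have "(\<integral>\<^sup>+ y. indicator {v. ?G (Suc n) v = 0} (x(n := y)) \<partial>lborel) = (\<integral>\<^sup>+ y. 0 \<partial>(lborel::real measure))"
      by (rule nn_integral_cong_AE)
    then show "(\<integral>\<^sup>+ y. indicator {v. ?G (Suc n) v = 0} (x(n := y)) \<partial>lborel) = 0" by simp
  qed
  have ind: "(\<lambda>v. indicator {v. ?G (Suc n) v = 0} v :: ennreal) \<in> borel_measurable (PiM (insert n {..<n}) (\<lambda>_. lborel))"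
    using meas[of "Suc n"] unfolding ins by measurable
  have "(\<integral>\<^sup>+ v. indicator {v. ?G (Suc n) v = 0} v \<partial>PiM (insert n {..<n}) (\<lambda>_. lborel))
      = (\<integral>\<^sup>+ x. (\<integral>\<^sup>+ y. indicator {v. ?G (Suc n) v = 0} (x(n := y)) \<partial>lborel) \<partial>?P)"
    by (rule product_nn_integral_insert) (use ind in auto)
  also have "\<dots> = (\<integral>\<^sup>+ x. 0 \<partial>?P)" by (rule nn_integral_cong_AE[OF AE1])
  finally have "(\<integral>\<^sup>+ v. indicator {v. ?G (Suc n) v = 0} v \<partial>PiM (insert n {..<n}) (\<lambda>_. lborel)) = 0" by simp
  then have "AE v in PiM (insert n {..<n}) (\<lambda>_. lborel). indicator {v. ?G (Suc n) v = 0} v = (0::ennreal)"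
    using nn_integral_0_iff_AE[OF ind] by simp
  then show ?case unfolding ins by (auto simp: indicator_def split: if_splits)
qed

text \<open>The Leibniz formula writes the determinant as a sum of products of affine entries; each
  entry becomes a polynomial of degree at most one when a single coordinate varies.\<close>

lemma AE_nonsing:
  fixes f :: "(nat \<Rightarrow> real) \<Rightarrow> 'i \<Rightarrow> 'j \<Rightarrow> complex"
  assumes aff: "\<And>i j. i \<in> I \<Longrightarrow> j \<in> J \<Longrightarrow> affine_in D (\<lambda>v. f v i j)"
    and ns: "nonsing I J (f v0)"
  shows "AE v in PiM {..<D} (\<lambda>_. lborel). nonsing I J (f v)"
proof -
  let ?n = "card I"
  from ns have fin: "finite I" "finite J" "card J = ?n" by (auto simp: nonsing_def)
  obtain g h where g: "bij_betw g {..<?n} I" and h: "bij_betw h {..<?n} J"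
    using bij_betw_enum[OF fin(1)] bij_betw_enum[OF fin(2)] fin(3) by metis
  have gI: "g a \<in> I" if "a < ?n" for a using g that by (auto simp: bij_betw_def)
  have hJ: "h a \<in> J" if "a < ?n" for a using h that by (auto simp: bij_betw_def)
  define F where "F v = reindexed_det ?n g h (f v)" for v
  have Fsum: "F v = (\<Sum>p\<in>{p. p permutes {0..<?n}}. signof p * (\<Prod>i = 0..<?n. f v (g i) (h (p i))))" for v
  proof -
    have "F v = (\<Sum>p\<in>{p. p permutes {0..<?n}}. signof p * (\<Prod>i = 0..<?n. mat ?n ?n (\<lambda>(a, b). f v (g a) (h b)) $$ (i, p i)))"
      unfolding F_def reindexed_det_def by (rule det_def') simp
    also have "\<dots> = (\<Sum>p\<in>{p. p permutes {0..<?n}}. signof p * (\<Prod>i = 0..<?n. f v (g i) (h (p i))))"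
    proof (intro sum.cong refl arg_cong2[of _ _ _ _ "(*)"] prod.cong)
      fix p i assume "p \<in> {p. p permutes {0..<?n}}" "i \<in> {0..<?n}"
      then have "i < ?n" "p i < ?n" using permutes_in_image[of p "{0..<?n}" i] by auto
      then show "mat ?n ?n (\<lambda>(a, b). f v (g a) (h b)) $$ (i, p i) = f v (g i) (h (p i))" by simp
    qed
    finally show ?thesis .
  qed
  have "\<exists>a b. \<forall>v. f v i j = a + (\<Sum>l<D. b l * of_real (v l))" if "i \<in> I" "j \<in> J" for i j
    using aff[OF that] by (simp add: affine_in_def)
  then obtain a b where ab: "\<And>i j v. i \<in> I \<Longrightarrow> j \<in> J \<Longrightarrow> f v i j = a i j + (\<Sum>l<D. b i j l * of_real (v l))"
    by metis
  have Fab: "F v = (\<Sum>p\<in>{p. p permutes {0..<?n}}. signof p *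
      (\<Prod>i = 0..<?n. a (g i) (h (p i)) + (\<Sum>l<D. b (g i) (h (p i)) l * of_real (v l))))" for v
    unfolding Fsum
  proof (intro sum.cong refl arg_cong2[of _ _ _ _ "(*)"] prod.cong)
    fix p i assume "p \<in> {p. p permutes {0..<?n}}" "i \<in> {0..<?n}"
    then have "i < ?n" "p i < ?n" using permutes_in_image[of p "{0..<?n}" i] by auto
    then show "f v (g i) (h (p i)) = a (g i) (h (p i)) + (\<Sum>l<D. b (g i) (h (p i)) l * of_real (v l))"
      by (intro ab gI hJ)
  qed
  have "AE v in PiM {..<D} (\<lambda>_. lborel). F (\<lambda>i. if i < D then v i else v0 i) \<noteq> 0"
  proof (rule AE_nonzero_of_coordinatewise_poly)
    fix v l
    define P where "P i j = [: a i j + (\<Sum>m\<in>{..<D}-{l}. b i j m * of_real (v m)), if l < D then b i j l else 0 :]" for i j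
    have split: "a i j + (\<Sum>m<D. b i j m * of_real ((v(l := t)) m)) = poly (P i j) (of_real t)" for i j t
    proof (cases "l < D")
      case True
      then have "(\<Sum>m<D. b i j m * of_real ((v(l := t)) m)) = b i j l * of_real t + (\<Sum>m\<in>{..<D}-{l}. b i j m * of_real ((v(l := t)) m))"
        by (subst sum.remove[of _ l]) auto
      also have "(\<Sum>m\<in>{..<D}-{l}. b i j m * of_real ((v(l := t)) m)) = (\<Sum>m\<in>{..<D}-{l}. b i j m * of_real (v m))"
        by (intro sum.cong) auto
      finally show ?thesis using True by (simp add: P_def)
    next
      case False
      have "(\<Sum>m<D. b i j m * of_real ((v(l := t)) m)) = (\<Sum>m\<in>{..<D}-{l}. b i j m * of_real (v m))"
        using False by (intro sum.cong) auto
      then show ?thesis using False by (simp add: P_def)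
    qed
    have "F (v(l := t)) = poly (\<Sum>p\<in>{p. p permutes {0..<?n}}. [: signof p :] * (\<Prod>i = 0..<?n. P (g i) (h (p i)))) (of_real t)" for t
      unfolding Fab split by (simp add: poly_sum poly_prod)
    then show "\<exists>p. \<forall>t. F (v(l := t)) = poly p (of_real t)" by blast
  next
    fix n
    have "(\<lambda>v. complex_of_real (if l < n then v l else v0 l)) \<in> borel_measurable (PiM {..<n} (\<lambda>_. lborel))" for l
      by (cases "l < n") (auto intro!: measurable_component_singleton[THEN measurable_compose])
    then show "(\<lambda>v. F (\<lambda>i. if i < n then v i else v0 i)) \<in> borel_measurable (PiM {..<n} (\<lambda>_. lborel))"
      unfolding Fab by (intro borel_measurable_sum borel_measurable_times borel_measurable_prod borel_measurable_add borel_measurable_const)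
  next
    show "F v0 \<noteq> 0" unfolding F_def using nonsing_iff_det[OF g h] ns by blast
  qed
  \<comment> \<open>\<open>F\<close> reads only the coordinates below \<open>D\<close>, so filling
    the others from \<open>v0\<close> changes nothing.\<close>
  moreover have "F (\<lambda>i. if i < D then v i else v0 i) = F v" for v
    unfolding Fab by (intro sum.cong refl arg_cong2[of _ _ _ _ "(*)"] prod.cong arg_cong2[of _ _ _ _ "(+)"]) auto
  ultimately show ?thesis unfolding F_def using nonsing_iff_det[OF g h] by simp
qed

text \<open>Over \<open>S\<close> channel uses, each index \<open>j\<close> stands for two symbols, exchanged by the users other than
  \<open>\<beta> j\<close>: user \<open>k\<close> sends its one along \<open>x k j\<close>, and \<open>A j\<close> is the linear functional by which the relay
  extracts the sum. With \<open>A\<close> and \<open>x\<close> exchanged the same condition for the transposed downlink matrices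
  provides the beams of the relay and the zero-forcing functionals of the users.\<close>
definition aligned :: "nat \<Rightarrow> nat \<Rightarrow> nat \<Rightarrow> 'r set \<Rightarrow> ('r \<Rightarrow> nat) \<Rightarrow> (nat \<Rightarrow> cmat) \<Rightarrow> bool" where
  "aligned M N S R \<beta> H \<longleftrightarrow>
    (\<exists>(A :: 'r \<Rightarrow> nat \<Rightarrow> nat \<Rightarrow> complex) (x :: nat \<Rightarrow> 'r \<Rightarrow> nat \<Rightarrow> nat \<Rightarrow> complex).
      \<forall>k<3. \<forall>j\<in>R. \<beta> j \<noteq> k \<longrightarrow> (\<forall>j'\<in>R.
        (\<Sum>i<N. \<Sum>s<S. A j' i s * (\<Sum>a<M. H k i a * x k j a s)) = (if j' = j then 1 else 0)))"

text \<open>The rows of \<open>A\<close> indexed by \<open>\<beta> r = k\<close> annihilate the column space of \<open>F k\<close>; the second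
  hypothesis makes \<open>A\<close> invertible, and the columns of its inverse lie in pairwise intersections
  of the three column spaces.\<close>
lemma alignment_basis:
  fixes F :: "nat \<Rightarrow> 'r \<Rightarrow> 'c \<Rightarrow> complex" and J :: "nat \<Rightarrow> 'c set"
  assumes R: "finite R" and \<beta>: "\<And>r. r \<in> R \<Longrightarrow> \<beta> r < 3"
    and ns: "\<And>k. k < 3 \<Longrightarrow> nonsing {r\<in>R. \<beta> r \<noteq> k} (J k) (F k)"
    and triple: "\<And>x. (\<And>r k. r \<in> R \<Longrightarrow> k < 3 \<Longrightarrow> (\<Sum>c\<in>J k. F k r c * x k c) = (\<Sum>c\<in>J 0. F 0 r c * x 0 c))
        \<Longrightarrow> (\<And>k c. k < 3 \<Longrightarrow> c \<in> J k \<Longrightarrow> x k c = 0)"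
  shows "\<exists>A x. \<forall>k<3. \<forall>j\<in>R. \<beta> j \<noteq> k \<longrightarrow> (\<forall>j'\<in>R.
     (\<Sum>r\<in>R. A j' r * (\<Sum>c\<in>J k. F k r c * x k j c)) = (if j' = j then 1 else (0::complex)))"
proof -
  let ?R = "\<lambda>k. {r\<in>R. \<beta> r \<noteq> k}"
  \<comment> \<open>The transposed block is solvable, so row \<open>r\<close> of
    \<open>F (\<beta> r)\<close> is a combination of the rows with other labels; \<open>L r\<close>
    holds its coefficients.\<close>
  have "\<exists>y. \<forall>c\<in>J (\<beta> r). (\<Sum>r'\<in>?R (\<beta> r). F (\<beta> r) r' c * y r') = F (\<beta> r) r c" if "r \<in> R" for r
    using nonsing_solve[OF nonsing_transpose[OF ns[OF \<beta>[OF that]]]] by blast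
  then have "\<forall>r\<in>R. \<exists>y. \<forall>c\<in>J (\<beta> r). (\<Sum>r'\<in>?R (\<beta> r). F (\<beta> r) r' c * y r') = F (\<beta> r) r c" by simp
  then obtain L where "\<forall>r\<in>R. \<forall>c\<in>J (\<beta> r). (\<Sum>r'\<in>?R (\<beta> r). F (\<beta> r) r' c * L r r') = F (\<beta> r) r c"
    by (rule bchoice[THEN exE])
  then have L: "\<And>r c. r \<in> R \<Longrightarrow> c \<in> J (\<beta> r) \<Longrightarrow> (\<Sum>r'\<in>?R (\<beta> r). F (\<beta> r) r' c * L r r') = F (\<beta> r) r c"
    by simp
  define A where "A r r' = (if r' = r then 1 else 0) - (if \<beta> r' \<noteq> \<beta> r then L r r' else 0)" for r r'
  have Av: "(\<Sum>r'\<in>R. A r r' * v r') = v r - (\<Sum>r'\<in>?R (\<beta> r). L r r' * v r')" if "r \<in> R" for r v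
  proof -
    have "(\<Sum>r'\<in>R. A r r' * v r') = (\<Sum>r'\<in>R. if r' = r then v r' else 0) - (\<Sum>r'\<in>R. if \<beta> r' \<noteq> \<beta> r then L r r' * v r' else 0)"
      by (subst sum_subtractf[symmetric]) (auto simp: A_def algebra_simps intro!: sum.cong)
    also have "(\<Sum>r'\<in>R. if r' = r then v r' else 0) = v r" using R that by simp
    also have "(\<Sum>r'\<in>R. if \<beta> r' \<noteq> \<beta> r then L r r' * v r' else 0) = (\<Sum>r'\<in>?R (\<beta> r). L r r' * v r')"
      using R by (simp add: sum.inter_filter)
    finally show ?thesis .
  qed
  \<comment> \<open>The column space of \<open>F k\<close> is all that the rows of \<open>A\<close>
    labelled \<open>k\<close> annihilate: the remaining rows determine a preimage, and the linear
    relations \<open>L\<close> then match the rows labelled \<open>k\<close>.\<close>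
  have range: "\<exists>x. \<forall>r\<in>R. (\<Sum>c\<in>J k. F k r c * x c) = v r"
    if k: "k < 3" and v: "\<And>r. r \<in> R \<Longrightarrow> \<beta> r = k \<Longrightarrow> (\<Sum>r'\<in>R. A r r' * v r') = 0" for k v
  proof -
    obtain x where x: "\<And>r. r \<in> ?R k \<Longrightarrow> (\<Sum>c\<in>J k. F k r c * x c) = v r"
      using nonsing_solve[OF ns[OF k], of v] by blast
    have "(\<Sum>c\<in>J k. F k r c * x c) = v r" if r: "r \<in> R" for r
    proof (cases "\<beta> r = k")
      case True
      have "(\<Sum>c\<in>J k. F k r c * x c) = (\<Sum>c\<in>J k. (\<Sum>r'\<in>?R k. F k r' c * L r r') * x c)"
        using L[OF r] True by (intro sum.cong) auto
      also have "\<dots> = (\<Sum>r'\<in>?R k. L r r' * (\<Sum>c\<in>J k. F k r' c * x c))"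
        unfolding sum_distrib_left sum_distrib_right
        by (subst sum.swap) (intro sum.cong refl, simp only: mult_ac)
      also have "\<dots> = (\<Sum>r'\<in>?R k. L r r' * v r')" using x by (intro sum.cong) auto
      also have "\<dots> = v r" using Av[OF r, of v] v[OF r True] True by simp
      finally show ?thesis .
    qed (use r x in auto)
    then show ?thesis by blast
  qed
  \<comment> \<open>A vector in the kernel of \<open>A\<close> lies in all three column spaces,
    whose common part is zero by \<open>triple\<close>.\<close>
  have nsA: "nonsing R R A" unfolding nonsing_def
  proof (intro conjI R refl allI impI)
    fix v assume v: "\<forall>r\<in>R. (\<Sum>r'\<in>R. A r r' * v r') = 0"
    have "\<exists>x. \<forall>r\<in>R. (\<Sum>c\<in>J k. F k r c * x c) = v r" if "k < 3" for k
      by (rule range[OF that]) (use v in auto)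
    then obtain x where x: "\<And>k r. k < 3 \<Longrightarrow> r \<in> R \<Longrightarrow> (\<Sum>c\<in>J k. F k r c * x k c) = v r" by metis
    have z: "x k c = 0" if "k < 3" "c \<in> J k" for k c
      by (rule triple[OF _ that]) (simp add: x)
    show "\<forall>r\<in>R. v r = 0"
    proof
      fix r assume "r \<in> R"
      then have "v r = (\<Sum>c\<in>J 0. F 0 r c * x 0 c)" using x[of 0 r] by simp
      also have "\<dots> = 0" using z[of 0] by simp
      finally show "v r = 0" .
    qed
  qed
  have "\<exists>a. \<forall>r\<in>R. (\<Sum>r'\<in>R. A r r' * a r') = (if r = j then 1 else 0)" for j
    by (rule nonsing_solve[OF nsA])
  then obtain a where a: "\<And>j r. r \<in> R \<Longrightarrow> (\<Sum>r'\<in>R. A r r' * a j r') = (if r = j then 1 else 0)" by metis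
  \<comment> \<open>Column \<open>j\<close> of the inverse is annihilated by every row except row
    \<open>j\<close>, in particular by all rows labelled \<open>k \<noteq> \<beta> j\<close>. It
    thus lies in the column spaces of both users other than \<open>\<beta> j\<close>.\<close>
  have "\<exists>x. \<forall>r\<in>R. (\<Sum>c\<in>J k. F k r c * x c) = a j r" if "k < 3" "\<beta> j \<noteq> k" for k j
    by (rule range[OF that(1)]) (use a that in auto)
  then obtain x where x: "\<And>k j r. k < 3 \<Longrightarrow> \<beta> j \<noteq> k \<Longrightarrow> r \<in> R \<Longrightarrow> (\<Sum>c\<in>J k. F k r c * x k j c) = a j r"
    by metis
  show ?thesis
    by (rule exI[of _ A], rule exI[of _ x]) (use x a in auto)
qed

text \<open>The symbol-extended channel followed by a fixed linear map \<open>Q\<close> at the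
  relay. Column \<open>(s, a)\<close> is antenna \<open>a\<close> in slot \<open>s\<close>; the
  channel does not change between slots. Row \<open>r\<close> is one dimension kept by the
  relay.\<close>

definition ext_chan :: "('r \<Rightarrow> nat \<Rightarrow> nat \<Rightarrow> complex) \<Rightarrow> nat \<Rightarrow> (nat \<Rightarrow> cmat) \<Rightarrow> nat \<Rightarrow> 'r \<Rightarrow> nat \<times> nat \<Rightarrow> complex" where
  "ext_chan Q N H k r c = (\<Sum>i<N. Q r (fst c) i * H k i (snd c))"

text \<open>The system \<open>F 0 x\<^sub>0 - F 1 x\<^sub>1 = F 0 x\<^sub>0 - F 2 x\<^sub>2 = 0\<close>: its nonsingularity says that the three column
  spaces have trivial common intersection.\<close>
definition stacked_difference :: "(nat \<Rightarrow> 'r \<Rightarrow> 'c \<Rightarrow> complex) \<Rightarrow> bool \<times> 'r \<Rightarrow> nat \<times> 'c \<Rightarrow> complex" where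
  "stacked_difference F br kc = (if fst kc = 0 then F 0 (snd br) (snd kc)
     else if fst kc = (if fst br then 1 else 2) then - F (fst kc) (snd br) (snd kc) else 0)"

text \<open>Both requirements are determinants of matrices affine in the channel entries, which is
  what lets a single example imply them almost everywhere.\<close>

definition generic_position ::
  "nat \<Rightarrow> 'r set \<Rightarrow> ('r \<Rightarrow> nat) \<Rightarrow> (nat \<Rightarrow> (nat \<times> nat) set) \<Rightarrow> ('r \<Rightarrow> nat \<Rightarrow> nat \<Rightarrow> complex) \<Rightarrow> (nat \<Rightarrow> cmat) \<Rightarrow> bool" where
  "generic_position N R \<beta> J Q H \<longleftrightarrow>
     (\<forall>k<3. nonsing {r\<in>R. \<beta> r \<noteq> k} (J k) (ext_chan Q N H k)) \<and>
     nonsing (UNIV \<times> R) (Sigma {..<3} J) (stacked_difference (ext_chan Q N H))"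

lemma stacked_difference_sum:
  assumes J: "\<And>k. k < 3 \<Longrightarrow> finite (J k)"
  shows "(\<Sum>c\<in>Sigma {..<3} J. stacked_difference F (b, r) c * x c)
    = (\<Sum>c\<in>J 0. F 0 r c * x (0, c)) - (\<Sum>c\<in>J (if b then 1 else 2). F (if b then 1 else 2) r c * x (if b then 1 else 2, c))"
proof -
  have 3: "{..<3} = {0, 1, 2::nat}" by auto
  have "(\<Sum>c\<in>Sigma {..<3} J. stacked_difference F (b, r) c * x c)
      = (\<Sum>k<3. \<Sum>c\<in>J k. stacked_difference F (b, r) (k, c) * x (k, c))"
    using J by (subst sum.Sigma) (auto simp: case_prod_beta)
  also have "\<dots> = (\<Sum>c\<in>J 0. F 0 r c * x (0, c)) - (\<Sum>c\<in>J (if b then 1 else 2). F (if b then 1 else 2) r c * x (if b then 1 else 2, c))"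
    unfolding 3 by (cases b) (auto simp: stacked_difference_def sum_negf)
  finally show ?thesis .
qed

lemma aligned_of_generic_position:
  assumes R: "finite R" and \<beta>: "\<And>r. r \<in> R \<Longrightarrow> \<beta> r < 3"
    and J: "\<And>k. k < 3 \<Longrightarrow> J k \<subseteq> {..<S} \<times> {..<M}"
    and gp: "generic_position N R \<beta> J Q H"
  shows "aligned M N S R \<beta> H"
proof -
  let ?F = "ext_chan Q N H"
  have finJ: "finite (J k)" if "k < 3" for k using J[OF that] by (rule finite_subset) auto
  have "\<exists>A x. \<forall>k<3. \<forall>j\<in>R. \<beta> j \<noteq> k \<longrightarrow> (\<forall>j'\<in>R.
     (\<Sum>r\<in>R. A j' r * (\<Sum>c\<in>J k. ?F k r c * x k j c)) = (if j' = j then 1 else (0::complex)))"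
  proof (rule alignment_basis[OF R \<beta>])
    show "nonsing {r\<in>R. \<beta> r \<noteq> k} (J k) (?F k)" if "k < 3" for k
      using gp that by (simp add: generic_position_def)
    fix x k c assume eq: "\<And>r k. r \<in> R \<Longrightarrow> k < 3 \<Longrightarrow> (\<Sum>c\<in>J k. ?F k r c * x k c) = (\<Sum>c\<in>J 0. ?F 0 r c * x 0 c)"
      and kc: "k < 3" "c \<in> J k"
    have "(\<Sum>c\<in>Sigma {..<3} J. stacked_difference ?F i c * (case c of (k, c) \<Rightarrow> x k c)) = 0"
      if iR: "i \<in> UNIV \<times> R" for i
    proof -
      obtain b r where i: "i = (b, r)" "r \<in> R" using iR by blast
      have "(\<Sum>c\<in>Sigma {..<3} J. stacked_difference ?F (b, r) c * (case c of (k, c) \<Rightarrow> x k c)) =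
        (\<Sum>c\<in>J 0. ?F 0 r c * (case (0, c) of (k, c) \<Rightarrow> x k c)) - (\<Sum>c\<in>J (if b then 1 else 2). ?F (if b then 1 else 2) r c * (case (if b then 1 else 2, c) of (k, c) \<Rightarrow> x k c))"
        by (rule stacked_difference_sum) (rule finJ)
      also have "\<dots> = 0" using eq[OF i(2), of "if b then 1 else 2"] by (auto split: if_splits)
      finally show ?thesis using i by simp
    qed
    then have "\<forall>c\<in>Sigma {..<3} J. (case c of (k, c) \<Rightarrow> x k c) = 0"
      using gp unfolding generic_position_def nonsing_def by blast
    then show "x k c = 0" using kc by auto
  qed auto
  then obtain A x where Ax: "\<And>k j j'. k < 3 \<Longrightarrow> j \<in> R \<Longrightarrow> \<beta> j \<noteq> k \<Longrightarrow> j' \<in> R \<Longrightarrow>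
     (\<Sum>r\<in>R. A j' r * (\<Sum>c\<in>J k. ?F k r c * x k j c)) = (if j' = j then 1 else (0::complex))" by blast
  \<comment> \<open>The compression \<open>Q\<close> is absorbed into the functionals of the relay,
    and slots and antennas outside \<open>J k\<close> are left silent by \<open>x'\<close>.\<close>
  define A' where "A' j i s = (\<Sum>r\<in>R. A j r * Q r s i)" for j i s
  define x' where "x' k j a s = (if (s, a) \<in> J k then x k j (s, a) else 0)" for k j a s
  have eq: "(\<Sum>i<N. \<Sum>s<S. A' j' i s * (\<Sum>a<M. H k i a * x' k j a s)) = (\<Sum>r\<in>R. A j' r * (\<Sum>c\<in>J k. ?F k r c * x k j c))"
    if k: "k < 3" for k j j'
  proof -
    have inner: "(\<Sum>c\<in>J k. ?F k r c * x k j c) = (\<Sum>s<S. \<Sum>a<M. \<Sum>i<N. Q r s i * H k i a * x' k j a s)" for r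
    proof -
      have "(\<Sum>c\<in>J k. ?F k r c * x k j c) = (\<Sum>c\<in>J k. ?F k r c * x' k j (snd c) (fst c))"
        by (intro sum.cong) (auto simp: x'_def)
      also have "\<dots> = (\<Sum>c\<in>{..<S} \<times> {..<M}. ?F k r c * x' k j (snd c) (fst c))"
        by (rule sum.mono_neutral_left) (use J[OF k] in \<open>auto simp: x'_def\<close>)
      also have "\<dots> = (\<Sum>s<S. \<Sum>a<M. ?F k r (s, a) * x' k j a s)"
        by (simp add: sum.cartesian_product case_prod_beta)
      finally show ?thesis by (simp add: ext_chan_def sum_distrib_right)
    qed
    let ?t = "\<lambda>r s i a. A j' r * (Q r s i * H k i a * x' k j a s)"
    have "(\<Sum>i<N. \<Sum>s<S. A' j' i s * (\<Sum>a<M. H k i a * x' k j a s))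
       = (\<Sum>i<N. \<Sum>s<S. \<Sum>r\<in>R. \<Sum>a<M. ?t r s i a)"
      by (simp add: A'_def sum_distrib_left sum_distrib_right mult_ac)
         (intro sum.cong refl, rule sum.swap)
    also have "\<dots> = (\<Sum>s<S. \<Sum>i<N. \<Sum>r\<in>R. \<Sum>a<M. ?t r s i a)"
      by (rule sum.swap)
    also have "\<dots> = (\<Sum>s<S. \<Sum>r\<in>R. \<Sum>i<N. \<Sum>a<M. ?t r s i a)"
      by (intro sum.cong refl, rule sum.swap)
    also have "\<dots> = (\<Sum>r\<in>R. \<Sum>s<S. \<Sum>i<N. \<Sum>a<M. ?t r s i a)"
      by (rule sum.swap)
    also have "\<dots> = (\<Sum>r\<in>R. \<Sum>s<S. \<Sum>a<M. \<Sum>i<N. ?t r s i a)"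
      by (rule sum.cong[OF refl], rule sum.cong[OF refl], rule sum.swap)
    also have "\<dots> = (\<Sum>r\<in>R. A j' r * (\<Sum>c\<in>J k. ?F k r c * x k j c))"
      unfolding inner by (simp add: sum_distrib_left)
    finally show ?thesis .
  qed
  show ?thesis unfolding aligned_def
    by (rule exI[of _ A'], rule exI[of _ x']) (use Ax eq in auto)
qed

section \<open>Channels as points of a real coordinate space\<close>

text \<open>The row-major numbering implicit in \<open>chan_H\<close> and \<open>chan_G\<close>.
  Naming it allows a prescribed channel to be encoded as a parameter vector by inverting it with
  \<open>div\<close> and \<open>mod\<close>.\<close>

definition entry_index :: "nat \<Rightarrow> nat \<Rightarrow> nat \<Rightarrow> nat \<Rightarrow> nat \<Rightarrow> nat" where
  "entry_index P L k i j = (k * P + i) * L + j"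

lemma entry_index_less:
  assumes "k < K" "i < P" "j < L" shows "entry_index P L k i j < K * P * L"
proof -
  have "k * P + i < K * P" using assms
    by (metis add.commute add_mult_distrib2 less_le_trans mult.commute mult_Suc_right nat_add_left_cancel_less Suc_leI mult_le_mono2)
  then have "Suc (k * P + i) * L \<le> K * P * L" by (intro mult_le_mono1) simp
  then show ?thesis using assms(3) by (simp add: entry_index_def)
qed

lemma entry_index_decode:
  assumes "i < P" "j < L"
  shows "entry_index P L k i j mod L = j" "entry_index P L k i j div L mod P = i" "entry_index P L k i j div L div P = k"
  using assms by (auto simp: entry_index_def)

lemma chan_H_entry:
  "k < K \<Longrightarrow> i < N \<Longrightarrow> j < M \<Longrightarrow>
    chan_H K M N v k i j = Complex (v (2 * entry_index N M k i j)) (v (2 * entry_index N M k i j + 1))"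
  by (simp add: chan_H_def entry_index_def)

lemma chan_G_entry:
  "k < K \<Longrightarrow> i < M \<Longrightarrow> j < N \<Longrightarrow>
    chan_G K M N v k i j = Complex (v (2 * K * N * M + 2 * entry_index M N k i j))
      (v (2 * K * N * M + 2 * entry_index M N k i j + 1))"
  by (simp add: chan_G_def entry_index_def)

lemma AE_generic_position:
  assumes ent: "\<And>k i j. k < 3 \<Longrightarrow> i < N \<Longrightarrow> j < M \<Longrightarrow> affine_in D (\<lambda>v. H v k i j)"
    and J: "\<And>k. k < 3 \<Longrightarrow> J k \<subseteq> {..<S} \<times> {..<M}"
    and gp: "generic_position N R \<beta> J Q (H v0)"
  shows "AE v in PiM {..<D} (\<lambda>_. lborel). generic_position N R \<beta> J Q (H v)"
proof -
  have aff: "affine_in D (\<lambda>v. ext_chan Q N (H v) k r c)" if "k < 3" "c \<in> J k" for k r c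
    unfolding ext_chan_def using that J[OF that(1)]
    by (intro affine_in_sum affine_in_cmult ent) auto
  have "AE v in PiM {..<D} (\<lambda>_. lborel). nonsing {r\<in>R. \<beta> r \<noteq> k} (J k) (ext_chan Q N (H v) k)" if "k < 3" for k
    by (rule AE_nonsing[where ?v0.0 = v0]) (use aff that gp in \<open>auto simp: generic_position_def\<close>)
  then have 1: "AE v in PiM {..<D} (\<lambda>_. lborel). \<forall>k\<in>{..<3}. nonsing {r\<in>R. \<beta> r \<noteq> k} (J k) (ext_chan Q N (H v) k)"
    by (intro AE_finite_allI) auto
  have aff2: "affine_in D (\<lambda>v. stacked_difference (ext_chan Q N (H v)) br kc)" if kc: "kc \<in> Sigma {..<3} J" for br kc
  proof -
    have neg: "affine_in D (\<lambda>v. - ext_chan Q N (H v) k r c)" if "k < 3" "c \<in> J k" for k r c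
      using affine_in_cmult[OF aff[OF that], of "-1"] by simp
    obtain k c where [simp]: "kc = (k, c)" and k: "k < 3" "c \<in> J k" using kc by auto
    show ?thesis
      by (cases "k = 0"; cases "k = (if fst br then 1 else 2)")
         (use aff[of 0 c] aff[OF k] neg[OF k] k in \<open>auto simp: stacked_difference_def affine_in_const\<close>)
  qed
  have 2: "AE v in PiM {..<D} (\<lambda>_. lborel). nonsing (UNIV \<times> R) (Sigma {..<3} J) (stacked_difference (ext_chan Q N (H v)))"
    by (rule AE_nonsing[where ?v0.0 = v0]) (use aff2 gp in \<open>auto simp: generic_position_def\<close>)
  from 1 2 show ?thesis unfolding generic_position_def by eventually_elim auto
qed

text \<open>The transposed downlink has the shape of the uplink, so one witness \<open>H0\<close>
  serves both directions.\<close>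

lemma AE_aligned:
  assumes R: "finite R" and \<beta>: "\<And>r. r \<in> R \<Longrightarrow> \<beta> r < 3"
    and J: "\<And>k. k < 3 \<Longrightarrow> J k \<subseteq> {..<S} \<times> {..<M}"
    and gp: "generic_position N R \<beta> J Q H0"
  shows "AE v in PiM {..<chan_dim 3 M N} (\<lambda>_. lborel).
     aligned M N S R \<beta> (chan_H 3 M N v) \<and> aligned M N S R \<beta> (\<lambda>k i a. chan_G 3 M N v k a i)"
proof -
  have ext0: "generic_position N R \<beta> J Q H = generic_position N R \<beta> J Q H0"
    if "\<And>k i a. k < 3 \<Longrightarrow> i < N \<Longrightarrow> a < M \<Longrightarrow> H k i a = H0 k i a" for H
  proof -
    have e: "ext_chan Q N H k r c = ext_chan Q N H0 k r c" if "k < 3" "c \<in> J k" for k r c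
      using that J[OF that(1)] \<open>\<And>k i a. k < 3 \<Longrightarrow> i < N \<Longrightarrow> a < M \<Longrightarrow> H k i a = H0 k i a\<close>
      by (auto simp: ext_chan_def intro!: sum.cong)
    have c: "nonsing I J' f = nonsing I J' g" if "\<And>i j. i \<in> I \<Longrightarrow> j \<in> J' \<Longrightarrow> f i j = g i j"
      for I :: "'i set" and J' :: "'j set" and f g
      unfolding nonsing_def using that by (simp cong: sum.cong)
    have "nonsing (UNIV \<times> R) (Sigma {..<3} J) (stacked_difference (ext_chan Q N H))
        = nonsing (UNIV \<times> R) (Sigma {..<3} J) (stacked_difference (ext_chan Q N H0))"
      by (rule c) (use e in \<open>auto simp: stacked_difference_def\<close>)
    moreover have "nonsing {r\<in>R. \<beta> r \<noteq> k} (J k) (ext_chan Q N H k) = nonsing {r\<in>R. \<beta> r \<noteq> k} (J k) (ext_chan Q N H0 k)"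
      if "k < 3" for k by (rule c) (use e that in auto)
    ultimately show ?thesis unfolding generic_position_def by auto
  qed
  \<comment> \<open>Parameter vectors realizing \<open>H0\<close>: parity selects real or imaginary
    part and the halved index is decoded. In \<open>vG\<close> the index starts after the uplink
    block, and \<open>i\<close> and \<open>a\<close> trade places because the downlink matrices are
    stored untransposed.\<close>
  define vH where "vH l = (let q = l div 2; z = H0 (q div M div N) (q div M mod N) (q mod M) in if even l then Re z else Im z)" for l
  define off where "off = 3 * N * M"
  define vG where "vG l = (let q = (l - 2 * off) div 2; z = H0 (q div N div M) (q mod N) (q div N mod M) in if even l then Re z else Im z)" for l
  have b1: "2 * entry_index N M k i j + 1 < chan_dim 3 M N" if "k < 3" "i < N" "j < M" for k i j
    using entry_index_less[OF that] by (simp add: chan_dim_def mult.commute[of M N] mult.assoc)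
  have b2: "2 * 3 * N * M + (2 * entry_index M N k i j + 1) < chan_dim 3 M N" if "k < 3" "i < M" "j < N" for k i j
    using entry_index_less[OF that] by (simp add: chan_dim_def mult.commute[of M N] mult.assoc)
  have "AE v in PiM {..<chan_dim 3 M N} (\<lambda>_. lborel). generic_position N R \<beta> J Q (chan_H 3 M N v)"
  proof (rule AE_generic_position[OF _ J, where ?v0.0 = vH])
    show "affine_in (chan_dim 3 M N) (\<lambda>v. chan_H 3 M N v k i j)" if "k < 3" "i < N" "j < M" for k i j
      unfolding chan_H_entry[OF that] using b1[OF that] by (intro affine_in_Complex) auto
    have "chan_H 3 M N vH k i a = H0 k i a" if "k < 3" "i < N" "a < M" for k i a
      unfolding chan_H_entry[OF that] using entry_index_decode[OF that(2,3), of k] by (simp add: vH_def)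
    then show "generic_position N R \<beta> J Q (chan_H 3 M N vH)" using ext0 gp by blast
  qed auto
  moreover have "AE v in PiM {..<chan_dim 3 M N} (\<lambda>_. lborel). generic_position N R \<beta> J Q (\<lambda>k i a. chan_G 3 M N v k a i)"
  proof (rule AE_generic_position[OF _ J, where ?v0.0 = vG])
    show "affine_in (chan_dim 3 M N) (\<lambda>v. chan_G 3 M N v k j i)" if "k < 3" "i < N" "j < M" for k i j
      unfolding chan_G_entry[OF that(1,3,2)] using b2[OF that(1,3,2)] by (intro affine_in_Complex) auto
    have "chan_G 3 M N vG k a i = H0 k i a" if "k < 3" "i < N" "a < M" for k i a
    proof -
      have o: "2 * 3 * N * M = 2 * off" by (simp add: off_def)
      have "vG (2 * off + 2 * e) = Re (H0 (e div N div M) (e mod N) (e div N mod M))"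
        "vG (2 * off + 2 * e + 1) = Im (H0 (e div N div M) (e mod N) (e div N mod M))" for e
        by (simp_all add: vG_def)
      then show ?thesis
        unfolding chan_G_entry[OF that(1,3,2)] o by (simp only: entry_index_decode[OF that(3,2)] complex_surj)
    qed
    then have "generic_position N R \<beta> J Q (\<lambda>k i a. chan_G 3 M N vG k a i) = generic_position N R \<beta> J Q H0"
      by (rule ext0)
    then show "generic_position N R \<beta> J Q (\<lambda>k i a. chan_G 3 M N vG k a i)" using gp by simp
  qed auto
  ultimately show ?thesis
  proof eventually_elim
    case (elim v)
    show ?case
      using aligned_of_generic_position[OF R \<beta> J elim(1)] aligned_of_generic_position[OF R \<beta> J elim(2)] by simp
  qed
qed

section \<open>Explicit channels in generic position\<close>

text \<open>Every row label is avoided by exactly two users, so the stacked system has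
  \<open>2 * card R\<close> unknowns and is square. A solution of it is a vector common to the three
  column spaces; \<open>common\<close> kills that vector and \<open>inj\<close> then kills the
  preimages.\<close>

lemma generic_positionI:
  assumes R: "finite R" and \<beta>: "\<And>r. r \<in> R \<Longrightarrow> \<beta> r < 3"
    and J: "\<And>k. k < 3 \<Longrightarrow> finite (J k)" and card: "\<And>k. k < 3 \<Longrightarrow> card (J k) = card {r\<in>R. \<beta> r \<noteq> k}"
    and inj: "\<And>k x c. k < 3 \<Longrightarrow> (\<And>r. r \<in> R \<Longrightarrow> \<beta> r \<noteq> k \<Longrightarrow> (\<Sum>c\<in>J k. ext_chan Q N H k r c * x c) = 0) \<Longrightarrow> c \<in> J k \<Longrightarrow> x c = 0"
    and common: "\<And>v x r. (\<And>k r. k < 3 \<Longrightarrow> r \<in> R \<Longrightarrow> (\<Sum>c\<in>J k. ext_chan Q N H k r c * x k c) = v r) \<Longrightarrow> r \<in> R \<Longrightarrow> v r = 0"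
  shows "generic_position N R \<beta> J Q H"
  unfolding generic_position_def
proof (intro conjI allI impI)
  fix k :: nat assume k: "k < 3"
  show "nonsing {r\<in>R. \<beta> r \<noteq> k} (J k) (ext_chan Q N H k)"
    unfolding nonsing_def using R J[OF k] card[OF k] inj[OF k] by auto
next
  let ?F = "ext_chan Q N H"
  have "(\<Sum>k<3. card (J k)) = (\<Sum>k<3. \<Sum>r\<in>R. if \<beta> r \<noteq> k then 1 else 0)"
    using R card by (simp add: sum.If_cases Int_def)
  also have "\<dots> = (\<Sum>r\<in>R. \<Sum>k<3. if \<beta> r \<noteq> k then 1 else 0)" by (rule sum.swap)
  also have "\<dots> = (\<Sum>r\<in>R. 2)"
  proof (rule sum.cong[OF refl])
    fix r assume "r \<in> R"
    then have "\<beta> r = 0 \<or> \<beta> r = 1 \<or> \<beta> r = 2" using \<beta> by fastforce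
    then show "(\<Sum>k<3. if \<beta> r \<noteq> k then 1 else 0) = (2::nat)" by (auto simp: numeral_3_eq_3 lessThan_Suc)
  qed
  finally have cards: "(\<Sum>k<3. card (J k)) = 2 * card R" by simp
  show "nonsing (UNIV \<times> R) (Sigma {..<3} J) (stacked_difference ?F)"
    unfolding nonsing_def
  proof (intro conjI allI impI)
    show "finite ((UNIV :: bool set) \<times> R)" "finite (Sigma {..<3} J)" using R J by auto
    show "card ((UNIV :: bool set) \<times> R) = card (Sigma {..<3} J)"
      using cards J by (simp add: card_cartesian_product card_SigmaI)
    fix x assume x: "\<forall>i\<in>UNIV \<times> R. (\<Sum>j\<in>Sigma {..<3} J. stacked_difference ?F i j * x j) = 0"
    define v where "v r = (\<Sum>c\<in>J 0. ?F 0 r c * x (0, c))" for r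
    have e: "v r = (\<Sum>c\<in>J (if b then 1 else 2). ?F (if b then 1 else 2) r c * x (if b then 1 else 2, c))" if "r \<in> R" for r b
    proof -
      have "(\<Sum>j\<in>Sigma {..<3} J. stacked_difference ?F (b, r) j * x j) = 0" using x that by blast
      then show ?thesis using stacked_difference_sum[of J, OF J, of ?F b r x] by (simp add: v_def)
    qed
    have F: "(\<Sum>c\<in>J k. ?F k r c * x (k, c)) = v r" if "k < 3" "r \<in> R" for k r
    proof -
      from that(1) consider "k = 0" | "k = 1" | "k = 2" by linarith
      then show ?thesis
        by cases (use e[OF that(2), of True] e[OF that(2), of False] in \<open>simp_all add: v_def\<close>)
    qed
    have v0: "v r = 0" if "r \<in> R" for r by (rule common[of "\<lambda>k c. x (k, c)" v, OF F that])
    show "\<forall>j\<in>Sigma {..<3} J. x j = 0"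
    proof
      fix j assume "j \<in> Sigma {..<3} J"
      then obtain k c where j: "j = (k, c)" "k < 3" "c \<in> J k" by blast
      show "x j = 0" unfolding j(1)
        by (rule inj[of k "\<lambda>c. x (k, c)"]) (use F v0 j in auto)
    qed
  qed
qed

lemma sum_single_coeff:
  fixes h :: "'a \<Rightarrow> complex"
  assumes "finite I" "i0 \<in> I"
  shows "(\<Sum>i\<in>I. (if i = i0 then c else 0) * h i) = c * h i0"
proof -
  have "(\<Sum>i\<in>I. (if i = i0 then c else 0) * h i) = (\<Sum>i\<in>I. if i = i0 then c * h i else 0)"
    by (intro sum.cong) auto
  then show ?thesis using assms by simp
qed

text \<open>Label \<open>k\<close> marks the coordinate axes that user \<open>k\<close> does not
  reach. Users 0 and 1 miss \<open>d\<close> axes each, so they need \<open>N - d \<le> M\<close>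
  antennas; user 2 reaches the other \<open>2 * d\<close> axes, and \<open>2 * d \<le> M\<close>
  follows from \<open>2 * N \<le> 3 * M\<close>. Truncated subtraction gives \<open>d = 0\<close>
  when \<open>M \<ge> N\<close>, and then only users 0 and 1 exchange data.\<close>

lemma generic_position_many_antennas:
  assumes MN: "2 * N \<le> 3 * M"
  defines "d \<equiv> N - M"
  defines "\<beta> \<equiv> \<lambda>r::nat. if r < d then 0 else if r < 2 * d then 1 else (2::nat)"
  defines "m \<equiv> \<lambda>k::nat. if k = 2 then 2 * d else N - d"
  obtains H0 where "generic_position N {..<N} \<beta> (\<lambda>k. {0::nat} \<times> {..<m k}) (\<lambda>r s i. if i = r then 1 else 0) H0"
proof -
  \<comment> \<open>Antenna \<open>a\<close> of user \<open>k\<close> feeds the axis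
    \<open>e k a\<close>; these are exactly the axes with a label other than
    \<open>k\<close>.\<close>
  define e where "e k a = (if k = 0 then d + a else if k = 1 then (if a < d then a else a + d) else a)" for k a :: nat
  define H0 :: "nat \<Rightarrow> cmat" where "H0 k i a = (if i = e k a then 1 else 0)" for k i a
  let ?Q = "\<lambda>(r::nat) (s::nat) i. if i = r then 1 else (0::complex)"
  have dN: "3 * d \<le> N" using MN by (auto simp: d_def)
  have ext: "ext_chan ?Q N H0 k r c = H0 k r (snd c)" if "r < N" for k r c
    unfolding ext_chan_def using sum_single_coeff[of "{..<N}" r 1 "\<lambda>i. H0 k i (snd c)"] that by simp
  have einj: "e k a = e k b \<Longrightarrow> a = b" for k a b
    by (auto simp: e_def split: if_splits)
  have eb: "e k a < N \<and> \<beta> (e k a) \<noteq> k" if "k < 3" "a < m k" for k a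
    using that dN by (auto simp: e_def \<beta>_def m_def split: if_splits)
  have esurj: "\<exists>a<m k. r = e k a" if "k < 3" "r < N" "\<beta> r \<noteq> k" for k r
  proof -
    from that(1) consider "k = 0" | "k = 1" | "k = 2" by linarith
    then show ?thesis
    proof cases
      case 1
      then show ?thesis using that by (intro exI[of _ "r - d"]) (auto simp: e_def \<beta>_def m_def split: if_splits)
    next
      case 2
      then show ?thesis using that dN by (intro exI[of _ "if r < d then r else r - d"]) (auto simp: e_def \<beta>_def m_def split: if_splits)
    next
      case 3
      then show ?thesis using that by (intro exI[of _ r]) (auto simp: e_def \<beta>_def m_def split: if_splits)
    qed
  qed
  let ?J = "\<lambda>k. {0::nat} \<times> {..<m k}"
  have hit: "(\<Sum>c\<in>?J k. ext_chan ?Q N H0 k (e k a) c * x c) = x (0, a)" if "k < 3" "a < m k" for k a x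
  proof -
    have "(\<Sum>c\<in>?J k. ext_chan ?Q N H0 k (e k a) c * x c) = (\<Sum>c\<in>?J k. (if c = (0, a) then 1 else 0) * x c)"
      using eb[OF that] by (intro sum.cong refl) (auto simp: ext H0_def dest: einj)
    then show ?thesis using sum_single_coeff[of "?J k" "(0, a)" 1 x] that by simp
  qed
  have miss: "(\<Sum>c\<in>?J k. ext_chan ?Q N H0 k r c * x c) = 0" if "k < 3" "r < N" "\<beta> r = k" for k r x
  proof (intro sum.neutral ballI)
    fix c assume "c \<in> ?J k"
    then have "e k (snd c) \<noteq> r" using eb[OF that(1), of "snd c"] that(3) by auto
    then show "ext_chan ?Q N H0 k r c * x c = 0" using that(2) by (simp add: ext H0_def)
  qed
  have "generic_position N {..<N} \<beta> ?J ?Q H0"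
  proof (rule generic_positionI)
    show "\<beta> r < 3" for r by (simp add: \<beta>_def)
    show "card (?J k) = card {r \<in> {..<N}. \<beta> r \<noteq> k}" if "k < 3" for k
    proof -
      have "{r \<in> {..<N}. \<beta> r \<noteq> k} = e k ` {..<m k}" using eb[OF that] esurj[OF that] by auto
      then show ?thesis using einj by (simp add: card_image inj_on_def)
    qed
    show "x c = 0" if "k < 3" "\<And>r. r \<in> {..<N} \<Longrightarrow> \<beta> r \<noteq> k \<Longrightarrow> (\<Sum>c\<in>?J k. ext_chan ?Q N H0 k r c * x c) = 0" "c \<in> ?J k" for k x c
    proof -
      from that(3) obtain a where c: "c = (0, a)" "a < m k" by auto
      show ?thesis using hit[OF that(1) c(2), of x] that(2)[of "e k a"] eb[OF that(1) c(2)] c by simp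
    qed
    \<comment> \<open>Each axis \<open>r\<close> is missed by user \<open>\<beta> r\<close>, so a
      common vector vanishes there.\<close>
    show "v r = 0" if "\<And>k r. k < 3 \<Longrightarrow> r \<in> {..<N} \<Longrightarrow> (\<Sum>c\<in>?J k. ext_chan ?Q N H0 k r c * x k c) = v r" "r \<in> {..<N}" for v x r
    proof -
      have b: "\<beta> r < 3" by (simp add: \<beta>_def)
      have "(\<Sum>c\<in>?J (\<beta> r). ext_chan ?Q N H0 (\<beta> r) r c * x (\<beta> r) c) = 0"
        by (rule miss[OF b]) (use that(2) in auto)
      then show ?thesis using that(1)[OF b that(2)] by simp
    qed
  qed auto
  then show thesis by (rule that)
qed

text \<open>In the instance the antennas are grouped into units with two user and three relay antennas,
  on which the column spaces are coordinate planes. For odd \<open>M\<close> one unit with one user and two relay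
  antennas is left, where no coordinate choice works: its three lines are \<open>(1,0)\<close>, \<open>(0,1)\<close>, \<open>(1,1)\<close>, and the
  relay maps the two received symbols \<open>p, r\<close> (first slot) and \<open>q, s\<close> (second slot) to \<open>r, q, p - s\<close>.\<close>
lemma generic_position_few_antennas:
  assumes MN: "3 * M \<le> 2 * N"
  obtains H0 Q where "generic_position N ({..<3} \<times> {..<M}) fst (\<lambda>k. {..<2::nat} \<times> {..<M}) Q H0"
proof -
  define m where "m = M div 2"
  \<comment> \<open>In a unit, user \<open>k\<close> spans the plane of the two axes other than
    \<open>k\<close>: \<open>oth k e\<close> is the axis of its antenna \<open>e\<close>, and
    \<open>pos k\<close> inverts this.\<close>
  define pos where "pos k l = (if l < k then l else l - 1)" for k l :: nat
  define oth where "oth k e = (if e < k then e else e + 1)" for k e :: nat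
  define H0 :: "nat \<Rightarrow> cmat" where "H0 k i a =
     (if a < 2 * m then (if i = 3 * (a div 2) + oth k (a mod 2) then 1 else 0)
      else if (i = 3 * m \<and> k \<noteq> 1) \<or> (i = 3 * m + 1 \<and> k \<noteq> 0) then 1 else 0)" for k i a
  \<comment> \<open>For \<open>b < 2 * m\<close> row \<open>(l, b)\<close> reads axis
    \<open>l\<close> of unit \<open>b div 2\<close> in slot \<open>b mod 2\<close>, so a unit
    accounts for two values of \<open>b\<close>. Index \<open>2 * m\<close> belongs to the leftover
    unit.\<close>
  define Q :: "nat \<times> nat \<Rightarrow> nat \<Rightarrow> nat \<Rightarrow> complex" where "Q r s i =
     (if snd r < 2 * m then (if i = 3 * (snd r div 2) + fst r then (if s = snd r mod 2 then 1 else 0) else 0)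
      else if fst r = 0 then (if i = 3 * m + 1 then (if s = 0 then 1 else 0) else 0)
      else if fst r = 1 then (if i = 3 * m then (if s = 1 then 1 else 0) else 0)
      else (if i = 3 * m then (if s = 0 then 1 else 0) else 0) + (if i = 3 * m + 1 then (if s = 1 then - 1 else 0) else 0))" for r s i
  let ?R = "{..<3::nat} \<times> {..<M}" and ?J = "{..<2::nat} \<times> {..<M}"
  let ?F = "ext_chan Q N H0"
  define odd_value :: "nat \<Rightarrow> nat \<Rightarrow> (nat \<times> nat \<Rightarrow> complex) \<Rightarrow> complex" where
    "odd_value k l x = (if l = 0 then (if k \<noteq> 0 then x (0, 2 * m) else 0)
        else if l = 1 then (if k \<noteq> 1 then x (1, 2 * m) else 0)
        else (if k \<noteq> 1 then x (0, 2 * m) else 0) - (if k \<noteq> 0 then x (1, 2 * m) else 0))" for k l x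
  \<comment> \<open>A leftover index forces \<open>M = 2 * m + 1\<close>. The hypothesis then reads
    \<open>6 * m + 3 \<le> 2 * N\<close>, and parity leaves the two relay antennas
    \<open>3 * m\<close> and \<open>3 * m + 1\<close>.\<close>
  have bM: "b = 2 * m \<and> 3 * m + 1 < N" if "b < M" "\<not> b < 2 * m" for b
    using that MN by (auto simp: m_def) 
  have mN: "3 * m \<le> N" "2 * m \<le> M" using MN by (auto simp: m_def)
  have unit3: "3 * p + l = 3 * q + l' \<longleftrightarrow> p = q \<and> l = l'" if "l < 3" "l' < 3" for p q l l' :: nat
    using that by presburger
  have unit2: "p = a div 2 \<and> a mod 2 = t \<longleftrightarrow> a = 2 * p + t" if "t < 2" for p a t :: nat
    using that by auto
  have F_even: "?F k (l, b) (s, a) = (if l \<noteq> k \<and> (s, a) = (b mod 2, 2 * (b div 2) + pos k l) then 1 else 0)"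
    if "l < 3" "k < 3" "b < 2 * m" "s < 2" "a < M" for k l b s a
  proof -
    let ?i = "3 * (b div 2) + l"
    have "b div 2 < m" using that(3) by presburger
    then have i: "?i < 3 * m" using that(1) by linarith
    have "?F k (l, b) (s, a) = (\<Sum>i<N. (if i = ?i then (if s = b mod 2 then 1 else 0) else 0) * H0 k i a)"
      unfolding ext_chan_def Q_def using that by simp
    also have "\<dots> = (if s = b mod 2 then 1 else 0) * H0 k ?i a"
      using i mN by (intro sum_single_coeff) auto
    also have "H0 k ?i a = (if l \<noteq> k \<and> a = 2 * (b div 2) + pos k l then 1 else 0)"
    proof (cases "a < 2 * m")
      case True
      have o: "oth k (a mod 2) < 3" using that(2) by (auto simp: oth_def)
      have "(?i = 3 * (a div 2) + oth k (a mod 2)) \<longleftrightarrow> (b div 2 = a div 2 \<and> l = oth k (a mod 2))"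
        by (rule unit3[OF that(1) o])
      also have "\<dots> \<longleftrightarrow> (l \<noteq> k \<and> a = 2 * (b div 2) + pos k l)"
      proof -
        have "l = oth k (a mod 2) \<longleftrightarrow> (l \<noteq> k \<and> a mod 2 = pos k l)"
          using that(1,2) by (auto simp: oth_def pos_def split: if_splits)
        moreover have "pos k l < 2" if "l \<noteq> k" using that \<open>l < 3\<close> \<open>k < 3\<close> by (auto simp: pos_def)
        ultimately show ?thesis using unit2[of "pos k l" "b div 2" a] by blast
      qed
      finally show ?thesis using True by (simp add: H0_def)
    next
      case False
      have "2 * (b div 2) + pos k l < 2 * m" if "l \<noteq> k"
      proof -
        have "pos k l < 2" using that \<open>l < 3\<close> \<open>k < 3\<close> by (auto simp: pos_def)
        then show ?thesis using \<open>b < 2 * m\<close> by presburger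
      qed
      then show ?thesis using False i by (auto simp: H0_def)
    qed
    finally show ?thesis by auto
  qed
  have sum_even: "(\<Sum>c\<in>?J. ?F k (l, b) c * x c) = (if l = k then 0 else x (b mod 2, 2 * (b div 2) + pos k l))"
    if "l < 3" "k < 3" "b < 2 * m" for k l b x
  proof (cases "l = k")
    case True
    have "?F k (l, b) c = 0" if "c \<in> ?J" for c
      using F_even[OF \<open>l < 3\<close> \<open>k < 3\<close> \<open>b < 2 * m\<close>, of "fst c" "snd c"] that True by auto
    then have "(\<Sum>c\<in>?J. ?F k (l, b) c * x c) = (\<Sum>c\<in>?J. 0)" by (intro sum.cong refl) simp
    then show ?thesis using True by simp
  next
    case False
    have "pos k l < 2" using that False by (auto simp: pos_def)
    moreover have "b div 2 < m" using that(3) by presburger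
    ultimately have "2 * (b div 2) + pos k l < M" using mN by linarith
    moreover have "(\<Sum>c\<in>?J. ?F k (l, b) c * x c) = (\<Sum>c\<in>?J. (if c = (b mod 2, 2 * (b div 2) + pos k l) then 1 else 0) * x c)"
    proof (intro sum.cong refl)
      fix c assume "c \<in> ?J"
      then show "?F k (l, b) c * x c = (if c = (b mod 2, 2 * (b div 2) + pos k l) then 1 else 0) * x c"
        using F_even[OF that, of "fst c" "snd c"] False by (auto split: if_splits)
    qed
    ultimately show ?thesis
      using False sum_single_coeff[of ?J "(b mod 2, 2 * (b div 2) + pos k l)" 1 x] by simp
  qed
  have F_odd: "?F k (l, 2 * m) (s, a) = (if a = 2 * m then
       (if l = 0 then (if s = 0 \<and> k \<noteq> 0 then 1 else 0)
        else if l = 1 then (if s = 1 \<and> k \<noteq> 1 then 1 else 0)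
        else (if s = 0 \<and> k \<noteq> 1 then 1 else 0) + (if s = 1 \<and> k \<noteq> 0 then - 1 else 0)) else 0)"
    if "l < 3" "k < 3" "2 * m < M" "s < 2" "a < M" for k l s a
  proof -
    have N: "3 * m < N" "3 * m + 1 < N" using bM[OF that(3)] by auto
    have sg: "(\<Sum>i<N. (if i = i0 then c else 0) * H0 k i a) = c * H0 k i0 a" if "i0 < N" for i0 c
      using that by (intro sum_single_coeff) auto
    have h: "H0 k (3 * m) a = (if a = 2 * m \<and> k \<noteq> 1 then 1 else 0)" "H0 k (3 * m + 1) a = (if a = 2 * m \<and> k \<noteq> 0 then 1 else 0)"
    proof -
      have lt: "3 * (a div 2) + oth k (a mod 2) < 3 * m" if "a < 2 * m"
      proof -
        have "oth k (a mod 2) < 3" using \<open>k < 3\<close> by (auto simp: oth_def)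
        moreover have "a div 2 < m" using that by auto
        ultimately show ?thesis by linarith
      qed
      have "a < 2 * m \<or> a = 2 * m" using bM[OF \<open>a < M\<close>] by auto
      then show "H0 k (3 * m) a = (if a = 2 * m \<and> k \<noteq> 1 then 1 else 0)" "H0 k (3 * m + 1) a = (if a = 2 * m \<and> k \<noteq> 0 then 1 else 0)"
        using lt by (auto simp: H0_def)
    qed
    from that(1) consider "l = 0" | "l = 1" | "l = 2" by linarith
    then show ?thesis
    proof cases
      case 1
      then show ?thesis unfolding ext_chan_def Q_def using N by (simp add: sg h h(2)[unfolded Suc_eq_plus1[symmetric]])
    next
      case 2
      then show ?thesis unfolding ext_chan_def Q_def using N by (simp add: sg h h(2)[unfolded Suc_eq_plus1[symmetric]])
    next
      case 3
      then show ?thesis unfolding ext_chan_def Q_def using N by (simp add: sg h h(2)[unfolded Suc_eq_plus1[symmetric]] distrib_right sum.distrib)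
    qed
  qed
  have sum_odd: "(\<Sum>c\<in>?J. ?F k (l, 2 * m) c * x c) =
      odd_value k l x"
    if "l < 3" "k < 3" "2 * m < M" for k l x
  proof -
    have "(\<Sum>c\<in>?J. ?F k (l, 2 * m) c * x c) = (\<Sum>c\<in>{(0, 2 * m), (1, 2 * m)}. ?F k (l, 2 * m) c * x c)"
      by (rule sum.mono_neutral_right) (use F_odd[OF that] that(3) in \<open>auto simp: less_2_cases_iff split: if_splits\<close>)
    also have "\<dots> = ?F k (l, 2 * m) (0, 2 * m) * x (0, 2 * m) + ?F k (l, 2 * m) (1, 2 * m) * x (1, 2 * m)" by simp
    finally show ?thesis using F_odd[OF that, of 0 "2 * m"] F_odd[OF that, of 1 "2 * m"] that by (auto simp: odd_value_def)
  qed
  have "generic_position N ?R fst (\<lambda>k. ?J) Q H0"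
  proof (rule generic_positionI)
    show "card ?J = card {r \<in> ?R. fst r \<noteq> k}" if "k < 3" for k
    proof -
      have "{r \<in> ?R. fst r \<noteq> k} = ({..<3} - {k}) \<times> {..<M}" by auto
      then show ?thesis using that by (simp add: card_cartesian_product)
    qed
    show "x c = 0" if k: "k < 3" and z: "\<And>r. r \<in> ?R \<Longrightarrow> fst r \<noteq> k \<Longrightarrow> (\<Sum>c\<in>?J. ?F k r c * x c) = 0" and c: "c \<in> ?J" for k x c
    proof -
      obtain s a where c': "c = (s, a)" "s < 2" "a < M" using c by auto
      show ?thesis
      proof (cases "a < 2 * m")
        case True
        let ?l = "oth k (a mod 2)" and ?b = "2 * (a div 2) + s"
        have l: "?l < 3" "?l \<noteq> k" using k by (auto simp: oth_def)
        have b: "?b < 2 * m" using True c' by presburger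
        have e: "?b mod 2 = s" "2 * (?b div 2) + pos k ?l = a"
          using c' k by (auto simp: oth_def pos_def)
        show ?thesis using sum_even[OF l(1) k b, of x] z[of "(?l, ?b)"] l b mN e c' by auto
      next
        case False
        then have a: "a = 2 * m" "2 * m < M" using bM c' by auto
        have z': "(\<Sum>c\<in>?J. ?F k (l, 2 * m) c * x c) = 0" if "l < 3" "l \<noteq> k" for l
          using z[of "(l, 2 * m)"] that a by auto
        have so: "odd_value k l x = 0" if "l < 3" "l \<noteq> k" for l
          using z'[OF that] unfolding sum_odd[OF that(1) k a(2)] .
        from k consider "k = 0" | "k = 1" | "k = 2" by linarith
        then have "x (0, 2 * m) = 0 \<and> x (1, 2 * m) = 0"
        proof cases
          case 1 then show ?thesis using so[of 1] so[of 2] by (simp add: odd_value_def)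
        next
          case 2 then show ?thesis using so[of 0] so[of 2] by (simp add: odd_value_def)
        next
          case 3 then show ?thesis using so[of 0] so[of 1] by (simp add: odd_value_def)
        qed
        moreover have "s = 0 \<or> s = 1" using c' by auto
        ultimately show ?thesis using c' a by auto
      qed
    qed
    show "v r = 0" if F: "\<And>k r. k < 3 \<Longrightarrow> r \<in> ?R \<Longrightarrow> (\<Sum>c\<in>?J. ?F k r c * x k c) = v r" and r: "r \<in> ?R" for v x r
    proof -
      obtain l b where r': "r = (l, b)" "l < 3" "b < M" using r by auto
      show ?thesis
      proof (cases "b < 2 * m")
        case True
        then show ?thesis using F[OF r'(2) r] sum_even[OF r'(2) r'(2) True, of "x l"] r' by simp
      next
        case False
        then have b: "b = 2 * m" "2 * m < M" using bM r' by auto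
        have v: "v (l, 2 * m) = odd_value k l (x k)" if "l < 3" "k < 3" for k l
          using F[OF that(2), of "(l, 2 * m)"] that b unfolding sum_odd[OF that b(2)] by simp
        \<comment> \<open>Users 0 and 1 are invisible in rows 0 and 1 respectively. For user 2 these
          rows carry its two symbols, so they vanish and with them its row 2.\<close>
        have "v (0, 2 * m) = 0" "v (1, 2 * m) = 0" using v[of 0 0] v[of 1 1] by (simp_all add: odd_value_def)
        moreover have "v (0, 2 * m) = x 2 (0, 2 * m)" "v (1, 2 * m) = x 2 (1, 2 * m)" "v (2, 2 * m) = x 2 (0, 2 * m) - x 2 (1, 2 * m)"
          using v[of 0 2] v[of 1 2] v[of 2 2] by (simp_all add: odd_value_def)
        moreover consider "l = 0" | "l = 1" | "l = 2" using r'(2) by linarith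
        ultimately show ?thesis unfolding r'(1) b(1) by cases auto
      qed
    qed
  qed auto
  then show thesis by (rule that)
qed

lemma AE_aligned_many_antennas:
  assumes "2 * N \<le> 3 * M"
  obtains \<beta> :: "nat \<Rightarrow> nat" where "\<And>r. \<beta> r < 3"
    "AE v in PiM {..<chan_dim 3 M N} (\<lambda>_. lborel). aligned M N 1 {..<N} \<beta> (chan_H 3 M N v)
       \<and> aligned M N 1 {..<N} \<beta> (\<lambda>k i a. chan_G 3 M N v k a i)"
proof -
  let ?\<beta> = "\<lambda>r::nat. if r < N - M then 0 else if r < 2 * (N - M) then 1 else (2::nat)"
  obtain H0 where H0: "generic_position N {..<N} ?\<beta> (\<lambda>k. {0} \<times> {..<if k = 2 then 2 * (N - M) else N - (N - M)})
      (\<lambda>r s i. if i = r then 1 else 0) H0"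
    by (rule generic_position_many_antennas[OF assms])
  have "AE v in PiM {..<chan_dim 3 M N} (\<lambda>_. lborel). aligned M N 1 {..<N} ?\<beta> (chan_H 3 M N v)
       \<and> aligned M N 1 {..<N} ?\<beta> (\<lambda>k i a. chan_G 3 M N v k a i)"
    by (rule AE_aligned[OF _ _ _ H0]) (use assms in auto)
  then show thesis by (rule that[rotated]) auto
qed

lemma AE_aligned_few_antennas:
  assumes "3 * M \<le> 2 * N"
  shows "AE v in PiM {..<chan_dim 3 M N} (\<lambda>_. lborel). aligned M N 2 ({..<3} \<times> {..<M}) fst (chan_H 3 M N v)
       \<and> aligned M N 2 ({..<3} \<times> {..<M}) fst (\<lambda>k i a. chan_G 3 M N v k a i)"
proof -
  obtain H0 Q where "generic_position N ({..<3} \<times> {..<M}) fst (\<lambda>k. {..<2::nat} \<times> {..<M}) Q H0"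
    using generic_position_few_antennas[OF assms] .
  from AE_aligned[OF _ _ _ this] show ?thesis by auto
qed

section \<open>Packings of the integer grid\<close>

text \<open>For integers \<open>d \<le> d\<^sup>2\<close>, so each side of \<open>c\<close> is
  dominated by a geometric series of ratio at most \<open>1/2\<close>. The bound is uniform in
  \<open>q\<close>, which keeps the packing loss free of SNR.\<close>

lemma sum_exp_sq_le:
  fixes c q :: nat
  shows "(\<Sum>k<q. exp (- (real c - real k)\<^sup>2)) \<le> 4"
proof -
  have e2: "exp (-1::real) \<le> 1/2"
    using exp_ge_add_one_self[of 1] by (simp add: exp_minus field_simps)
  have geo: "(\<Sum>d<n. exp (- real d)) \<le> 2" for n
  proof -
    have "(\<Sum>d<n. exp (- real d)) = (\<Sum>d<n. exp (-1) ^ d)"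
      by (simp add: exp_of_nat_mult[symmetric])
    also have "\<dots> \<le> (\<Sum>d<n. (1/2) ^ d)" by (intro sum_mono power_mono e2) simp
    also have "\<dots> \<le> 2" by (simp add: sum_gp_strict)
    finally show ?thesis .
  qed
  have term_le: "exp (- (real c - real k)\<^sup>2) \<le> exp (- real (if k \<le> c then c - k else k - c))" for k
  proof -
    define d where "d = (if k \<le> c then c - k else k - c)"
    have "(real c - real k)\<^sup>2 = (real d)\<^sup>2"
      by (auto simp: d_def of_nat_diff power2_commute)
    moreover have "real d \<le> (real d)\<^sup>2"
      by (metis of_nat_mono of_nat_power power2_nat_le_imp_le self_le_power le_zero_eq le_square power2_eq_square)
    ultimately show ?thesis unfolding d_def by simp
  qed
  have "(\<Sum>k<q. exp (- (real c - real k)\<^sup>2)) \<le> (\<Sum>k<q. exp (- real (if k \<le> c then c - k else k - c)))"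
    by (intro sum_mono term_le)
  also have "\<dots> = (\<Sum>k | k < q \<and> k \<le> c. exp (- real (c - k))) + (\<Sum>k | k < q \<and> \<not> k \<le> c. exp (- real (k - c)))"
    by (subst sum.inter_filter[symmetric] | subst sum.If_cases | simp add: if_distrib Int_def)+
  also have "(\<Sum>k | k < q \<and> k \<le> c. exp (- real (c - k))) = (\<Sum>d\<in>(\<lambda>k. c - k) ` {k. k < q \<and> k \<le> c}. exp (- real d))"
    by (subst sum.reindex) (auto simp: inj_on_def)
  also have "\<dots> \<le> (\<Sum>d<Suc c. exp (- real d))" by (rule sum_mono2) auto
  also have "\<dots> \<le> 2" by (rule geo)
  also have "(\<Sum>k | k < q \<and> \<not> k \<le> c. exp (- real (k - c))) = (\<Sum>d\<in>(\<lambda>k. k - c) ` {k. k < q \<and> \<not> k \<le> c}. exp (- real d))"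
    by (subst sum.reindex) (auto simp: inj_on_def)
  also have "\<dots> \<le> (\<Sum>d<q. exp (- real d))" by (rule sum_mono2) auto
  also have "\<dots> \<le> 2" by (rule geo)
  finally show ?thesis by simp
qed

text \<open>A maximal packing covers the whole grid by balls of squared radius \<open>D\<close>, and such a ball has at
  most \<open>exp D * 4 ^ n\<close> grid points by Markov's inequality for the weight \<open>exp (D - r\<^sup>2)\<close>.\<close>
lemma gilbert_varshamov_grid:
  fixes I :: "'i set" and q :: nat and D :: real
  assumes I: "finite I" and D: "0 \<le> D"
  shows "\<exists>C. finite C \<and> C \<subseteq> I \<rightarrow>\<^sub>E {..<q} \<and>
    (\<forall>x\<in>C. \<forall>y\<in>C. x \<noteq> y \<longrightarrow> D < (\<Sum>i\<in>I. (real (x i) - real (y i))\<^sup>2)) \<and>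
    real q ^ card I \<le> real (card C) * (exp D * 4 ^ card I)"
proof -
  let ?U = "I \<rightarrow>\<^sub>E {..<q}"
  let ?d = "\<lambda>x y. (\<Sum>i\<in>I. (real (x i) - real (y i))\<^sup>2)"
  have finU: "finite ?U" using I by (intro finite_PiE) auto
  define \<P> where "\<P> = {C. C \<subseteq> ?U \<and> (\<forall>x\<in>C. \<forall>y\<in>C. x \<noteq> y \<longrightarrow> D < ?d x y)}"
  have finP: "finite \<P>" unfolding \<P>_def using finU by (auto intro: finite_subset[of _ "Pow ?U"])
  have ne: "{} \<in> \<P>" by (simp add: \<P>_def)
  obtain C where C: "C \<in> \<P>" and mx: "\<And>B. B \<in> \<P> \<Longrightarrow> C \<subseteq> B \<Longrightarrow> C = B"
    using finite_has_maximal[OF finP] ne by (metis empty_iff)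
  have sym: "?d x y = ?d y x" for x y by (intro sum.cong refl) (simp add: power2_commute)
  have cover: "\<exists>x\<in>C. ?d x y \<le> D" if y: "y \<in> ?U" for y
  proof (rule ccontr)
    assume "\<not> (\<exists>x\<in>C. ?d x y \<le> D)"
    then have far: "\<And>x. x \<in> C \<Longrightarrow> D < ?d x y" by force
    have "insert y C \<in> \<P>" unfolding \<P>_def
    proof (intro CollectI conjI ballI impI)
      show "insert y C \<subseteq> ?U" using C y by (auto simp: \<P>_def)
      fix u v assume uv: "u \<in> insert y C" "v \<in> insert y C" "u \<noteq> v"
      show "D < ?d u v"
      proof (cases "u = y")
        case True then show ?thesis using uv far[of v] sym[of u v] by auto
      next
        case False
        then have "u \<in> C" using uv by auto
        then show ?thesis using uv far[of u] C by (cases "v = y") (auto simp: \<P>_def)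
      qed
    qed
    then have "y \<in> C" using mx[of "insert y C"] by auto
    then have "D < ?d y y" using far by blast
    then show False using D by simp
  qed
  have finC: "finite C" using C finU finite_subset unfolding \<P>_def by blast
  have "real q ^ card I = (\<Sum>y\<in>?U. 1)" using I by (simp add: card_PiE)
  also have "\<dots> \<le> (\<Sum>y\<in>?U. \<Sum>x\<in>C. exp (D - ?d x y))"
  proof (rule sum_mono)
    fix y assume "y \<in> ?U"
    then obtain x where x: "x \<in> C" "?d x y \<le> D" using cover by blast
    have "1 \<le> exp (D - ?d x y)" using x by simp
    also have "\<dots> \<le> (\<Sum>x\<in>C. exp (D - ?d x y))"
      by (rule member_le_sum[OF x(1), of "\<lambda>x. exp (D - ?d x y)"]) (use finC in auto)
    finally show "1 \<le> (\<Sum>x\<in>C. exp (D - ?d x y))" .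
  qed
  also have "\<dots> = (\<Sum>x\<in>C. \<Sum>y\<in>?U. exp (D - ?d x y))" by (rule sum.swap)
  also have "\<dots> \<le> (\<Sum>x\<in>C. exp D * 4 ^ card I)"
  proof (rule sum_mono)
    fix x
    have "(\<Sum>y\<in>?U. exp (D - ?d x y)) = exp D * (\<Sum>y\<in>?U. \<Prod>i\<in>I. exp (- (real (x i) - real (y i))\<^sup>2))"
      by (simp add: exp_diff sum_distrib_left exp_sum[OF I] sum_negf[symmetric] exp_minus prod_inversef[symmetric] divide_inverse o_def)
    also have "(\<Sum>y\<in>?U. \<Prod>i\<in>I. exp (- (real (x i) - real (y i))\<^sup>2))
       = (\<Prod>i\<in>I. \<Sum>k<q. exp (- (real (x i) - real k)\<^sup>2))"
      by (rule prod_sum_PiE[symmetric]) (use I in auto)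
    also have "\<dots> \<le> (\<Prod>i\<in>I. 4)"
      by (intro prod_mono conjI sum_nonneg sum_exp_sq_le) auto
    finally show "(\<Sum>y\<in>?U. exp (D - ?d x y)) \<le> exp D * 4 ^ card I" by simp
  qed
  also have "\<dots> = real (card C) * (exp D * 4 ^ card I)" by simp
  finally have "real q ^ card I \<le> real (card C) * (exp D * 4 ^ card I)" .
  moreover have "C \<subseteq> ?U" "\<forall>x\<in>C. \<forall>y\<in>C. x \<noteq> y \<longrightarrow> D < ?d x y" using C by (simp_all add: \<P>_def)
  ultimately show ?thesis using finC by (intro exI[of _ C] conjI)
qed

section \<open>Amplify-and-forward codes\<close>

lemma sum_blocks:
  fixes f :: "nat \<Rightarrow> real"
  shows "(\<Sum>t<B * S. f t) = (\<Sum>s<S. \<Sum>b<B. f (b * S + s))"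
proof -
  have "(\<Sum>t<B * S. f t) = (\<Sum>b<B. \<Sum>s<S. f (b * S + s))"
  proof (induction B)
    case (Suc B)
    have "(\<Sum>t<Suc B * S. f t) = (\<Sum>t<B * S. f t) + (\<Sum>s<S. f (B * S + s))"
      using sum.nat_group[of f S "Suc B"] sum.nat_group[of f S B]
      by (simp add: sum.shift_bounds_nat_ivl[of f 0 "B * S" S, simplified] atLeast0LessThan add.commute lessThan_Suc)
    then show ?case using Suc by simp
  qed simp
  also have "\<dots> = (\<Sum>s<S. \<Sum>b<B. f (b * S + s))" by (rule sum.swap)
  finally show ?thesis .
qed

lemma sum_pairs_eq: "(\<Sum>q\<in>A \<times> B. f (fst q) (snd q)) = (\<Sum>a\<in>A. \<Sum>b\<in>B. f a b)"
  by (simp add: sum.cartesian_product case_prod_beta)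

lemma block_energy_le:
  fixes Y :: cmat
  assumes "B * S \<le> T"
  shows "(\<Sum>q\<in>{..<n} \<times> {..<S}. \<Sum>b<B. (cmod (Y (fst q) (b * S + snd q)))\<^sup>2) \<le> frob n T Y"
proof -
  have "(\<Sum>q\<in>{..<n} \<times> {..<S}. \<Sum>b<B. (cmod (Y (fst q) (b * S + snd q)))\<^sup>2)
      = (\<Sum>i<n. \<Sum>t<B * S. (cmod (Y i t))\<^sup>2)"
    unfolding sum_blocks by (rule sum_pairs_eq[of "\<lambda>i s. \<Sum>b<B. (cmod (Y i (b * S + s)))\<^sup>2"])
  also have "\<dots> \<le> frob n T Y"
    unfolding frob_def using assms by (intro sum_mono sum_mono2) auto
  finally show ?thesis .
qed

lemma frob_block_eq:
  assumes "B * S \<le> T" "0 < S"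
  shows "frob n T (\<lambda>i t. if t < B * S then f i (t mod S) (t div S) else 0)
    = (\<Sum>q\<in>{..<n} \<times> {..<S}. \<Sum>b<B. (cmod (f (fst q) (snd q) b))\<^sup>2)"
proof -
  have "(\<Sum>t<T. (cmod (if t < B * S then f i (t mod S) (t div S) else 0))\<^sup>2) = (\<Sum>s<S. \<Sum>b<B. (cmod (f i s b))\<^sup>2)" for i
  proof -
    have "(\<Sum>t<T. (cmod (if t < B * S then f i (t mod S) (t div S) else 0))\<^sup>2) = (\<Sum>t<B * S. (cmod (f i (t mod S) (t div S)))\<^sup>2)"
      by (rule sum.mono_neutral_cong_right) (use assms in auto)
    also have "\<dots> = (\<Sum>s<S. \<Sum>b<B. (cmod (f i s b))\<^sup>2)"
      unfolding sum_blocks using assms(2) by (intro sum.cong refl) auto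
    finally show ?thesis .
  qed
  then show ?thesis unfolding frob_def by (simp only: sum_pairs_eq[of "\<lambda>i s. \<Sum>b<B. (cmod (f i s b))\<^sup>2"])
qed

lemma sum_mult_scaled: "(\<Sum>i\<in>I. f i * (c * h i)) = c * (\<Sum>i\<in>I. f i * (h i :: complex))"
  by (simp add: sum_distrib_left mult.left_commute)

lemma cmod_add_sq_le: "(cmod (a + b))\<^sup>2 \<le> 2 * (cmod a)\<^sup>2 + 2 * (cmod b)\<^sup>2"
proof -
  have "(cmod (a + b))\<^sup>2 \<le> (cmod a + cmod b)\<^sup>2" by (intro power_mono norm_triangle_ineq) auto
  also have "\<dots> \<le> 2 * (cmod a)\<^sup>2 + 2 * (cmod b)\<^sup>2"
    using zero_le_power2[of "cmod a - cmod b"] by (simp add: power2_eq_square algebra_simps)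
  finally show ?thesis .
qed

lemma err_prob_le:
  assumes s2: "0 < s2" and le: "\<And>w. w \<in> msg_set K (code_sz c) \<Longrightarrow>
      measure (noise_meas K M N T s2) (err_event K M N T s2 H G c w p) \<le> \<delta>" and \<delta>: "0 \<le> \<delta>"
  shows "err_prob K M N T s2 H G c p \<le> \<delta>"
proof -
  let ?W = "msg_set K (code_sz c)"
  have "(\<Sum>w\<in>?W. measure (noise_meas K M N T s2) (err_event K M N T s2 H G c w p)) \<le> real (card ?W) * \<delta>"
    using sum_bounded_above[OF le, of ?W] by simp
  then show ?thesis unfolding err_prob_def using \<delta> by (cases "card ?W = 0") (auto simp: divide_le_eq mult.commute)
qed

lemma achievable_ratesI:
  assumes R: "\<And>p. p \<in> pairs K \<Longrightarrow> 0 \<le> R p" and P: "0 \<le> P" and \<delta>: "\<delta> \<longlonglongrightarrow> 0"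
    and ex: "eventually (\<lambda>T. \<exists>c. valid_code K M N T P s2 H G c \<and>
      (\<forall>p\<in>pairs K. 2 powr (real T * R p) \<le> real (code_sz c p) \<and> err_prob K M N T s2 H G c p \<le> \<delta> T)) sequentially"
  shows "achievable_rates K M N P s2 H G R"
proof -
  obtain T0 where T0: "\<And>T. T0 \<le> T \<Longrightarrow> \<exists>c. valid_code K M N T P s2 H G c \<and>
      (\<forall>p\<in>pairs K. 2 powr (real T * R p) \<le> real (code_sz c p) \<and> err_prob K M N T s2 H G c p \<le> \<delta> T)"
    using ex unfolding eventually_sequentially by blast
  \<comment> \<open>A silent code for the finitely many short block lengths. It meets the size
    requirement by fiat, and its error events are empty or the whole space, hence measurable; its
    errors do not affect the limit.\<close>
  define c0 :: "nat \<Rightarrow> mrc_code" where "c0 T = \<lparr>code_sz = \<lambda>p. nat \<lceil>2 powr (real T * R p)\<rceil>, code_enc = \<lambda>_ _ _ _. 0,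
     code_relay = \<lambda>_ _ _. 0, code_dec = \<lambda>_ _ _ _. 0\<rparr>" for T
  have v0: "valid_code K M N T P s2 H G (c0 T)" for T
  proof -
    have "err_event K M N T s2 H G (c0 T) w p \<in> sets (noise_meas K M N T s2)" for w p
      by (cases "w p = 0") (auto simp: err_event_def c0_def)
    then show ?thesis using P by (auto simp: valid_code_def c0_def frob_def)
  qed
  have s0: "2 powr (real T * R p) \<le> real (code_sz (c0 T) p)" for T p
    by (simp add: c0_def)
  have "\<exists>c. valid_code K M N T P s2 H G c \<and>
      (\<forall>p\<in>pairs K. 2 powr (real T * R p) \<le> real (code_sz c p) \<and> (T0 \<le> T \<longrightarrow> err_prob K M N T s2 H G c p \<le> \<delta> T))" for T
  proof (cases "T0 \<le> T")
    case True then show ?thesis using T0 by blast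
  next
    case False then show ?thesis using v0 s0 by blast
  qed
  then obtain c where c: "\<And>T. valid_code K M N T P s2 H G (c T)"
    "\<And>T p. p \<in> pairs K \<Longrightarrow> 2 powr (real T * R p) \<le> real (code_sz (c T) p)"
    "\<And>T p. p \<in> pairs K \<Longrightarrow> T0 \<le> T \<Longrightarrow> err_prob K M N T s2 H G (c T) p \<le> \<delta> T" by metis
  have "(\<lambda>T. err_prob K M N T s2 H G (c T) p) \<longlonglongrightarrow> 0" if p: "p \<in> pairs K" for p
  proof (rule tendsto_sandwich[OF _ _ tendsto_const \<delta>])
    show "eventually (\<lambda>T. 0 \<le> err_prob K M N T s2 H G (c T) p) sequentially"
      by (intro always_eventually allI) (auto simp: err_prob_def intro!: divide_nonneg_nonneg sum_nonneg)
    show "eventually (\<lambda>T. err_prob K M N T s2 H G (c T) p \<le> \<delta> T) sequentially"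
      using c(3)[OF p] unfolding eventually_sequentially by blast
  qed
  then show ?thesis unfolding achievable_rates_def using R c by blast
qed

text \<open>Degrees of freedom ask for achievable rates at every positive SNR; this is the fallback
  when the SNR is too small for a nontrivial grid.\<close>

lemma achievable_rates_zero:
  assumes P: "0 \<le> P" and s2: "0 < s2"
  shows "achievable_rates K M N P s2 H G (\<lambda>_. 0)"
proof (rule achievable_ratesI[OF _ P tendsto_const])
  define c :: mrc_code where "c = \<lparr>code_sz = \<lambda>p. 1, code_enc = \<lambda>_ _ _ _. 0, code_relay = \<lambda>_ _ _. 0, code_dec = \<lambda>_ _ _ _. 0\<rparr>"
  have e: "err_event K M N T s2 H G c w p = {}" if "w \<in> msg_set K (code_sz c)" for T w p
  proof -
    have "w p = 0" using that by (cases "p \<in> pairs K") (simp_all add: msg_set_def c_def del: split_paired_All)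
    then show ?thesis by (simp add: err_event_def c_def)
  qed
  have "valid_code K M N T P s2 H G c" for T
    using P by (auto simp: valid_code_def e) (auto simp: c_def frob_def)
  moreover have "err_prob K M N T s2 H G c p \<le> 0" for T p
    by (rule err_prob_le[OF s2]) (auto simp: e)
  ultimately show "eventually (\<lambda>T. \<exists>c. valid_code K M N T P s2 H G c \<and>
      (\<forall>p\<in>pairs K. 2 powr (real T * 0) \<le> real (code_sz c p) \<and> err_prob K M N T s2 H G c p \<le> 0)) sequentially"
    by (intro always_eventually allI exI[of _ c]) (auto simp: c_def)
qed auto

section \<open>The linear relay scheme\<close>

text \<open>Arguments are the ordered pair, the message, and a real coordinate of the codeword:
  stream, block, and a flag that is \<open>False\<close> for the real and \<open>True\<close> for
  the imaginary part.\<close>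

type_synonym 'j codebook = "nat \<times> nat \<Rightarrow> nat \<Rightarrow> 'j \<times> nat \<times> bool \<Rightarrow> nat"

text \<open>\<open>x\<close> and \<open>E\<close> are transmit beams of users and relay;
  \<open>A\<close> and \<open>u\<close> are the receive functionals of relay and users.\<close>

locale relay_scheme =
  fixes M N S :: nat and R :: "'j set" and \<beta> :: "'j \<Rightarrow> nat" and H G :: "nat \<Rightarrow> cmat"
    and A E :: "'j \<Rightarrow> nat \<Rightarrow> nat \<Rightarrow> complex" and x u :: "nat \<Rightarrow> 'j \<Rightarrow> nat \<Rightarrow> nat \<Rightarrow> complex" and s2 :: real
  assumes finR: "finite R" and \<beta>: "\<And>j. j \<in> R \<Longrightarrow> \<beta> j < 3" and S: "0 < S" and s2: "0 < s2"
    and up: "\<And>k j j'. k < 3 \<Longrightarrow> j \<in> R \<Longrightarrow> \<beta> j \<noteq> k \<Longrightarrow> j' \<in> R \<Longrightarrow>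
      (\<Sum>i<N. \<Sum>s<S. A j' i s * (\<Sum>a<M. H k i a * x k j a s)) = (if j' = j then 1 else 0)"
    and down: "\<And>k j j'. k < 3 \<Longrightarrow> j \<in> R \<Longrightarrow> \<beta> j \<noteq> k \<Longrightarrow> j' \<in> R \<Longrightarrow>
      (\<Sum>i<N. \<Sum>s<S. E j' i s * (\<Sum>a<M. G k a i * u k j a s)) = (if j' = j then 1 else 0)"
begin

text \<open>Zero forcing removes every index but \<open>j'\<close>; alignment makes both symbols of
  \<open>j'\<close> arrive with coefficient one, so the relay obtains their sum without separating
  them.\<close>

lemma uplink_collapse:
  assumes j': "j' \<in> R"
  shows "(\<Sum>i<N. \<Sum>s<S. A j' i s * (\<Sum>k<3. \<Sum>a<M. H k i a * (\<Sum>j\<in>{j\<in>R. \<beta> j \<noteq> k}. x k j a s * \<sigma> k j)))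
       = (\<Sum>k\<in>{..<3} - {\<beta> j'}. \<sigma> k j')"
proof -
  let ?t = "\<lambda>k j i s. A j' i s * (\<Sum>a<M. H k i a * x k j a s) * \<sigma> k j"
  let ?Rk = "\<lambda>k. {j\<in>R. \<beta> j \<noteq> k}"
  have "(\<Sum>i<N. \<Sum>s<S. A j' i s * (\<Sum>k<3. \<Sum>a<M. H k i a * (\<Sum>j\<in>?Rk k. x k j a s * \<sigma> k j)))
     = (\<Sum>i<N. \<Sum>s<S. \<Sum>k<3. \<Sum>j\<in>?Rk k. ?t k j i s)"
  proof (rule sum.cong[OF refl], rule sum.cong[OF refl])
    fix i s
    have "(\<Sum>a<M. H k i a * (\<Sum>j\<in>?Rk k. x k j a s * \<sigma> k j)) = (\<Sum>j\<in>?Rk k. (\<Sum>a<M. H k i a * x k j a s) * \<sigma> k j)" for k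
      unfolding sum_distrib_left sum_distrib_right by (subst sum.swap) (simp add: mult.assoc)
    moreover have "A j' i s * (\<Sum>k<3. \<Sum>j\<in>?Rk k. g k j * \<sigma> k j) = (\<Sum>k<3. \<Sum>j\<in>?Rk k. A j' i s * g k j * \<sigma> k j)" for g
      by (simp add: sum_distrib_left mult.assoc)
    ultimately show "A j' i s * (\<Sum>k<3. \<Sum>a<M. H k i a * (\<Sum>j\<in>?Rk k. x k j a s * \<sigma> k j))
       = (\<Sum>k<3. \<Sum>j\<in>?Rk k. ?t k j i s)"
      by (simp only:)
  qed
  also have "\<dots> = (\<Sum>i<N. \<Sum>k<3. \<Sum>s<S. \<Sum>j\<in>?Rk k. ?t k j i s)"
    by (rule sum.cong[OF refl], rule sum.swap)
  also have "\<dots> = (\<Sum>k<3. \<Sum>i<N. \<Sum>s<S. \<Sum>j\<in>?Rk k. ?t k j i s)"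
    by (rule sum.swap)
  also have "\<dots> = (\<Sum>k<3. \<Sum>i<N. \<Sum>j\<in>?Rk k. \<Sum>s<S. ?t k j i s)"
    by (rule sum.cong[OF refl], rule sum.cong[OF refl], rule sum.swap)
  also have "\<dots> = (\<Sum>k<3. \<Sum>j\<in>?Rk k. \<Sum>i<N. \<Sum>s<S. ?t k j i s)"
    by (rule sum.cong[OF refl], rule sum.swap)
  also have "\<dots> = (\<Sum>k<3. \<Sum>j\<in>?Rk k. (if j' = j then 1 else 0) * \<sigma> k j)"
  proof (rule sum.cong[OF refl], rule sum.cong[OF refl])
    fix k j assume "k \<in> {..<3::nat}" "j \<in> ?Rk k"
    then have "(\<Sum>i<N. \<Sum>s<S. A j' i s * (\<Sum>a<M. H k i a * x k j a s)) = (if j' = j then 1 else 0)"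
      using up j' by simp
    then show "(\<Sum>i<N. \<Sum>s<S. ?t k j i s) = (if j' = j then 1 else 0) * \<sigma> k j"
      by (simp flip: sum_distrib_right)
  qed
  also have "\<dots> = (\<Sum>k<3. if k \<noteq> \<beta> j' then \<sigma> k j' else 0)"
  proof (rule sum.cong[OF refl])
    fix k
    have "(\<Sum>j\<in>?Rk k. (if j' = j then 1 else 0) * \<sigma> k j) = (\<Sum>j\<in>?Rk k. if j' = j then \<sigma> k j else 0)"
      by (intro sum.cong) auto
    then show "(\<Sum>j\<in>?Rk k. (if j' = j then 1 else 0) * \<sigma> k j) = (if k \<noteq> \<beta> j' then \<sigma> k j' else 0)"
      using j' finR by auto
  qed
  also have "\<dots> = (\<Sum>k\<in>{k\<in>{..<3}. k \<noteq> \<beta> j'}. \<sigma> k j')" by (rule sum.inter_filter[symmetric]) simp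
  also have "{k\<in>{..<3}. k \<noteq> \<beta> j'} = {..<3} - {\<beta> j'}" by auto
  finally show ?thesis .
qed

lemma downlink_collapse:
  assumes l: "l < 3" and j: "j \<in> R" "\<beta> j \<noteq> l"
  shows "(\<Sum>a<M. \<Sum>s<S. u l j a s * (\<Sum>i<N. G l a i * (\<Sum>j'\<in>R. E j' i s * \<rho> j'))) = \<rho> j"
proof -
  let ?t = "\<lambda>j' i s a. E j' i s * (G l a i * u l j a s) * \<rho> j'"
  have "(\<Sum>a<M. \<Sum>s<S. u l j a s * (\<Sum>i<N. G l a i * (\<Sum>j'\<in>R. E j' i s * \<rho> j')))
     = (\<Sum>a<M. \<Sum>s<S. \<Sum>i<N. \<Sum>j'\<in>R. ?t j' i s a)"
    unfolding sum_distrib_left by (simp only: mult_ac)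
  also have "\<dots> = (\<Sum>a<M. \<Sum>s<S. \<Sum>j'\<in>R. \<Sum>i<N. ?t j' i s a)"
    by (rule sum.cong[OF refl], rule sum.cong[OF refl], rule sum.swap)
  also have "\<dots> = (\<Sum>a<M. \<Sum>j'\<in>R. \<Sum>s<S. \<Sum>i<N. ?t j' i s a)"
    by (rule sum.cong[OF refl], rule sum.swap)
  also have "\<dots> = (\<Sum>j'\<in>R. \<Sum>a<M. \<Sum>s<S. \<Sum>i<N. ?t j' i s a)"
    by (rule sum.swap)
  also have "\<dots> = (\<Sum>j'\<in>R. \<Sum>a<M. \<Sum>i<N. \<Sum>s<S. ?t j' i s a)"
    by (rule sum.cong[OF refl], rule sum.cong[OF refl], rule sum.swap)
  also have "\<dots> = (\<Sum>j'\<in>R. \<Sum>i<N. \<Sum>a<M. \<Sum>s<S. ?t j' i s a)"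
    by (rule sum.cong[OF refl], rule sum.swap)
  also have "\<dots> = (\<Sum>j'\<in>R. \<Sum>i<N. \<Sum>s<S. \<Sum>a<M. ?t j' i s a)"
    by (rule sum.cong[OF refl], rule sum.cong[OF refl], rule sum.swap)
  also have "\<dots> = (\<Sum>j'\<in>R. (if j' = j then 1 else 0) * \<rho> j')"
  proof (rule sum.cong[OF refl])
    fix j' assume "j' \<in> R"
    then have "(\<Sum>i<N. \<Sum>s<S. E j' i s * (\<Sum>a<M. G l a i * u l j a s)) = (if j' = j then 1 else 0)"
      using down l j by simp
    then show "(\<Sum>i<N. \<Sum>s<S. \<Sum>a<M. ?t j' i s a) = (if j' = j then 1 else 0) * \<rho> j'"
      by (simp flip: sum_distrib_right sum_distrib_left)
  qed
  also have "\<dots> = (\<Sum>j'\<in>R. if j' = j then \<rho> j' else 0)" by (intro sum.cong) auto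
  also have "\<dots> = \<rho> j" using j finR by simp
  finally show ?thesis .
qed

definition streams :: "nat \<times> nat \<Rightarrow> 'j set" where
  "streams p = {j\<in>R. \<beta> j \<noteq> fst p \<and> \<beta> j \<noteq> snd p}"

text \<open>The three users \<open>0\<close>, \<open>1\<close>, \<open>2\<close> add up to
  \<open>3\<close>, so subtracting a user and the excluded one leaves the partner.\<close>

definition peer :: "nat \<Rightarrow> 'j \<Rightarrow> nat" where "peer k j = 3 - k - \<beta> j"

lemma peer_eq:
  assumes "(k, l) \<in> pairs 3" "j \<in> streams (k, l)"
  shows "peer k j = l" "peer l j = k" "{..<3} - {\<beta> j} = {k, l}"
proof -
  have *: "k < 3" "l < 3" "k \<noteq> l" "\<beta> j < 3" "\<beta> j \<noteq> k" "\<beta> j \<noteq> l"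
    using assms \<beta> by (auto simp: pairs_def streams_def)
  then show "peer k j = l" "peer l j = k" unfolding peer_def by arith+
  show "{..<3} - {\<beta> j} = {k, l}" using * by auto
qed

text \<open>Scaling by \<open>sqrt s2\<close> fixes the grid spacing in units of the noise; transmit
  power is governed by the side of the grid alone.\<close>

definition symb :: "'j codebook \<Rightarrow> nat \<times> nat \<Rightarrow> nat \<Rightarrow> 'j \<Rightarrow> nat \<Rightarrow> complex" where
  "symb cb p m j b = of_real (sqrt s2) * Complex (real (cb p m (j, b, False))) (real (cb p m (j, b, True)))"

definition relay_stream :: "cmat \<Rightarrow> 'j \<Rightarrow> nat \<Rightarrow> complex" where
  "relay_stream Y j b = (\<Sum>i<N. \<Sum>s<S. A j i s * Y i (b * S + s))"

definition user_stream :: "nat \<Rightarrow> cmat \<Rightarrow> 'j \<Rightarrow> nat \<Rightarrow> complex" where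
  "user_stream l Y j b = (\<Sum>a<M. \<Sum>s<S. u l j a s * Y a (b * S + s))"

definition relay_out :: "nat \<Rightarrow> real \<Rightarrow> cmat \<Rightarrow> cmat" where
  "relay_out T \<alpha> Y = (\<lambda>i t. if t < T div S * S then of_real \<alpha> * (\<Sum>j\<in>R. E j i (t mod S) * relay_stream Y j (t div S)) else 0)"

text \<open>Squared distance of the candidate \<open>m\<close> from the observation once the relay
  gain is undone and the symbols sent by user \<open>l\<close> itself are subtracted.\<close>

definition residual ::
  "nat \<Rightarrow> real \<Rightarrow> 'j codebook \<Rightarrow> nat \<Rightarrow> cmat \<Rightarrow> msgs \<Rightarrow> nat \<Rightarrow> nat \<Rightarrow> real" where
  "residual T \<alpha> cb l Y w k m = (\<Sum>j\<in>streams (k, l). \<Sum>b<T div S.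
     (cmod (user_stream l Y j b / of_real \<alpha> - symb cb (l, k) (w (l, k)) j b - symb cb (k, l) m j b))\<^sup>2)"

text \<open>The relay output is clipped to zero when it is too large, since the power constraint of
  the relay has to hold for every received block.\<close>
definition af_code ::
  "nat \<Rightarrow> real \<Rightarrow> real \<Rightarrow> real \<Rightarrow> (nat \<times> nat \<Rightarrow> nat) \<Rightarrow> 'j codebook \<Rightarrow> mrc_code" where
  "af_code T P \<alpha> thr sz cb = \<lparr>code_sz = sz,
     code_enc = \<lambda>k w a t. if t < T div S * S then
        (\<Sum>j\<in>{j\<in>R. \<beta> j \<noteq> k}. x k j a (t mod S) * symb cb (k, peer k j) (w (k, peer k j)) j (t div S)) else 0,
     code_relay = \<lambda>Y. if frob N T (relay_out T \<alpha> Y) \<le> real T * P then relay_out T \<alpha> Y else (\<lambda>_ _. 0),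
     code_dec = \<lambda>l Y w k. LEAST m. m < sz (k, l) \<and> residual T \<alpha> cb l Y w k m \<le> thr\<rparr>"

text \<open>Here and below: Frobenius energies of the fixed linear maps. They depend on the channel
  but neither on block length nor on SNR.\<close>

definition cA :: real where "cA = (\<Sum>j\<in>R. \<Sum>q\<in>{..<N} \<times> {..<S}. (cmod (A j (fst q) (snd q)))\<^sup>2)"
definition cE :: real where "cE = (\<Sum>q\<in>{..<N} \<times> {..<S}. \<Sum>j\<in>R. (cmod (E j (fst q) (snd q)))\<^sup>2)"
definition cx :: real where "cx = (\<Sum>k<3. \<Sum>q\<in>{..<M} \<times> {..<S}. \<Sum>j\<in>R. (cmod (x k j (fst q) (snd q)))\<^sup>2)"
definition cu :: real where "cu = (\<Sum>l<3. \<Sum>j\<in>R. \<Sum>q\<in>{..<M} \<times> {..<S}. (cmod (u l j (fst q) (snd q)))\<^sup>2)"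

lemma consts_nonneg: "0 \<le> cA" "0 \<le> cE" "0 \<le> cx" "0 \<le> cu"
  by (auto simp: cA_def cE_def cx_def cu_def intro!: sum_nonneg)

lemma stream_energy:
  fixes V :: "'j \<Rightarrow> nat \<Rightarrow> nat \<Rightarrow> complex" and Y :: cmat
  assumes "B * S \<le> T"
  shows "(\<Sum>j\<in>R. \<Sum>b<B. (cmod (\<Sum>i<n. \<Sum>s<S. V j i s * Y i (b * S + s)))\<^sup>2)
    \<le> (\<Sum>j\<in>R. \<Sum>q\<in>{..<n} \<times> {..<S}. (cmod (V j (fst q) (snd q)))\<^sup>2) * frob n T Y"
proof -
  let ?c = "\<Sum>j\<in>R. \<Sum>q\<in>{..<n} \<times> {..<S}. (cmod (V j (fst q) (snd q)))\<^sup>2"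
  have "(\<Sum>j\<in>R. \<Sum>b<B. (cmod (\<Sum>i<n. \<Sum>s<S. V j i s * Y i (b * S + s)))\<^sup>2)
     = (\<Sum>j\<in>R. \<Sum>b<B. (cmod (\<Sum>q\<in>{..<n} \<times> {..<S}. V j (fst q) (snd q) * Y (fst q) (b * S + snd q)))\<^sup>2)"
    by (simp add: sum.cartesian_product case_prod_beta)
  also have "\<dots> \<le> ?c * (\<Sum>q\<in>{..<n} \<times> {..<S}. \<Sum>b<B. (cmod (Y (fst q) (b * S + snd q)))\<^sup>2)"
    by (rule energy_product)
  also have "\<dots> \<le> ?c * frob n T Y"
    by (intro mult_left_mono block_energy_le assms sum_nonneg) auto
  finally show ?thesis .
qed

lemma relay_stream_energy:
  "B * S \<le> T \<Longrightarrow> (\<Sum>j\<in>R. \<Sum>b<B. (cmod (relay_stream Y j b))\<^sup>2) \<le> cA * frob N T Y"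
  unfolding relay_stream_def cA_def by (rule stream_energy)

lemma user_stream_energy:
  assumes "B * S \<le> T" "l < 3"
  shows "(\<Sum>j\<in>R. \<Sum>b<B. (cmod (user_stream l Y j b))\<^sup>2) \<le> cu * frob M T Y"
proof -
  let ?c = "\<lambda>l. \<Sum>j\<in>R. \<Sum>q\<in>{..<M} \<times> {..<S}. (cmod (u l j (fst q) (snd q)))\<^sup>2"
  have "?c l \<le> cu" unfolding cu_def
    by (rule member_le_sum[of l "{..<3}" ?c]) (use assms in \<open>auto intro!: sum_nonneg\<close>)
  then have "?c l * frob M T Y \<le> cu * frob M T Y" by (intro mult_right_mono) (auto simp: frob_def intro!: sum_nonneg)
  then show ?thesis using stream_energy[OF assms(1), of "u l"] unfolding user_stream_def by (rule order.trans[rotated])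
qed

lemma relay_out_energy:
  "frob N T (relay_out T \<alpha> Y) \<le> \<alpha>\<^sup>2 * cE * (\<Sum>j\<in>R. \<Sum>b<T div S. (cmod (relay_stream Y j b))\<^sup>2)"
proof -
  have "frob N T (relay_out T \<alpha> Y)
     = (\<Sum>q\<in>{..<N} \<times> {..<S}. \<Sum>b<T div S. (cmod (of_real \<alpha> * (\<Sum>j\<in>R. E j (fst q) (snd q) * relay_stream Y j b)))\<^sup>2)"
    unfolding relay_out_def by (rule frob_block_eq) (use S in auto)
  also have "\<dots> = \<alpha>\<^sup>2 * (\<Sum>q\<in>{..<N} \<times> {..<S}. \<Sum>b<T div S. (cmod (\<Sum>j\<in>R. E j (fst q) (snd q) * relay_stream Y j b))\<^sup>2)"
    by (simp only: norm_mult power_mult_distrib norm_of_real power2_abs sum_distrib_left[of "\<alpha>\<^sup>2"])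
  also have "\<dots> \<le> \<alpha>\<^sup>2 * (cE * (\<Sum>j\<in>R. \<Sum>b<T div S. (cmod (relay_stream Y j b))\<^sup>2))"
    unfolding cE_def by (intro mult_left_mono energy_product) auto
  finally show ?thesis by (simp add: mult.assoc)
qed

lemma symb_energy:
  assumes "cb p m (j, b, False) < q" "cb p m (j, b, True) < q"
  shows "(cmod (symb cb p m j b))\<^sup>2 \<le> 2 * s2 * (real q)\<^sup>2"
proof -
  have "(cmod (symb cb p m j b))\<^sup>2 = s2 * ((real (cb p m (j, b, False)))\<^sup>2 + (real (cb p m (j, b, True)))\<^sup>2)"
    using s2 by (simp add: symb_def norm_mult power_mult_distrib cmod_power2)
  also have "\<dots> \<le> s2 * ((real q)\<^sup>2 + (real q)\<^sup>2)"
    using s2 assms by (intro mult_left_mono add_mono power_mono) auto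
  finally show ?thesis by (simp add: mult_ac)
qed

lemma peer_pair:
  assumes "k < 3" "j \<in> R" "\<beta> j \<noteq> k"
  shows "(k, peer k j) \<in> pairs 3" "j \<in> streams (k, peer k j)"
proof -
  have "\<beta> j < 3" using \<beta> assms(2) .
  then have "peer k j < 3 \<and> peer k j \<noteq> k \<and> peer k j \<noteq> \<beta> j" unfolding peer_def using assms(1,3) by arith
  then show "(k, peer k j) \<in> pairs 3" "j \<in> streams (k, peer k j)"
    using assms by (auto simp: pairs_def streams_def)
qed

lemma block_index_less:
  assumes "b < T div S" "s < S" shows "b * S + s < T div S * S"
proof -
  have "b * S + s < Suc b * S" using assms(2) by simp
  also have "\<dots> \<le> T div S * S" using assms(1) by (intro mult_le_mono1) simp
  finally show ?thesis .
qed

lemma relay_stream_rx: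
  assumes c: "c = af_code T P \<alpha> thr sz cb" and j: "j \<in> R" and b: "b < T div S"
  shows "relay_stream (relay_rx 3 M N T H c w z) j b
    = (\<Sum>k\<in>{..<3} - {\<beta> j}. symb cb (k, peer k j) (w (k, peer k j)) j b) + relay_stream (\<lambda>i t. z (0, i, t)) j b"
proof -
  let ?\<sigma> = "\<lambda>k j. symb cb (k, peer k j) (w (k, peer k j)) j b"
  let ?sig = "\<lambda>i s. \<Sum>k<3. \<Sum>a<M. H k i a * (\<Sum>j\<in>{j\<in>R. \<beta> j \<noteq> k}. x k j a s * ?\<sigma> k j)"
  have rx: "relay_rx 3 M N T H c w z i (b * S + s) = ?sig i s + z (0, i, b * S + s)" if "i < N" "s < S" for i s
  proof -
    have "b * S + s < T div S * S" "(b * S + s) mod S = s" "(b * S + s) div S = b"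
      using block_index_less[OF b that(2)] that(2) by auto
    moreover from this(1) have "b * S + s < T" using div_times_less_eq_dividend[of T S] by linarith
    ultimately show ?thesis using that
      by (simp add: relay_rx_def trunc_def mmul_def c af_code_def own_def)
  qed
  have "relay_stream (relay_rx 3 M N T H c w z) j b
     = (\<Sum>i<N. \<Sum>s<S. A j i s * ?sig i s) + relay_stream (\<lambda>i t. z (0, i, t)) j b"
    unfolding relay_stream_def by (simp add: rx distrib_left sum.distrib)
  then show ?thesis using uplink_collapse[OF j, of ?\<sigma>] by simp
qed

lemma user_stream_rx:
  assumes c: "c = af_code T P \<alpha> thr sz cb" and l: "l < 3" and j: "j \<in> R" "\<beta> j \<noteq> l" and b: "b < T div S"
    and noclip: "frob N T (relay_out T \<alpha> (relay_rx 3 M N T H c w z)) \<le> real T * P"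
  shows "user_stream l (user_rx 3 M N T H G c w z l) j b
    = of_real \<alpha> * relay_stream (relay_rx 3 M N T H c w z) j b + user_stream l (\<lambda>a t. z (Suc l, a, t)) j b"
proof -
  let ?Y = "relay_rx 3 M N T H c w z"
  have relay: "code_relay c ?Y = relay_out T \<alpha> ?Y" using noclip by (simp add: c af_code_def)
  have rx: "user_rx 3 M N T H G c w z l a (b * S + s)
     = of_real \<alpha> * (\<Sum>i<N. G l a i * (\<Sum>j'\<in>R. E j' i s * relay_stream ?Y j' b)) + z (Suc l, a, b * S + s)" if "a < M" "s < S" for a s
  proof -
    have "b * S + s < T div S * S" "(b * S + s) mod S = s" "(b * S + s) div S = b"
      using block_index_less[OF b that(2)] that(2) by auto
    moreover from this(1) have "b * S + s < T" using div_times_less_eq_dividend[of T S] by linarith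
    ultimately have "user_rx 3 M N T H G c w z l a (b * S + s)
      = (\<Sum>i<N. G l a i * (of_real \<alpha> * (\<Sum>j'\<in>R. E j' i s * relay_stream ?Y j' b))) + z (Suc l, a, b * S + s)"
      using that by (simp add: user_rx_def trunc_def mmul_def relay relay_out_def)
    also have "(\<Sum>i<N. G l a i * (of_real \<alpha> * (\<Sum>j'\<in>R. E j' i s * relay_stream ?Y j' b)))
      = of_real \<alpha> * (\<Sum>i<N. G l a i * (\<Sum>j'\<in>R. E j' i s * relay_stream ?Y j' b))"
      by (rule sum_mult_scaled)
    finally show ?thesis .
  qed
  let ?g = "\<lambda>a s. \<Sum>i<N. G l a i * (\<Sum>j'\<in>R. E j' i s * relay_stream ?Y j' b)"
  have "user_stream l (user_rx 3 M N T H G c w z l) j b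
    = (\<Sum>a<M. \<Sum>s<S. u l j a s * (of_real \<alpha> * ?g a s)) + user_stream l (\<lambda>a t. z (Suc l, a, t)) j b"
    unfolding user_stream_def by (simp add: rx distrib_left sum.distrib)
  also have "(\<Sum>a<M. \<Sum>s<S. u l j a s * (of_real \<alpha> * ?g a s)) = of_real \<alpha> * (\<Sum>a<M. \<Sum>s<S. u l j a s * ?g a s)"
    unfolding sum_mult_scaled by (rule sum_distrib_left[symmetric])
  also have "(\<Sum>a<M. \<Sum>s<S. u l j a s * ?g a s) = relay_stream ?Y j b"
    by (rule downlink_collapse[OF l j])
  finally show ?thesis .
qed

text \<open>Deterministic unique decoding. Effective noise is relay noise plus user noise over
  \<open>\<alpha>\<close>, so its energy is at most \<open>thr\<close> and the true message passes
  the test. A second passing message would lie within squared distance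
  \<open>2 * thr + 2 * thr\<close> of the true codeword, contradicting \<open>sep\<close>.\<close>

lemma decode_correct:
  assumes c: "c = af_code T P \<alpha> thr sz cb" and p: "(k, l) \<in> pairs 3" and w: "w (k, l) < sz (k, l)" and \<alpha>: "0 < \<alpha>"
    and noclip: "frob N T (relay_out T \<alpha> (relay_rx 3 M N T H c w z)) \<le> real T * P"
    and zR: "frob N T (\<lambda>i t. z (0, i, t)) \<le> \<nu>" and zl: "frob M T (\<lambda>a t. z (Suc l, a, t)) \<le> \<nu>"
    and thr: "(2 * cA + 2 * cu / \<alpha>\<^sup>2) * \<nu> \<le> thr"
    and sep: "\<And>m. m < sz (k, l) \<Longrightarrow> m \<noteq> w (k, l) \<Longrightarrow>
      4 * thr < (\<Sum>j\<in>streams (k, l). \<Sum>b<T div S. (cmod (symb cb (k, l) m j b - symb cb (k, l) (w (k, l)) j b))\<^sup>2)"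
  shows "code_dec c l (user_rx 3 M N T H G c w z l) (own l w) k = w (k, l)"
proof -
  let ?B = "T div S" and ?st = "streams (k, l)" and ?m = "w (k, l)"
  let ?Y = "user_rx 3 M N T H G c w z l"
  have kl: "k < 3" "l < 3" "k \<noteq> l" using p by (auto simp: pairs_def)
  have stR: "?st \<subseteq> R" by (auto simp: streams_def)
  define e1 where "e1 j b = relay_stream (\<lambda>i t. z (0, i, t)) j b" for j b
  define e2 where "e2 j b = user_stream l (\<lambda>a t. z (Suc l, a, t)) j b" for j b
  define e where "e j b = e1 j b + e2 j b / of_real \<alpha>" for j b
  let ?s = "symb cb (k, l)"
  have obs: "user_stream l ?Y j b / of_real \<alpha> - symb cb (l, k) (own l w (l, k)) j b - ?s m j b = (?s ?m j b - ?s m j b) + e j b"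
    if j: "j \<in> ?st" and b: "b < ?B" for j b m
  proof -
    have jR: "j \<in> R" "\<beta> j \<noteq> l" using j by (auto simp: streams_def)
    have "user_stream l ?Y j b / of_real \<alpha> = relay_stream (relay_rx 3 M N T H c w z) j b + e2 j b / of_real \<alpha>"
      using user_stream_rx[OF c kl(2) jR b noclip] \<alpha> by (simp add: e2_def add_divide_distrib)
    also have "relay_stream (relay_rx 3 M N T H c w z) j b = ?s ?m j b + symb cb (l, k) (w (l, k)) j b + e1 j b"
      unfolding relay_stream_rx[OF c jR(1) b] peer_eq(3)[OF p j] using kl by (simp add: peer_eq[OF p j] e1_def)
    finally show ?thesis by (simp add: e_def own_def)
  qed
  have res: "residual T \<alpha> cb l ?Y (own l w) k m = (\<Sum>j\<in>?st. \<Sum>b<?B. (cmod ((?s ?m j b - ?s m j b) + e j b))\<^sup>2)" for m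
    unfolding residual_def
    by (rule sum.cong[OF refl], rule sum.cong[OF refl]) (simp only: obs lessThan_iff)
  have mono: "(\<Sum>j\<in>?st. \<Sum>b<?B. f j b) \<le> (\<Sum>j\<in>R. \<Sum>b<?B. f j b)" if "\<And>j b. 0 \<le> f j b" for f :: "'j \<Rightarrow> nat \<Rightarrow> real"
    by (intro sum_mono2 finR stR sum_nonneg that)
  have BT: "?B * S \<le> T" by simp
  have E1: "(\<Sum>j\<in>?st. \<Sum>b<?B. (cmod (e1 j b))\<^sup>2) \<le> cA * \<nu>"
    using mono[of "\<lambda>j b. (cmod (e1 j b))\<^sup>2"] relay_stream_energy[OF BT, of "\<lambda>i t. z (0, i, t)"]
      mult_left_mono[OF zR consts_nonneg(1)] by (simp add: e1_def)
  have E2: "(\<Sum>j\<in>?st. \<Sum>b<?B. (cmod (e2 j b))\<^sup>2) \<le> cu * \<nu>"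
    using mono[of "\<lambda>j b. (cmod (e2 j b))\<^sup>2"] user_stream_energy[OF BT kl(2), of "\<lambda>a t. z (Suc l, a, t)"]
      mult_left_mono[OF zl consts_nonneg(4)] by (simp add: e2_def)
  have "(\<Sum>j\<in>?st. \<Sum>b<?B. (cmod (e j b))\<^sup>2)
     \<le> (\<Sum>j\<in>?st. \<Sum>b<?B. 2 * (cmod (e1 j b))\<^sup>2 + 2 / \<alpha>\<^sup>2 * (cmod (e2 j b))\<^sup>2)"
  proof (intro sum_mono)
    fix j b
    have "(cmod (e j b))\<^sup>2 \<le> 2 * (cmod (e1 j b))\<^sup>2 + 2 * (cmod (e2 j b / of_real \<alpha>))\<^sup>2"
      unfolding e_def by (rule cmod_add_sq_le)
    then show "(cmod (e j b))\<^sup>2 \<le> 2 * (cmod (e1 j b))\<^sup>2 + 2 / \<alpha>\<^sup>2 * (cmod (e2 j b))\<^sup>2"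
      by (simp add: norm_divide power_divide)
  qed
  also have "\<dots> = 2 * (\<Sum>j\<in>?st. \<Sum>b<?B. (cmod (e1 j b))\<^sup>2) + 2 / \<alpha>\<^sup>2 * (\<Sum>j\<in>?st. \<Sum>b<?B. (cmod (e2 j b))\<^sup>2)"
    by (simp only: sum.distrib sum_distrib_left)
  also have "\<dots> \<le> 2 * (cA * \<nu>) + 2 / \<alpha>\<^sup>2 * (cu * \<nu>)"
    using E1 E2 by (intro add_mono mult_left_mono) auto
  also have "\<dots> = (2 * cA + 2 * cu / \<alpha>\<^sup>2) * \<nu>" by (simp add: algebra_simps)
  finally have Ee: "(\<Sum>j\<in>?st. \<Sum>b<?B. (cmod (e j b))\<^sup>2) \<le> thr" using thr by linarith
  have uniq: "m = ?m" if m: "m < sz (k, l)" "residual T \<alpha> cb l ?Y (own l w) k m \<le> thr" for m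
  proof (rule ccontr)
    assume "m \<noteq> ?m"
    from sep[OF m(1) this] have "4 * thr < (\<Sum>j\<in>?st. \<Sum>b<?B. (cmod (?s m j b - ?s ?m j b))\<^sup>2)" .
    also have "\<dots> \<le> (\<Sum>j\<in>?st. \<Sum>b<?B. 2 * (cmod ((?s ?m j b - ?s m j b) + e j b))\<^sup>2 + 2 * (cmod (e j b))\<^sup>2)"
    proof (intro sum_mono)
      fix j b
      have "(cmod (- ((?s ?m j b - ?s m j b) + e j b) + e j b))\<^sup>2
         \<le> 2 * (cmod (- ((?s ?m j b - ?s m j b) + e j b)))\<^sup>2 + 2 * (cmod (e j b))\<^sup>2"
        by (rule cmod_add_sq_le)
      then show "(cmod (?s m j b - ?s ?m j b))\<^sup>2 \<le> 2 * (cmod ((?s ?m j b - ?s m j b) + e j b))\<^sup>2 + 2 * (cmod (e j b))\<^sup>2"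
        unfolding norm_minus_cancel by (simp add: algebra_simps)
    qed
    also have "\<dots> = 2 * residual T \<alpha> cb l ?Y (own l w) k m + 2 * (\<Sum>j\<in>?st. \<Sum>b<?B. (cmod (e j b))\<^sup>2)"
      unfolding res by (simp only: sum.distrib sum_distrib_left)
    also have "\<dots> \<le> 4 * thr" using m(2) Ee by linarith
    finally show False by simp
  qed
  have "(LEAST m. m < sz (k, l) \<and> residual T \<alpha> cb l ?Y (own l w) k m \<le> thr) = ?m"
  proof (rule Least_equality)
    show "?m < sz (k, l) \<and> residual T \<alpha> cb l ?Y (own l w) k ?m \<le> thr"
      using w Ee unfolding res by simp
  qed (use uniq in auto)
  then show ?thesis by (simp add: c af_code_def)
qed

definition bounded_book :: "nat \<Rightarrow> nat \<Rightarrow> (nat \<times> nat \<Rightarrow> nat) \<Rightarrow> 'j codebook \<Rightarrow> bool" where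
  "bounded_book T q sz cb \<longleftrightarrow> (\<forall>p\<in>pairs 3. \<forall>m<sz p. \<forall>j\<in>streams p. \<forall>b<T div S. \<forall>h. cb p m (j, b, h) < q)"

lemma sent_symbol_energy:
  assumes bb: "bounded_book T q sz cb" and w: "w \<in> msg_set 3 sz" and k: "k < 3" "j \<in> R" "\<beta> j \<noteq> k" and b: "b < T div S"
  shows "(cmod (symb cb (k, peer k j) (w (k, peer k j)) j b))\<^sup>2 \<le> 2 * s2 * (real q)\<^sup>2"
  using bb w peer_pair[OF k] b unfolding bounded_book_def msg_set_def
  by (intro symb_energy) (simp_all del: split_paired_All)

lemma enc_power:
  assumes c: "c = af_code T P \<alpha> thr sz cb" and bb: "bounded_book T q sz cb" and w: "w \<in> msg_set 3 sz" and k: "k < 3"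
  shows "frob M T (code_enc c k (own k w)) \<le> cx * (real (card R) * real (T div S) * (2 * s2 * (real q)\<^sup>2))"
proof -
  let ?B = "T div S" and ?Rk = "{j\<in>R. \<beta> j \<noteq> k}"
  let ?\<sigma> = "\<lambda>j b. symb cb (k, peer k j) (w (k, peer k j)) j b"
  have "frob M T (code_enc c k (own k w)) = (\<Sum>q\<in>{..<M} \<times> {..<S}. \<Sum>b<?B. (cmod (\<Sum>j\<in>?Rk. x k j (fst q) (snd q) * ?\<sigma> j b))\<^sup>2)"
    unfolding c af_code_def mrc_code.simps own_def fst_conv simp_thms if_True
    by (rule frob_block_eq) (use S in auto)
  also have "\<dots> \<le> (\<Sum>q\<in>{..<M} \<times> {..<S}. \<Sum>j\<in>?Rk. (cmod (x k j (fst q) (snd q)))\<^sup>2) * (\<Sum>j\<in>?Rk. \<Sum>b<?B. (cmod (?\<sigma> j b))\<^sup>2)"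
    by (rule energy_product)
  also have "\<dots> \<le> cx * (real (card R) * real ?B * (2 * s2 * (real q)\<^sup>2))"
  proof (intro mult_mono consts_nonneg sum_nonneg)
    have "(\<Sum>q\<in>{..<M} \<times> {..<S}. \<Sum>j\<in>?Rk. (cmod (x k j (fst q) (snd q)))\<^sup>2) \<le> (\<Sum>q\<in>{..<M} \<times> {..<S}. \<Sum>j\<in>R. (cmod (x k j (fst q) (snd q)))\<^sup>2)"
      by (intro sum_mono sum_mono2 finR) auto
    also have "\<dots> \<le> cx" unfolding cx_def
      by (rule member_le_sum[of k "{..<3}" "\<lambda>k. \<Sum>q\<in>{..<M} \<times> {..<S}. \<Sum>j\<in>R. (cmod (x k j (fst q) (snd q)))\<^sup>2"])
         (use k in \<open>auto intro!: sum_nonneg\<close>)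
    finally show "(\<Sum>q\<in>{..<M} \<times> {..<S}. \<Sum>j\<in>?Rk. (cmod (x k j (fst q) (snd q)))\<^sup>2) \<le> cx" .
    have "(\<Sum>j\<in>?Rk. \<Sum>b<?B. (cmod (?\<sigma> j b))\<^sup>2) \<le> (\<Sum>j\<in>?Rk. \<Sum>b<?B. 2 * s2 * (real q)\<^sup>2)"
      by (intro sum_mono sent_symbol_energy[OF bb w k]) auto
    also have "\<dots> = real (card ?Rk) * (real ?B * (2 * s2 * (real q)\<^sup>2))" by simp
    also have "\<dots> \<le> real (card R) * (real ?B * (2 * s2 * (real q)\<^sup>2))"
      using finR s2 by (intro mult_right_mono) (auto intro: card_mono)
    finally show "(\<Sum>j\<in>?Rk. \<Sum>b<?B. (cmod (?\<sigma> j b))\<^sup>2) \<le> real (card R) * real ?B * (2 * s2 * (real q)\<^sup>2)"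
      by (simp only: mult.assoc)
  qed auto
  finally show ?thesis .
qed

text \<open>The \<open>36\<close> is \<open>2 * 9 * 2\<close>: splitting off the noise doubles the
  signal term, the sum of symbols is bounded by three amplitudes, and a symbol has energy at most
  \<open>2 * s2 * q\<^sup>2\<close>.\<close>

lemma relay_power:
  assumes c: "c = af_code T P \<alpha> thr sz cb" and bb: "bounded_book T q sz cb" and w: "w \<in> msg_set 3 sz"
    and zR: "frob N T (\<lambda>i t. z (0, i, t)) \<le> \<nu>"
  shows "frob N T (relay_out T \<alpha> (relay_rx 3 M N T H c w z))
    \<le> \<alpha>\<^sup>2 * cE * (36 * real (card R) * real (T div S) * s2 * (real q)\<^sup>2 + 2 * cA * \<nu>)"
proof -
  let ?B = "T div S" and ?Y = "relay_rx 3 M N T H c w z"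
  let ?\<sigma> = "\<lambda>k j b. symb cb (k, peer k j) (w (k, peer k j)) j b"
  let ?e = "relay_stream (\<lambda>i t. z (0, i, t))"
  let ?\<tau> = "2 * s2 * (real q)\<^sup>2"
  have one: "(cmod (relay_stream ?Y j b))\<^sup>2 \<le> 18 * ?\<tau> + 2 * (cmod (?e j b))\<^sup>2" if j: "j \<in> R" and b: "b < ?B" for j b
  proof -
    have cm: "cmod (?\<sigma> k j b) \<le> sqrt ?\<tau>" if "k \<in> {..<3} - {\<beta> j}" for k
      using sent_symbol_energy[OF bb w _ j _ b, of k] that by (intro real_le_rsqrt) auto
    have "cmod (\<Sum>k\<in>{..<3} - {\<beta> j}. ?\<sigma> k j b) \<le> (\<Sum>k\<in>{..<3} - {\<beta> j}. sqrt ?\<tau>)"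
      by (rule order.trans[OF norm_sum]) (intro sum_mono cm)
    also have "\<dots> \<le> (\<Sum>k<3::nat. sqrt ?\<tau>)" by (intro sum_mono2) (use s2 in auto)
    finally have "cmod (\<Sum>k\<in>{..<3} - {\<beta> j}. ?\<sigma> k j b) \<le> 3 * sqrt ?\<tau>" by simp
    then have "(cmod (\<Sum>k\<in>{..<3} - {\<beta> j}. ?\<sigma> k j b))\<^sup>2 \<le> (3 * sqrt ?\<tau>)\<^sup>2" by (intro power_mono) auto
    also have "\<dots> = 9 * ?\<tau>" using s2 by (simp add: power_mult_distrib)
    finally show ?thesis
      using cmod_add_sq_le[of "\<Sum>k\<in>{..<3} - {\<beta> j}. ?\<sigma> k j b" "?e j b"] unfolding relay_stream_rx[OF c j b] by linarith
  qed
  have "(\<Sum>j\<in>R. \<Sum>b<?B. (cmod (relay_stream ?Y j b))\<^sup>2) \<le> (\<Sum>j\<in>R. \<Sum>b<?B. 18 * ?\<tau> + 2 * (cmod (?e j b))\<^sup>2)"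
    by (intro sum_mono one) auto
  also have "\<dots> = real (card R) * (real ?B * (18 * ?\<tau>)) + 2 * (\<Sum>j\<in>R. \<Sum>b<?B. (cmod (?e j b))\<^sup>2)"
    by (simp add: sum.distrib sum_distrib_left)
  also have "(\<Sum>j\<in>R. \<Sum>b<?B. (cmod (?e j b))\<^sup>2) \<le> cA * \<nu>"
    using relay_stream_energy[of ?B T "\<lambda>i t. z (0, i, t)"] mult_left_mono[OF zR consts_nonneg(1)] by simp
  finally have "(\<Sum>j\<in>R. \<Sum>b<?B. (cmod (relay_stream ?Y j b))\<^sup>2) \<le> real (card R) * (real ?B * (18 * ?\<tau>)) + 2 * (cA * \<nu>)" by simp
  then have "\<alpha>\<^sup>2 * cE * (\<Sum>j\<in>R. \<Sum>b<?B. (cmod (relay_stream ?Y j b))\<^sup>2) \<le> \<alpha>\<^sup>2 * cE * (real (card R) * (real ?B * (18 * ?\<tau>)) + 2 * (cA * \<nu>))"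
    by (intro mult_left_mono mult_nonneg_nonneg consts_nonneg) auto
  also have "\<dots> = \<alpha>\<^sup>2 * cE * (36 * real (card R) * real ?B * s2 * (real q)\<^sup>2 + 2 * cA * \<nu>)" by (simp add: mult_ac)
  finally show ?thesis using relay_out_energy[of T \<alpha> ?Y] by linarith
qed

section \<open>Measurability of the error events\<close>

lemma relay_rx_measurable:
  "(\<lambda>z. relay_rx 3 M N T H c w z i t) \<in> borel_measurable (noise_meas 3 M N T s2)"
proof (cases "i < N \<and> t < T")
  case True
  then have "(0, i, t) \<in> noise_idx 3 M N T" by (auto simp: noise_idx_def)
  then have "(\<lambda>z. z (0, i, t)) \<in> borel_measurable (noise_meas 3 M N T s2)"
    unfolding noise_meas_def
    using measurable_component_singleton[of "(0, i, t)" "noise_idx 3 M N T" "\<lambda>_. cgauss s2"]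
    by (simp add: measurable_cong_sets[OF refl sets_cgauss])
  then show ?thesis using True unfolding relay_rx_def trunc_def by simp
next
  case False
  then have "(\<lambda>z. relay_rx 3 M N T H c w z i t) = (\<lambda>_. 0)" by (auto simp: relay_rx_def trunc_def fun_eq_iff)
  then show ?thesis by simp
qed

lemma user_rx_measurable:
  assumes l: "l < 3" and c: "c = af_code T P \<alpha> thr sz cb"
  shows "(\<lambda>z. user_rx 3 M N T H G c w z l a t) \<in> borel_measurable (noise_meas 3 M N T s2)"
proof (cases "a < M \<and> t < T")
  case True
  let ?Q = "noise_meas 3 M N T s2"
  let ?Y = "\<lambda>z. relay_rx 3 M N T H c w z"
  note [measurable] = relay_rx_measurable
  have "(Suc l, a, t) \<in> noise_idx 3 M N T" using True l by (auto simp: noise_idx_def)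
  then have z[measurable]: "(\<lambda>z. z (Suc l, a, t)) \<in> borel_measurable ?Q"
    unfolding noise_meas_def
    using measurable_component_singleton[of "(Suc l, a, t)" "noise_idx 3 M N T" "\<lambda>_. cgauss s2"]
    by (simp add: measurable_cong_sets[OF refl sets_cgauss])
  have [measurable]: "(\<lambda>z. relay_stream (?Y z) j b) \<in> borel_measurable ?Q" for j b
    unfolding relay_stream_def by measurable
  have out[measurable]: "(\<lambda>z. relay_out T \<alpha> (?Y z) i t) \<in> borel_measurable ?Q" for i t
    unfolding relay_out_def by measurable
  have [measurable]: "(\<lambda>z. frob N T (relay_out T \<alpha> (?Y z))) \<in> borel_measurable ?Q"
    unfolding frob_def by measurable
  have "(\<lambda>z. code_relay c (?Y z) i t) = (\<lambda>z. if frob N T (relay_out T \<alpha> (?Y z)) \<le> real T * P then relay_out T \<alpha> (?Y z) i t else 0)" for i t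
    by (auto simp: c af_code_def)
  then have [measurable]: "(\<lambda>z. code_relay c (?Y z) i t) \<in> borel_measurable ?Q" for i t by simp
  show ?thesis using True unfolding user_rx_def trunc_def mmul_def by simp
next
  case False
  then have "(\<lambda>z. user_rx 3 M N T H G c w z l a t) = (\<lambda>_. 0)" by (auto simp: user_rx_def trunc_def fun_eq_iff)
  then show ?thesis by simp
qed

lemma af_err_event_sets:
  assumes c: "c = af_code T P \<alpha> thr sz cb" and p: "p \<in> pairs 3"
  shows "err_event 3 M N T s2 H G c w p \<in> sets (noise_meas 3 M N T s2)"
proof -
  obtain k l where kl: "p = (k, l)" "l < 3" using p by (auto simp: pairs_def)
  let ?Q = "noise_meas 3 M N T s2"
  note [measurable] = user_rx_measurable[OF kl(2) c]
  have [measurable]: "(\<lambda>z. residual T \<alpha> cb l (user_rx 3 M N T H G c w z l) (own l w) k m) \<in> borel_measurable ?Q" for m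
    unfolding residual_def user_stream_def by measurable
  have "(\<lambda>z. code_dec c l (user_rx 3 M N T H G c w z l) (own l w) k) \<in> measurable ?Q (count_space UNIV)"
    \<comment> \<open>The decoder is unfolded, then the copies of the code inside
      \<open>user_rx\<close> are folded back to \<open>c\<close>, so that the measurability facts
      about \<open>c\<close> apply.\<close>
    unfolding c af_code_def mrc_code.simps unfolding c[symmetric, unfolded af_code_def] by measurable
  then have "{z \<in> space ?Q. code_dec c l (user_rx 3 M N T H G c w z l) (own l w) k \<noteq> w p} \<in> sets ?Q"
    by measurable
  then show ?thesis by (simp add: err_event_def kl)
qed

end

section \<open>Number and total energy of the noise coordinates\<close>

lemma card_noise_idx_le: "card (noise_idx K M N T) \<le> (K + 1) * max M N * T"
proof -
  have "noise_idx K M N T \<subseteq> {..K} \<times> {..<max M N} \<times> {..<T}" by (auto simp: noise_idx_def)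
  then have "card (noise_idx K M N T) \<le> card ({..K} \<times> {..<max M N} \<times> {..<T})" by (intro card_mono) auto
  then show ?thesis by (simp add: card_cartesian_product distrib_right)
qed

lemma card_noise_idx_ge:
  assumes "0 < N" shows "T \<le> card (noise_idx K M N T)"
proof -
  have "inj_on (\<lambda>t. (0::nat, 0::nat, t)) {..<T}" by (auto simp: inj_on_def)
  then have "card ((\<lambda>t. (0::nat, 0::nat, t)) ` {..<T}) = T" by (simp add: card_image)
  moreover have "card ((\<lambda>t. (0::nat, 0::nat, t)) ` {..<T}) \<le> card (noise_idx K M N T)"
    by (intro card_mono finite_noise_idx) (use assms in \<open>auto simp: noise_idx_def\<close>)
  ultimately show ?thesis by simp
qed

lemma frob_noise_le:
  shows "frob N T (\<lambda>i t. z (0, i, t)) \<le> (\<Sum>i\<in>noise_idx K M N T. (cmod (z i))\<^sup>2)"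
    and "l < K \<Longrightarrow> frob M T (\<lambda>i t. z (Suc l, i, t)) \<le> (\<Sum>i\<in>noise_idx K M N T. (cmod (z i))\<^sup>2)"
proof -
  have *: "frob n T (\<lambda>i t. z (e, i, t)) \<le> (\<Sum>i\<in>noise_idx K M N T. (cmod (z i))\<^sup>2)"
    if "(\<lambda>(i, t). (e, i, t)) ` ({..<n} \<times> {..<T}) \<subseteq> noise_idx K M N T" for e n
  proof -
    have inj: "inj_on (\<lambda>(i, t). (e, i, t)) ({..<n} \<times> {..<T})" by (auto simp: inj_on_def)
    have "frob n T (\<lambda>i t. z (e, i, t)) = (\<Sum>i\<in>(\<lambda>(i, t). (e, i, t)) ` ({..<n} \<times> {..<T}). (cmod (z i))\<^sup>2)"
      unfolding frob_def by (subst sum.reindex[OF inj]) (simp add: sum.cartesian_product case_prod_beta)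
    also have "\<dots> \<le> (\<Sum>i\<in>noise_idx K M N T. (cmod (z i))\<^sup>2)"
      by (intro sum_mono2 finite_noise_idx that) auto
    finally show ?thesis .
  qed
  show "frob N T (\<lambda>i t. z (0, i, t)) \<le> (\<Sum>i\<in>noise_idx K M N T. (cmod (z i))\<^sup>2)"
    by (rule *) (auto simp: noise_idx_def)
  show "frob M T (\<lambda>i t. z (Suc l, i, t)) \<le> (\<Sum>i\<in>noise_idx K M N T. (cmod (z i))\<^sup>2)" if "l < K"
    by (rule *) (use that in \<open>auto simp: noise_idx_def\<close>)
qed

section \<open>The degrees of freedom\<close>

context relay_scheme
begin

text \<open>\<open>cI\<close> bounds the number of noise coordinates per channel use: relay and
  three users. Typical noise has energy at most \<open>2 * s2 * cI * T\<close>; \<open>gain\<close>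
  keeps the relay below its power limit for such noise, and \<open>\<rho>\<close> is the resulting
  effective noise per channel use in units of \<open>s2\<close>. \<open>\<kappa>\<close> is the
  share of SNR available to \<open>q\<^sup>2\<close>. The summands \<open>1\<close> keep the
  denominators positive.\<close>

definition cI :: real where "cI = 4 * real (max M N)"
definition gain :: real where "gain = 1 / sqrt (1 + cE * (36 * real (card R) + 4 * cA * cI))"
definition \<rho> :: real where "\<rho> = (2 * cA + 2 * cu / gain\<^sup>2) * (2 * cI)"
definition \<kappa> :: real where "\<kappa> = 1 / (1 + 2 * cx * real (card R))"

lemma cI_nonneg: "0 \<le> cI"
  by (simp add: cI_def)

lemma gain_facts: "0 < gain" "gain\<^sup>2 * cE * (36 * real (card R) + 4 * cA * cI) \<le> 1"
proof -
  let ?y = "cE * (36 * real (card R) + 4 * cA * cI)"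
  have y: "0 \<le> ?y" using consts_nonneg cI_nonneg by (intro mult_nonneg_nonneg add_nonneg_nonneg) auto
  then show "0 < gain" by (simp add: gain_def)
  have "gain\<^sup>2 = 1 / (1 + ?y)" using y by (simp add: gain_def power_divide)
  then have "gain\<^sup>2 * ?y \<le> 1" using y by (simp add: divide_le_eq)
  then show "gain\<^sup>2 * cE * (36 * real (card R) + 4 * cA * cI) \<le> 1" by (simp only: mult.assoc)
qed

lemma \<rho>_nonneg: "0 \<le> \<rho>"
  using consts_nonneg cI_nonneg by (simp add: \<rho>_def)

lemma \<kappa>_facts: "0 < \<kappa>" "\<kappa> \<le> 1" "2 * cx * real (card R) * \<kappa> \<le> 1"
proof -
  define y where "y = 2 * cx * real (card R)"
  have y: "0 \<le> y" using consts_nonneg by (simp add: y_def)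
  then have "0 < 1 / (1 + y)" "1 / (1 + y) \<le> 1" "y * (1 / (1 + y)) \<le> 1" by (simp_all add: divide_le_eq)
  then show "0 < \<kappa>" "\<kappa> \<le> 1" "2 * cx * real (card R) * \<kappa> \<le> 1" by (simp_all only: \<kappa>_def y_def)
qed

lemma symb_distance:
  "(\<Sum>j\<in>J. \<Sum>b<B. (cmod (symb cb p m j b - symb cb p m' j b))\<^sup>2)
    = s2 * (\<Sum>i\<in>J \<times> {..<B} \<times> UNIV. (real (cb p m i) - real (cb p m' i))\<^sup>2)"
proof -
  have "(cmod (symb cb p m j b - symb cb p m' j b))\<^sup>2 = s2 * (\<Sum>h\<in>UNIV. (real (cb p m (j, b, h)) - real (cb p m' (j, b, h)))\<^sup>2)" for j b
    using s2 by (simp add: symb_def right_diff_distrib[symmetric] norm_mult power_mult_distrib cmod_power2 UNIV_bool add.commute)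
  then have "(\<Sum>j\<in>J. \<Sum>b<B. (cmod (symb cb p m j b - symb cb p m' j b))\<^sup>2)
     = s2 * (\<Sum>j\<in>J. \<Sum>b<B. \<Sum>h\<in>UNIV. (real (cb p m (j, b, h)) - real (cb p m' (j, b, h)))\<^sup>2)"
    by (simp only: sum_distrib_left)
  also have "(\<Sum>j\<in>J. \<Sum>b<B. \<Sum>h\<in>UNIV. (real (cb p m (j, b, h)) - real (cb p m' (j, b, h)))\<^sup>2)
     = (\<Sum>i\<in>J \<times> {..<B} \<times> UNIV. (real (cb p m i) - real (cb p m' i))\<^sup>2)"
    by (simp only: sum.cartesian_product case_prod_beta prod.collapse) (simp add: case_prod_beta)
  finally show ?thesis .
qed

text \<open>Outside one event of large noise energy the relay is never clipped and every message
  decodes, so the same tail bound serves all pairs and messages.\<close>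

lemma good_code:
  assumes N: "0 < N" and snr: "1 \<le> snr" and q: "1 \<le> q" "(real q)\<^sup>2 \<le> \<kappa> * snr"
  shows "\<exists>c. valid_code 3 M N T (snr * s2) s2 H G c \<and>
    (\<forall>p\<in>pairs 3. real q ^ (2 * card (streams p) * (T div S))
        \<le> real (code_sz c p) * (exp (4 * \<rho> * real T) * 4 ^ (2 * card (streams p) * (T div S)))) \<and>
    (\<forall>p\<in>pairs 3. err_prob 3 M N T s2 H G c p \<le> (2 / exp 1) ^ T)"
proof -
  let ?B = "T div S" and ?P = "snr * s2"
  define I where "I p = streams p \<times> {..<?B} \<times> (UNIV :: bool set)" for p
  have finI: "finite (I p)" for p using finR by (simp add: I_def streams_def)
  have cardI: "card (I p) = 2 * card (streams p) * ?B" for p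
    by (simp add: I_def card_cartesian_product UNIV_bool)
  have D: "0 \<le> 4 * \<rho> * real T" using \<rho>_nonneg by simp
  have "\<forall>p. \<exists>C. finite C \<and> C \<subseteq> I p \<rightarrow>\<^sub>E {..<q} \<and>
      (\<forall>y\<in>C. \<forall>y'\<in>C. y \<noteq> y' \<longrightarrow> 4 * \<rho> * real T < (\<Sum>i\<in>I p. (real (y i) - real (y' i))\<^sup>2)) \<and>
      real q ^ card (I p) \<le> real (card C) * (exp (4 * \<rho> * real T) * 4 ^ card (I p))"
    by (intro allI gilbert_varshamov_grid finI D)
  from choice[OF this] obtain C where "\<forall>p. finite (C p) \<and> C p \<subseteq> I p \<rightarrow>\<^sub>E {..<q} \<and>
      (\<forall>y\<in>C p. \<forall>y'\<in>C p. y \<noteq> y' \<longrightarrow> 4 * \<rho> * real T < (\<Sum>i\<in>I p. (real (y i) - real (y' i))\<^sup>2)) \<and>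
      real q ^ card (I p) \<le> real (card (C p)) * (exp (4 * \<rho> * real T) * 4 ^ card (I p))"
    by (elim exE)
  then have C: "\<And>p. finite (C p)" "\<And>p. C p \<subseteq> I p \<rightarrow>\<^sub>E {..<q}"
      "\<And>p y y'. y \<in> C p \<Longrightarrow> y' \<in> C p \<Longrightarrow> y \<noteq> y' \<Longrightarrow> 4 * \<rho> * real T < (\<Sum>i\<in>I p. (real (y i) - real (y' i))\<^sup>2)"
      "\<And>p. real q ^ card (I p) \<le> real (card (C p)) * (exp (4 * \<rho> * real T) * 4 ^ card (I p))" by (simp_all del: split_paired_All)
  have "\<exists>g. bij_betw g {..<card (C p)} (C p)" for p using bij_betw_enum[OF C(1)] .
  then obtain cb where cb: "\<And>p. bij_betw (cb p) {..<card (C p)} (C p)" by metis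
  define sz where "sz p = card (C p)" for p
  \<comment> \<open>Matched to the packing: squared grid distance \<open>4 * \<rho> * T\<close>
    becomes \<open>4 * thr\<close> after scaling by \<open>sqrt s2\<close>.\<close>
  define thr where "thr = s2 * \<rho> * real T"
  define c where "c = af_code T ?P gain thr sz cb"
  have csz: "code_sz c = sz" by (simp add: c_def af_code_def)
  have cbC: "cb p m \<in> C p" if "m < sz p" for p m using cb[of p] that by (auto simp: bij_betw_def sz_def)
  have bb: "bounded_book T q sz cb" unfolding bounded_book_def
  proof (intro ballI allI impI)
    fix p m j b h assume a: "m < sz p" "j \<in> streams p" "b < ?B"
    have "cb p m \<in> I p \<rightarrow>\<^sub>E {..<q}" by (rule subsetD[OF C(2) cbC[OF a(1)]])
    moreover have "(j, b, h) \<in> I p" using a by (simp add: I_def)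
    ultimately have "cb p m (j, b, h) \<in> {..<q}" by (rule PiE_mem)
    then show "cb p m (j, b, h) < q" by simp
  qed
  have sep: "4 * thr < (\<Sum>j\<in>streams p. \<Sum>b<?B. (cmod (symb cb p m j b - symb cb p m' j b))\<^sup>2)"
    if "m < sz p" "m' < sz p" "m \<noteq> m'" for p m m'
  proof -
    have "cb p m \<noteq> cb p m'" using cb[of p] that by (auto simp: bij_betw_def inj_on_def sz_def)
    then have "s2 * (4 * \<rho> * real T) < s2 * (\<Sum>i\<in>I p. (real (cb p m i) - real (cb p m' i))\<^sup>2)"
      using C(3)[OF cbC[OF that(1)] cbC[OF that(2)]] s2 by (intro mult_strict_left_mono) auto
    then show ?thesis unfolding symb_distance I_def thr_def by (simp add: mult_ac)
  qed
  have BT: "real ?B \<le> real T" by simp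
  have qs: "s2 * (real q)\<^sup>2 \<le> s2 * (\<kappa> * snr)" using q s2 by (intro mult_left_mono) auto
  have q_snr: "(real q)\<^sup>2 \<le> snr"
  proof -
    have "\<kappa> * snr \<le> 1 * snr" using \<kappa>_facts(2) snr by (intro mult_right_mono) auto
    then show ?thesis using q(2) by linarith
  qed
  let ?W = "msg_set 3 sz"
  have enc: "frob M T (code_enc c k (own k w)) \<le> real T * ?P" if "w \<in> ?W" "k < 3" for w k
  proof -
    have "frob M T (code_enc c k (own k w)) \<le> cx * (real (card R) * real ?B * (2 * s2 * (real q)\<^sup>2))"
      by (rule enc_power[OF c_def bb that])
    also have "\<dots> \<le> cx * (real (card R) * real T * (2 * (s2 * (\<kappa> * snr))))"
    proof -
      have "real ?B * (2 * s2 * (real q)\<^sup>2) \<le> real T * (2 * (s2 * (\<kappa> * snr)))"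
        by (rule mult_mono[OF BT]) (use qs s2 in auto)
      then have "(cx * real (card R)) * (real ?B * (2 * s2 * (real q)\<^sup>2)) \<le> (cx * real (card R)) * (real T * (2 * (s2 * (\<kappa> * snr))))"
        using consts_nonneg by (intro mult_left_mono) auto
      then show ?thesis by (simp only: mult.assoc)
    qed
    also have "\<dots> = (2 * cx * real (card R) * \<kappa>) * (real T * ?P)" by (simp add: mult_ac)
    also have "\<dots> \<le> 1 * (real T * ?P)" using \<kappa>_facts(3) s2 snr by (intro mult_right_mono) auto
    finally show ?thesis by simp
  qed
  have relay: "frob N T (code_relay c Y) \<le> real T * ?P" for Y
    using s2 snr by (simp add: c_def af_code_def frob_def)
  have valid: "valid_code 3 M N T ?P s2 H G c"
    unfolding valid_code_def csz using enc relay af_err_event_sets[OF c_def] by blast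
  let ?Q = "PiM (noise_idx 3 M N T) (\<lambda>_. cgauss s2)"
  let ?bad = "{z \<in> space ?Q. 2 * s2 * card (noise_idx 3 M N T) < (\<Sum>i\<in>noise_idx 3 M N T. (cmod (z i))\<^sup>2)}"
  interpret Q: prob_space ?Q by (intro prob_space_PiM prob_space_cgauss s2)
  define \<nu> where "\<nu> = 2 * s2 * (cI * real T)"
  have cardn: "real (card (noise_idx 3 M N T)) \<le> cI * real T"
    using of_nat_mono[OF card_noise_idx_le[of 3 M N T], where 'a = real] by (simp add: cI_def)
  have err: "err_event 3 M N T s2 H G c w p \<subseteq> ?bad" if w: "w \<in> ?W" and p: "p \<in> pairs 3" for w p
  proof
    fix z assume z: "z \<in> err_event 3 M N T s2 H G c w p"
    obtain k l where kl: "p = (k, l)" "l < 3" using p by (auto simp: pairs_def)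
    have zs: "z \<in> space ?Q" using z by (auto simp: err_event_def noise_meas_def)
    show "z \<in> ?bad"
    proof (rule ccontr)
      assume "z \<notin> ?bad"
      then have "(\<Sum>i\<in>noise_idx 3 M N T. (cmod (z i))\<^sup>2) \<le> 2 * s2 * card (noise_idx 3 M N T)" using zs by auto
      also have "\<dots> \<le> \<nu>" unfolding \<nu>_def using cardn s2 by (intro mult_left_mono) auto
      finally have E: "(\<Sum>i\<in>noise_idx 3 M N T. (cmod (z i))\<^sup>2) \<le> \<nu>" .
      have zR: "frob N T (\<lambda>i t. z (0, i, t)) \<le> \<nu>" using frob_noise_le(1)[of N T z 3 M] E by linarith
      have zl: "frob M T (\<lambda>a t. z (Suc l, a, t)) \<le> \<nu>" using frob_noise_le(2)[OF kl(2), of M T z N] E by linarith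
      have "frob N T (relay_out T gain (relay_rx 3 M N T H c w z))
         \<le> gain\<^sup>2 * cE * (36 * real (card R) * real ?B * s2 * (real q)\<^sup>2 + 2 * cA * \<nu>)"
        by (rule relay_power[OF c_def bb w zR])
      \<comment> \<open>Since \<open>1 \<le> snr\<close>, the noise term may be inflated by
        \<open>snr\<close>; both terms are then multiples of the power and one gain works at every
        such SNR.\<close>
      also have "\<dots> \<le> gain\<^sup>2 * cE * (36 * real (card R) * real T * s2 * snr + 2 * cA * (\<nu> * snr))"
      proof (intro mult_left_mono add_mono mult_mono mult_nonneg_nonneg consts_nonneg)
        have "0 \<le> \<nu>" using s2 cI_nonneg by (simp add: \<nu>_def)
        then show "\<nu> \<le> \<nu> * snr" using mult_left_mono[OF snr, of \<nu>] by simp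
      qed (use BT q_snr s2 consts_nonneg in auto)
      also have "\<dots> = (gain\<^sup>2 * cE * (36 * real (card R) + 4 * cA * cI)) * (real T * ?P)"
        by (simp add: \<nu>_def algebra_simps)
      also have "\<dots> \<le> 1 * (real T * ?P)" using gain_facts(2) s2 snr by (intro mult_right_mono) auto
      finally have noclip: "frob N T (relay_out T gain (relay_rx 3 M N T H c w z)) \<le> real T * ?P" by simp
      have wp: "w p' < sz p'" if "p' \<in> pairs 3" for p' using w that by (simp add: msg_set_def del: split_paired_All)
      have "code_dec c l (user_rx 3 M N T H G c w z l) (own l w) k = w (k, l)"
      proof (rule decode_correct[OF c_def _ _ gain_facts(1) noclip zR zl])
        show "(2 * cA + 2 * cu / gain\<^sup>2) * \<nu> \<le> thr" by (simp add: \<nu>_def thr_def \<rho>_def)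
        show "(k, l) \<in> pairs 3" "w (k, l) < sz (k, l)" using p wp kl by auto
        then show "4 * thr < (\<Sum>j\<in>streams (k, l). \<Sum>b<?B. (cmod (symb cb (k, l) m j b - symb cb (k, l) (w (k, l)) j b))\<^sup>2)"
          if "m < sz (k, l)" "m \<noteq> w (k, l)" for m using sep that by auto
      qed
      then show False using z by (simp add: err_event_def kl)
    qed
  qed
  have bad: "?bad \<in> sets ?Q" by measurable
  have e2: "2 / exp 1 \<le> (1::real)" using exp_ge_add_one_self[of 1] by simp
  have "err_prob 3 M N T s2 H G c p \<le> (2 / exp 1) ^ T" if p: "p \<in> pairs 3" for p
  proof (rule err_prob_le[OF s2])
    fix w assume "w \<in> msg_set 3 (code_sz c)"
    then have "measure ?Q (err_event 3 M N T s2 H G c w p) \<le> measure ?Q ?bad"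
      using err[OF _ p] csz bad by (intro Q.finite_measure_mono) auto
    also have "\<dots> \<le> (2 / exp 1) ^ card (noise_idx 3 M N T)" by (rule cgauss_energy_tail[OF finite_noise_idx s2])
    also have "\<dots> \<le> (2 / exp 1) ^ T"
      by (rule power_decreasing[OF card_noise_idx_ge[OF N]]) (use e2 in auto)
    finally show "measure (noise_meas 3 M N T s2) (err_event 3 M N T s2 H G c w p) \<le> (2 / exp 1) ^ T"
      by (simp add: noise_meas_def)
  qed simp
  then show ?thesis using valid C(4) by (intro exI[of _ c]) (simp add: csz sz_def cardI)
qed

text \<open>Guaranteed bits per real coordinate: \<open>q\<close> is about
  \<open>sqrt (\<kappa> * snr)\<close>, rounding it down costs at most one bit, and the factor
  \<open>4\<close> per coordinate in the packing bound costs two.\<close>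

definition base_rate :: "real \<Rightarrow> real" where "base_rate snr = log 2 (\<kappa> * snr) / 2 - 3"

text \<open>A pair uses two real coordinates per stream and block. The term
  \<open>4 * \<rho> / ln 2\<close> pays for the packing radius and \<open>1\<close> for an
  incomplete last block. From \<open>4 / \<kappa>\<close> on, \<open>sqrt (\<kappa> * snr)\<close>
  is at least \<open>2\<close>, so the floor loses at most half.\<close>

definition rate :: "real \<Rightarrow> nat \<times> nat \<Rightarrow> real" where
  "rate snr p = (if snr < 4 / \<kappa> then 0
     else max 0 (2 * real (card (streams p)) / real S * base_rate snr - 4 * \<rho> / ln 2 - 1))"

lemma rate_achievable:
  assumes N: "0 < N" and snr: "0 < snr"
  shows "achievable_rates 3 M N (snr * s2) s2 H G (rate snr)"
proof (cases "snr < 4 / \<kappa>")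
  case True
  then have "rate snr = (\<lambda>_. 0)" by (simp add: rate_def fun_eq_iff)
  then show ?thesis using achievable_rates_zero[of "snr * s2" s2] s2 snr by simp
next
  case False
  then have ks: "4 \<le> \<kappa> * snr" using \<kappa>_facts by (simp add: divide_le_eq not_less mult.commute)
  have "\<kappa> * snr \<le> 1 * snr" using \<kappa>_facts(2) snr by (intro mult_right_mono) auto
  then have snr1: "1 \<le> snr" using ks by linarith
  define q where "q = nat \<lfloor>sqrt (\<kappa> * snr)\<rfloor>"
  have sq2: "2 \<le> sqrt (\<kappa> * snr)" using ks real_sqrt_le_mono[OF ks] by simp
  have q_real: "real q = of_int \<lfloor>sqrt (\<kappa> * snr)\<rfloor>"
  proof -
    have "0 \<le> \<lfloor>sqrt (\<kappa> * snr)\<rfloor>" using ks by simp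
    then show ?thesis unfolding q_def by (rule of_nat_nat)
  qed
  have q_le: "real q \<le> sqrt (\<kappa> * snr)" unfolding q_real by simp
  have q_ge: "sqrt (\<kappa> * snr) / 2 \<le> real q" unfolding q_real using sq2 by linarith
  have q1: "1 \<le> q" using q_ge sq2 by linarith
  have "(real q)\<^sup>2 \<le> (sqrt (\<kappa> * snr))\<^sup>2" using q_le by (intro power_mono) auto
  then have qq: "(real q)\<^sup>2 \<le> \<kappa> * snr" using ks by simp
  have logq: "base_rate snr \<le> log 2 (real q) - 2"
  proof -
    have "log 2 (sqrt (\<kappa> * snr) / 2) \<le> log 2 (real q)"
      by (rule log_mono) (use q_ge sq2 in linarith)+
    moreover have "log 2 (sqrt (\<kappa> * snr) / 2) = log 2 (\<kappa> * snr) / 2 - 1"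
    proof -
      have "log 2 (sqrt (\<kappa> * snr) / 2) = log 2 (sqrt (\<kappa> * snr)) - log 2 2"
        by (rule log_divide_pos) (use sq2 in linarith)+
      also have "log 2 (sqrt (\<kappa> * snr)) = log 2 (\<kappa> * snr) / 2"
        using ks by (simp only: log_def ln_sqrt) simp
      finally show ?thesis by simp
    qed
    ultimately show ?thesis by (simp add: base_rate_def)
  qed
  show ?thesis
  proof (rule achievable_ratesI[where \<delta> = "\<lambda>T. (2 / exp 1) ^ T"])
    show "0 \<le> rate snr p" for p by (simp add: rate_def)
    show "0 \<le> snr * s2" using snr s2 by simp
    have "2 / exp 1 < (1::real)" using exp_gt_one[of 1] ln_2_less_1 by (simp add: divide_less_eq) (metis exp_less_mono exp_ln zero_less_numeral)
    then show "(\<lambda>T. (2 / exp 1 :: real) ^ T) \<longlonglongrightarrow> 0" by (intro LIMSEQ_power_zero) simp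
    let ?L = "base_rate snr"
    show "eventually (\<lambda>T. \<exists>c. valid_code 3 M N T (snr * s2) s2 H G c \<and>
      (\<forall>p\<in>pairs 3. 2 powr (real T * rate snr p) \<le> real (code_sz c p) \<and> err_prob 3 M N T s2 H G c p \<le> (2 / exp 1) ^ T)) sequentially"
      \<comment> \<open>From this length on, the at most one block lost in \<open>T div S\<close> is
        worth no more than \<open>T\<close> bits, which the \<open>1\<close> in \<open>rate\<close>
        covers.\<close>
      using eventually_ge_at_top[of "nat \<lceil>2 * real (card R) * \<bar>?L\<bar>\<rceil>"]
    proof eventually_elim
      case (elim T)
      then have T: "2 * real (card R) * \<bar>?L\<bar> \<le> real T" by linarith
      obtain c where c: "valid_code 3 M N T (snr * s2) s2 H G c"
        "\<And>p. p \<in> pairs 3 \<Longrightarrow> real q ^ (2 * card (streams p) * (T div S))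
            \<le> real (code_sz c p) * (exp (4 * \<rho> * real T) * 4 ^ (2 * card (streams p) * (T div S)))"
        "\<And>p. p \<in> pairs 3 \<Longrightarrow> err_prob 3 M N T s2 H G c p \<le> (2 / exp 1) ^ T"
        using good_code[OF N snr1 q1 qq, of T] by blast
      have "2 powr (real T * rate snr p) \<le> real (code_sz c p)" if p: "p \<in> pairs 3" for p
      proof -
        let ?d = "real (card (streams p))" and ?B = "T div S" and ?n = "2 * card (streams p) * (T div S)"
        let ?sz = "real (code_sz c p)"
        have qn: "0 < real q ^ ?n" using q1 by simp
        then have "0 < ?sz * (exp (4 * \<rho> * real T) * 4 ^ ?n)" using c(2)[OF p] by linarith
        then have sz: "0 < ?sz" by (simp add: zero_less_mult_iff)
        then have sz1: "1 \<le> ?sz" by simp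
        have "log 2 (real q ^ ?n) \<le> log 2 (?sz * (exp (4 * \<rho> * real T) * 4 ^ ?n))"
          using c(2)[OF p] qn sz by (simp del: log_mult log_nat_power)
        also have "\<dots> = log 2 ?sz + 4 * \<rho> * real T / ln 2 + real ?n * 2"
        proof -
          have "log 2 ((4::real) ^ ?n) = real ?n * log 2 (2 ^ 2)" by (subst log_nat_power) auto
          also have "log 2 ((2::real) ^ 2) = 2" by (subst log_nat_power) auto
          finally show ?thesis using sz by (simp add: log_mult log_exp del: log_nat_power)
        qed
        finally have lsz: "real ?n * (log 2 (real q) - 2) - 4 * \<rho> * real T / ln 2 \<le> log 2 ?sz"
          using q1 by (simp add: log_nat_power algebra_simps)
        have dR: "?d \<le> real (card R)" using finR by (auto simp: streams_def intro!: card_mono)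
        have "real T * (2 * ?d / real S * ?L) - real T \<le> real ?n * ?L"
        proof (cases "0 \<le> ?L")
          case True
          have "T < Suc ?B * S" using S dividend_less_div_times[of S T] by simp
          then have "real T \<le> (real ?B + 1) * real S"
            by (metis add.commute less_imp_le of_nat_Suc of_nat_le_iff of_nat_mult)
          then have "real T / real S \<le> real ?B + 1" using S by (simp add: divide_le_eq)
          then have "2 * ?d * ?L * (real T / real S) \<le> 2 * ?d * ?L * (real ?B + 1)"
            using True by (intro mult_left_mono) auto
          moreover have "2 * ?d * ?L \<le> real T"
            using T mult_right_mono[OF dR, of "2 * ?L"] True by (simp add: mult_ac)
          ultimately show ?thesis by (simp add: algebra_simps)
        next
          case False
          have "?B * S \<le> T" by simp
          then have "real ?B * real S \<le> real T" by (metis of_nat_le_iff of_nat_mult)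
          then have "real ?B \<le> real T / real S" using S by (simp add: le_divide_eq)
          then have "2 * ?d * (- ?L) * real ?B \<le> 2 * ?d * (- ?L) * (real T / real S)"
            using False by (intro mult_left_mono mult_nonneg_nonneg) auto
          then have "2 * ?d * ?L * (real T / real S) \<le> 2 * ?d * ?L * real ?B" by simp
          then show ?thesis by (simp add: algebra_simps)
        qed
        also have "\<dots> \<le> real ?n * (log 2 (real q) - 2)" by (rule mult_left_mono[OF logq]) simp
        finally have "real T * (2 * ?d / real S * ?L - 4 * \<rho> / ln 2 - 1) \<le> log 2 ?sz"
          using lsz by (simp add: algebra_simps)
        moreover have "0 \<le> log 2 ?sz" using sz1 by simp
        ultimately have "real T * rate snr p \<le> log 2 ?sz" using False by (auto simp: rate_def max_def)
        then have "2 powr (real T * rate snr p) \<le> 2 powr (log 2 ?sz)" by simp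
        then show ?thesis using sz by simp
      qed
      then show ?case using c by blast
    qed
  qed
qed

text \<open>Each index carries one symbol in both directions between its two users, so it counts for
  two ordered pairs.\<close>

lemma sum_card_streams: "(\<Sum>p\<in>pairs 3. card (streams p)) = 2 * card R"
proof -
  have "(\<Sum>p\<in>pairs 3. card (streams p)) = (\<Sum>p\<in>pairs 3. \<Sum>j\<in>R. if \<beta> j \<noteq> fst p \<and> \<beta> j \<noteq> snd p then 1 else 0)"
    using finR by (simp add: streams_def sum.If_cases Int_def)
  also have "\<dots> = (\<Sum>j\<in>R. \<Sum>p\<in>pairs 3. if \<beta> j \<noteq> fst p \<and> \<beta> j \<noteq> snd p then 1 else 0)" by (rule sum.swap)
  also have "\<dots> = (\<Sum>j\<in>R. 2)"
  proof (rule sum.cong[OF refl])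
    fix j assume "j \<in> R"
    then have "\<beta> j = 0 \<or> \<beta> j = 1 \<or> \<beta> j = 2" using \<beta> by fastforce
    then show "(\<Sum>p\<in>pairs 3. if \<beta> j \<noteq> fst p \<and> \<beta> j \<noteq> snd p then 1 else 0) = (2::nat)"
      by (auto simp: pairs_3)
  qed
  finally show ?thesis by simp
qed

lemma rate_limit: "((\<lambda>snr. (\<Sum>p\<in>pairs 3. rate snr p) / log 2 snr) \<longlongrightarrow> 2 * real (card R) / real S) at_top"
proof -
  have one: "((\<lambda>snr. rate snr p / log 2 snr) \<longlongrightarrow> real (card (streams p)) / real S) at_top" for p
  proof -
    let ?d = "real (card (streams p))"
    \<comment> \<open>All losses independent of SNR; they vanish after division by
      \<open>log 2 snr\<close>.\<close>
    define C where "C = 2 * ?d / real S * (log 2 \<kappa> / 2 - 3) - 4 * \<rho> / ln 2 - 1"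
    have ev: "eventually (\<lambda>snr. max 0 (?d / real S + C / log 2 snr) = rate snr p / log 2 snr) at_top"
      using eventually_gt_at_top[of 1] eventually_ge_at_top[of "4 / \<kappa>"]
    proof eventually_elim
      case (elim snr)
      then have l: "0 < log 2 snr" by simp
      have "log 2 (\<kappa> * snr) = log 2 \<kappa> + log 2 snr" using \<kappa>_facts(1) elim by (simp add: log_mult)
      moreover have "2 * ?d / real S * ((a + b) / 2 - 3) = ?d / real S * b + 2 * ?d / real S * (a / 2 - 3)" for a b
        by (simp add: algebra_simps add_divide_distrib diff_divide_distrib)
      ultimately have "2 * ?d / real S * base_rate snr - 4 * \<rho> / ln 2 - 1 = ?d / real S * log 2 snr + C"
        by (simp only: base_rate_def C_def)
      then have "rate snr p = max 0 (?d / real S * log 2 snr + C)" using elim by (simp add: rate_def)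
      also have "\<dots> = max 0 (?d / real S + C / log 2 snr) * log 2 snr"
        using l by (auto simp: max_def field_simps zero_le_mult_iff)
      finally show ?case using l by simp
    qed
    have "((\<lambda>snr. C / log 2 snr) \<longlongrightarrow> 0) at_top" unfolding log_def by real_asymp
    then have "((\<lambda>snr. max 0 (?d / real S + C / log 2 snr)) \<longlongrightarrow> max 0 (?d / real S + 0)) at_top"
      by (intro tendsto_max tendsto_add tendsto_const)
    then show ?thesis using Lim_transform_eventually[OF _ ev] by simp
  qed
  have "((\<lambda>snr. \<Sum>p\<in>pairs 3. rate snr p / log 2 snr) \<longlongrightarrow> (\<Sum>p\<in>pairs 3. real (card (streams p)) / real S)) at_top"
    by (intro tendsto_sum one)
  moreover have "(\<Sum>p\<in>pairs 3. real (card (streams p)) / real S) = 2 * real (card R) / real S"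
    using sum_card_streams by (simp flip: sum_divide_distrib of_nat_sum)
  ultimately show ?thesis by (simp add: sum_divide_distrib)
qed

end

lemma dof_achievable_at_of_aligned:
  assumes H: "aligned M N S R \<beta> H" and G: "aligned M N S R \<beta> (\<lambda>k i a. G k a i)"
    and R: "finite R" and \<beta>: "\<And>j. j \<in> R \<Longrightarrow> \<beta> j < 3" and S: "0 < S" and N: "0 < N" and s2: "0 < s2"
    and d: "3 * d = 2 * real (card R) / real S"
  shows "dof_achievable_at 3 M N s2 H G d"
proof -
  obtain A x where Ax: "\<And>k j j'. k < 3 \<Longrightarrow> j \<in> R \<Longrightarrow> \<beta> j \<noteq> k \<Longrightarrow> j' \<in> R \<Longrightarrow>
      (\<Sum>i<N. \<Sum>s<S. A j' i s * (\<Sum>a<M. H k i a * x k j a s)) = (if j' = j then 1 else 0)"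
    using H unfolding aligned_def by blast
  obtain E u where Eu: "\<And>k j j'. k < 3 \<Longrightarrow> j \<in> R \<Longrightarrow> \<beta> j \<noteq> k \<Longrightarrow> j' \<in> R \<Longrightarrow>
      (\<Sum>i<N. \<Sum>s<S. E j' i s * (\<Sum>a<M. G k a i * u k j a s)) = (if j' = j then 1 else 0)"
    using G unfolding aligned_def by blast
  interpret relay_scheme M N S R \<beta> H G A E x u s2
    by unfold_locales (use R \<beta> S s2 Ax Eu in auto)
  show ?thesis unfolding dof_achievable_at_def
    by (rule exI[of _ rate]) (use rate_achievable[OF N] rate_limit d in simp)
qed

theorem theorem1:
  fixes M N :: nat and s2 :: real
  assumes "0 < M" and "0 < N" and "0 < s2"
  shows "bdd_above {d. dof_achievable 3 M N s2 d}
       \<and> per_user_dof_capacity 3 M N s2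
           = (if real M / real N < 2 / 3 then real M else 2 * real N / 3)
       \<and> dof_achievable 3 M N s2
           (if real M / real N < 2 / 3 then real M else 2 * real N / 3)"
proof -
  let ?d = "if real M / real N < 2 / 3 then real M else 2 * real N / 3"
  have ach: "dof_achievable 3 M N s2 ?d"
  proof (cases "real M / real N < 2 / 3")
    case True
    then have "3 * M \<le> 2 * N" using assms(2) by (simp add: divide_less_eq)
    from AE_aligned_few_antennas[OF this] show ?thesis
      unfolding dof_achievable_def
    proof eventually_elim
      case (elim v)
      \<comment> \<open>Here \<open>2 * card R / S = 2 * (3 * M) / 2\<close>, three times the
        claimed value.\<close>
      then show ?case using True assms
        by (intro dof_achievable_at_of_aligned[where S = 2 and R = "{..<3} \<times> {..<M}" and \<beta> = fst])
          (auto simp: card_cartesian_product)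
    qed
  next
    case False
    then have "2 * N \<le> 3 * M" using assms(2) by (simp add: divide_less_eq)
    then obtain \<beta> :: "nat \<Rightarrow> nat" where \<beta>: "\<And>r. \<beta> r < 3"
      and AE: "AE v in PiM {..<chan_dim 3 M N} (\<lambda>_. lborel). aligned M N 1 {..<N} \<beta> (chan_H 3 M N v)
       \<and> aligned M N 1 {..<N} \<beta> (\<lambda>k i a. chan_G 3 M N v k a i)"
      by (rule AE_aligned_many_antennas) (rule that; assumption)
    from AE show ?thesis unfolding dof_achievable_def
    proof eventually_elim
      case (elim v)
      then show ?case using False assms \<beta>
        by (intro dof_achievable_at_of_aligned[where S = 1 and R = "{..<N}" and \<beta> = \<beta>]) auto
    qed
  qed
  have le: "d \<le> ?d" if "dof_achievable 3 M N s2 d" for d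
    using dof_achievable_le[OF assms(3) that] by simp
  have "bdd_above {d. dof_achievable 3 M N s2 d}"
    using le by (intro bdd_aboveI[of _ ?d]) auto
  moreover have "per_user_dof_capacity 3 M N s2 = ?d"
    unfolding per_user_dof_capacity_def using ach le by (intro cSup_eq_maximum) auto
  ultimately show ?thesis using ach by blast
qed

end
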